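(* For every positive integer $n$, \[ W_{(2,11)}(n)=-\tfrac5{488}\sigma_3(n)+\tfrac5{366}\sigma_3(\tfrac n2)+\tfrac{137}{1464}\sigma_3(\tfrac n{11})+\tfrac{39}{122}\sigma_3(\tfrac n{22})+(\tfrac1{24}-\tfrac n{44})\sigma(\tfrac n2)+(\tfrac1{24}-\tfrac n8)\sigma(\tfrac n{11})-\tfrac{16}{671}b_1(n)-\tfrac{1241}{5368}b_2(n)-\tfrac{4029}{5368}b_3(n)-\tfrac{668}{671}b_4(n)-\tfrac{362}{671}b_5(n)+\tfrac78b_6(n)+\tfrac3{88}b_7(n). \]
   Context: $\sigma_k(n)=\sum_{d\mid n}d^k$ for $n\in\mathbb{N}$, $\sigma_k(x)=0$ for $x\notin\mathbb{N}$, $\sigma=\sigma_1$. $W_{(\alpha,\beta)}(n)=\sum_{(l,m)\in\mathbb{N}_0^2,\ \alpha l+\beta m=n}\sigma(l)\sigma(m)$. With $q=e^{2\pi iz}$ and $\eta(z)=q^{1/24}\prod_{n\ge1}(1-q^n)$, the integers $b_i(n)$ are defined by $B_i=\sum_{n\ge1}b_i(n)q^n$ where $B_1=\frac{\eta^6(z)\eta^6(11z)}{\eta^2(2z)\eta^2(22z)}$, $B_2=\eta^4(z)\eta^4(11z)$, $B_3=\eta^2(z)\eta^2(2z)\eta^2(11z)\eta^2(22z)$, $B_4=\eta^4(2z)\eta^4(22z)$, $B_5=\frac{\eta^6(2z)\eta^6(22z)}{\eta^2(z)\eta^2(11z)}$, $B_6=\frac{\eta(2z)\eta^3(11z)\eta^5(22z)}{\eta(z)}$,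 $B_7=\frac{\eta^9(2z)\eta^7(11z)}{\eta^5(z)\eta^3(22z)}$. *)

theory Defs
  imports "HOL-Computational_Algebra.Formal_Power_Series"
begin

definition sigma_k :: "nat \<Rightarrow> nat \<Rightarrow> nat" where
  "sigma_k k n = (if n = 0 then 0 else (\<Sum>d\<in>{d. d dvd n}. d ^ k))"

definition sigmaQ :: "nat \<Rightarrow> rat \<Rightarrow> rat" where
  "sigmaQ k x = (if \<exists>m::nat. m > 0 \<and> x = of_nat m
                 then of_nat (sigma_k k (THE m::nat. x = of_nat m)) else 0)"

definition W :: "nat \<Rightarrow> nat \<Rightarrow> nat \<Rightarrow> nat" where
  "W \<alpha> \<beta> n = (\<Sum>(l, m)\<in>{(l, m). \<alpha> * l + \<beta> * m = n}. sigma_k 1 l * sigma_k 1 m)"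

text \<open>Truncated Euler product prod_{k=1}^N (1 - q^(d k)); exact modulo q^(N+1) as
  a representative of prod_{k>=1} (1 - q^(d k)).\<close>
definition euler_trunc :: "nat \<Rightarrow> nat \<Rightarrow> rat fps" where
  "euler_trunc N d = (\<Prod>k\<in>{1..N}. 1 - fps_X ^ (d * k))"

text \<open>Coefficient of q^m in prod_{(d,e) in L} prod_{k>=1} (1 - q^(d k))^e.\<close>
definition eta_prod_coeff :: "(nat \<times> int) list \<Rightarrow> nat \<Rightarrow> rat" where
  "eta_prod_coeff L m = fps_nth
     (prod_list (map (\<lambda>(d, e). if e \<ge> 0 then euler_trunc m d ^ nat e
                                else inverse (euler_trunc m d) ^ nat (- e)) L)) m"

text \<open>n-th q-expansion coefficient of the eta quotient prod_{(d,e) in L} eta(d z)^e,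
  whose leading power is q^s with s = (sum d e)/24 (an integer for the quotients used).\<close>
definition eta_quot_coeff :: "(nat \<times> int) list \<Rightarrow> nat \<Rightarrow> rat" where
  "eta_quot_coeff L n =
     (let s = (\<Sum>(d, e)\<leftarrow>L. int d * e) div 24
      in if int n \<ge> s then eta_prod_coeff L (nat (int n - s)) else 0)"

definition b1 :: "nat \<Rightarrow> rat" where
  "b1 = eta_quot_coeff [(1, 6), (11, 6), (2, -2), (22, -2)]"
definition b2 :: "nat \<Rightarrow> rat" where
  "b2 = eta_quot_coeff [(1, 4), (11, 4)]"
definition b3 :: "nat \<Rightarrow> rat" where
  "b3 = eta_quot_coeff [(1, 2), (2, 2), (11, 2), (22, 2)]"
definition b4 :: "nat \<Rightarrow> rat" where
  "b4 = eta_quot_coeff [(2, 4), (22, 4)]"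
definition b5 :: "nat \<Rightarrow> rat" where
  "b5 = eta_quot_coeff [(2, 6), (22, 6), (1, -2), (11, -2)]"
definition b6 :: "nat \<Rightarrow> rat" where
  "b6 = eta_quot_coeff [(2, 1), (11, 3), (22, 5), (1, -1)]"
definition b7 :: "nat \<Rightarrow> rat" where
  "b7 = eta_quot_coeff [(2, 9), (11, 7), (1, -5), (22, -3)]"

end

theory Submission
  imports Defs "HOL-Complex_Analysis.Complex_Analysis" "HOL-Number_Theory.Cong"
begin

text \<open>
  Up to a scalar the difference of both sides generates the \<open>q\<close>-series \<open>A + C\<close>, where
  \<open>A = (2 E\<^sub>2(2z) - 11 E\<^sub>2(11z))\<^sup>2 + \<Sum> \<alpha>\<^sub>d E\<^sub>4(dz) + \<Sum> \<beta>\<^sub>i B\<^sub>i\<close> (\<open>i \<le> 5\<close>) is a modular form of weight 4 for \<open>\<Gamma>\<^sub>0(22)\<close>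
  and \<open>C\<close> is a combination of \<open>B\<^sub>6\<close> and \<open>B\<^sub>7\<close>; the products of coefficients with \<open>n\<close> come from Ramanujan's
  \<open>E\<^sub>2\<^sup>2 = E\<^sub>4 + 12 q dE\<^sub>2/dq\<close>. The exponents in \<open>B\<^sub>6\<close>, \<open>B\<^sub>7\<close> are odd, but \<open>C\<^sup>2\<close> only involves \<open>\<eta>\<^sup>2\<close>, whose multiplier
  is a character of \<open>SL\<^sub>2(\<int>)\<close>. Hence \<open>F = A\<^sup>2 - C\<^sup>2\<close> is a form of weight 8 and trivial character.
  The product \<open>P\<close> of the \<open>m \<le> 36\<close> functions obtained from \<open>F\<close> by the slash action of \<open>SL\<^sub>2(\<int>)\<close> has level one, so the modulus of
  \<open>P\<^sup>3 / \<Delta>\<^sup>2\<^sup>m\<close> is invariant. As \<open>A + C\<close> vanishes to order 24, \<open>F\<close> vanishes to order 25, this quotient tends to 0 at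
  \<open>\<i>\<infinity>\<close> and is 0 by the maximum principle. So \<open>F = (A - C) (A + C) = 0\<close>, and \<open>A - C \<noteq> 0\<close>.
\<close>

section \<open>Power series in \<open>q = exp (2 \<pi> \<i> z)\<close> and cotangent sums\<close>

text \<open>B6 and B7 have trivial character themselves, but this rests on the multiplier of eta,
  with Jacobi symbols and 24th roots of unity. Squaring needs only the multiplier of eta^2, which is
  checked on the generators T and S by residues modulo 3 and 4. The price is the doubled weight: for
  weight 8 and the index 36 of Gamma_0(22) only a zero of order above 8 * 36 / 12 = 24 forces a form
  to vanish, where weight 4 has the bound 12. Hence 24 coefficients of A + C, those of q^0 to q^23,
  are computed, and the 25th order of F comes from A - C, which has no constant term. The norm to
  level one replaces the valence formula: P^3 has order at least 75 at infinity, while Delta^(2m)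
  has order 2m <= 72 and no zeros. The law of E2 under z -> -1/z is the only analytic input with
  conditional convergence. It makes eta^2 modular, since the logarithmic derivative of eta^2 is a
  multiple of E2, and its derivative makes E2^2 - 12 q dE2/dq a form of weight 4, which the maximum
  principle in level one identifies with the Eisenstein series.\<close>

definition qexp :: "complex \<Rightarrow> complex" where
  "qexp z = exp (2 * of_real pi * \<i> * z)"

lemma norm_qexp: "norm (qexp z) = exp (- 2 * pi * Im z)"
  by (simp add: qexp_def norm_exp_eq_Re)

lemma norm_qexp_less_1: "Im z > 0 \<Longrightarrow> norm (qexp z) < 1"
  by (simp add: norm_qexp)

lemma qexp_nonzero [simp]: "qexp z \<noteq> 0"
  by (simp add: qexp_def)

lemma qexp_add_1: "qexp (z + 1) = qexp z"
  by (simp add: qexp_def algebra_simps exp_add)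

lemma qexp_mult_nat: "qexp (of_nat m * z) = qexp z ^ m"
  unfolding qexp_def exp_of_nat_mult [symmetric] by (simp add: mult_ac)

lemma has_field_derivative_qexp:
  "(qexp has_field_derivative (2 * of_real pi * \<i> * qexp z)) (at z within A)"
  unfolding qexp_def by (auto intro!: derivative_eq_intros)

definition qeval :: "complex fps \<Rightarrow> complex \<Rightarrow> complex" where
  "qeval F z = eval_fps F (qexp z)"

definition qdiff :: "'a::comm_ring_1 fps \<Rightarrow> 'a fps" where
  "qdiff F = fps_X * fps_deriv F"

lemma fps_nth_qdiff: "fps_nth (qdiff F) n = of_nat n * fps_nth F n"
  by (cases n) (simp_all add: qdiff_def)

lemma conv_radius_qdiff:
  fixes F :: "complex fps"
  shows "fps_conv_radius (qdiff F) \<ge> fps_conv_radius F"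
proof -
  have "fps_conv_radius (qdiff F) \<ge> min (fps_conv_radius (fps_X :: complex fps)) (fps_conv_radius (fps_deriv F))"
    unfolding qdiff_def by (rule fps_conv_radius_mult)
  then show ?thesis using fps_conv_radius_deriv[of F] by (simp add: min_def split: if_splits)
qed

lemma in_eball_qexp:
  assumes "fps_conv_radius F \<ge> 1" "Im z > 0"
  shows "ereal (norm (qexp z)) < fps_conv_radius F"
  using norm_qexp_less_1[OF assms(2)] assms(1)
  by (metis ereal_less(3) less_le_trans)

lemma has_field_derivative_qeval:
  assumes "fps_conv_radius F \<ge> 1" "Im z > 0"
  shows "(qeval F has_field_derivative (2 * of_real pi * \<i> * qeval (qdiff F) z)) (at z)"
proof -
  have q: "ereal (norm (qexp z)) < fps_conv_radius F" by (rule in_eball_qexp) fact+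
  have d: "(eval_fps F has_field_derivative eval_fps (fps_deriv F) (qexp z)) (at (qexp z))"
    using q by (intro has_field_derivative_eval_fps) auto
  have "((\<lambda>z. eval_fps F (qexp z)) has_field_derivative
     (eval_fps (fps_deriv F) (qexp z) * (2 * of_real pi * \<i> * qexp z))) (at z)"
    by (rule DERIV_chain2[OF d has_field_derivative_qexp])
  moreover have "qeval (qdiff F) z = qexp z * eval_fps (fps_deriv F) (qexp z)"
    unfolding qeval_def qdiff_def using q fps_conv_radius_deriv[of F]
    by (subst eval_fps_mult) auto
  ultimately show ?thesis unfolding qeval_def[abs_def] by (simp add: mult_ac)
qed

lemma qeval_has_sum_aux:
  assumes "fps_conv_radius F \<ge> 1" "Im z > 0"
  shows "summable (\<lambda>n. norm (fps_nth F n * qexp z ^ n))" "(\<lambda>n. fps_nth F n * qexp z ^ n) sums qeval F z"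
  using norm_summable_fps[of "qexp z" F] sums_eval_fps[of "qexp z" F] in_eball_qexp[OF assms]
  by (auto simp: qeval_def)

lemma qeval_has_sum:
  assumes "fps_conv_radius F \<ge> 1" "Im z > 0"
  shows "((\<lambda>n. fps_nth F n * qexp z ^ n) has_sum qeval F z) UNIV"
  using qeval_has_sum_aux[OF assms] by (rule norm_summable_imp_has_sum)

section \<open>Power and divisor series in the unit disc\<close>

definition powers :: "nat \<Rightarrow> complex fps" where
  "powers k = Abs_fps (\<lambda>n. of_nat n ^ k)"

definition sigma_fps :: "nat \<Rightarrow> complex fps" where
  "sigma_fps k = Abs_fps (\<lambda>n. of_nat (sigma_k k n))"

lemma conv_radius_powers: "fps_conv_radius (powers k) \<ge> 1"
proof (induction k)
  case 0
  show ?case unfolding powers_def fps_conv_radius_def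
    by (intro conv_radius_geI_ex') (auto intro!: summable_geometric)
next
  case (Suc k)
  have "qdiff (powers k) = powers (Suc k)"
    by (rule fps_ext) (simp add: fps_nth_qdiff powers_def)
  then show ?case using conv_radius_qdiff[of "powers k"] Suc by (metis order_trans)
qed

lemma conv_radius_bounded_powers:
  assumes "\<And>n. norm (fps_nth F n) \<le> real n ^ k"
  shows "fps_conv_radius F \<ge> 1"
proof -
  show ?thesis unfolding fps_conv_radius_def
  proof (rule conv_radius_geI_ex')
    fix r :: real assume r: "0 < r" "ereal r < 1"
    have "ereal (norm (complex_of_real r)) < fps_conv_radius (powers k)"
      by (rule less_le_trans[of _ 1]) (use r conv_radius_powers[of k] in auto)
    then have "summable (\<lambda>n. norm (fps_nth (powers k) n * of_real r ^ n))"
      by (rule norm_summable_fps)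
    then show "summable (\<lambda>n. fps_nth F n * of_real r ^ n)"
      by (rule summable_comparison_test[rotated])
        (use assms r in \<open>auto simp: powers_def norm_mult norm_power intro!: mult_right_mono exI[of _ 0]\<close>)
  qed
qed

lemma sigma_k_le: "sigma_k k n \<le> n ^ (k + 1)"
proof (cases "n = 0")
  case False
  have "sigma_k k n = (\<Sum>d\<in>{d. d dvd n}. d ^ k)" using False by (simp add: sigma_k_def)
  also have "\<dots> \<le> (\<Sum>d\<in>{1..n}. n ^ k)"
  proof (rule order_trans[OF sum_mono sum_mono2])
    fix d assume "d \<in> {d. d dvd n}"
    then show "d ^ k \<le> n ^ k" using False by (auto intro!: power_mono dest: dvd_imp_le)
  next
    show "{d. d dvd n} \<subseteq> {1..n}"
    proof
      fix d assume "d \<in> {d. d dvd n}"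
      then have "d \<noteq> 0" "d \<le> n" using False by (auto dest: dvd_imp_le)
      then show "d \<in> {1..n}" by auto
    qed
  qed auto
  finally show ?thesis by simp
qed (auto simp: sigma_k_def)

lemma conv_radius_sigma_fps: "fps_conv_radius (sigma_fps k) \<ge> 1"
proof (rule conv_radius_bounded_powers)
  fix n show "norm (fps_nth (sigma_fps k) n) \<le> real n ^ (k + 1)"
    using sigma_k_le[of k n] unfolding sigma_fps_def by (simp del: power_Suc flip: of_nat_power)
qed

section \<open>Estimates for lattice sums\<close>

lemma lattice_lower_bound:
  assumes "Im z > 0"
  obtains c where "c > 0" "\<And>x y::real. c * (\<bar>x\<bar> + \<bar>y\<bar>) \<le> norm (of_real x * z + of_real y)"
proof -
  define K where "K = 1 / Im z + 1 + norm z / Im z"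
  have K: "K > 0" using assms by (simp add: K_def add_pos_nonneg)
  have "\<bar>x\<bar> + \<bar>y\<bar> \<le> K * norm (of_real x * z + of_real y)" for x y :: real
  proof -
    define N where "N = norm (of_real x * z + of_real y)"
    have 1: "\<bar>x\<bar> * Im z \<le> N"
      using abs_Im_le_cmod[of "of_real x * z + of_real y"] assms by (simp add: N_def abs_mult)
    hence x: "\<bar>x\<bar> \<le> N / Im z" using assms by (simp add: field_simps)
    have "\<bar>y\<bar> = norm ((of_real x * z + of_real y) - of_real x * z)" by simp
    also have "\<dots> \<le> N + \<bar>x\<bar> * norm z" unfolding N_def
      by (rule order_trans[OF norm_triangle_ineq4]) (simp add: norm_mult)
    also have "\<dots> \<le> N + N / Im z * norm z" using x by (intro add_left_mono mult_right_mono) auto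
    finally show ?thesis using x unfolding N_def[symmetric] K_def by (simp add: algebra_simps)
  qed
  then have "1 / K * (\<bar>x\<bar> + \<bar>y\<bar>) \<le> norm (of_real x * z + of_real y)" for x y :: real
    using K by (simp add: field_simps)
  with K show ?thesis by (intro that[of "1/K"]) auto
qed

text \<open>The exponent lets \<open>lat_wt m * lat_wt n\<close> dominate cubic decay on the
  lattice: by AM-GM each factor 1/|m z + n| is O((1 + |m|)^(-1/2) (1 + |n|)^(-1/2)), and three of
  them give the exponent -3/2 < -1 in each variable.\<close>

definition lat_wt :: "int \<Rightarrow> real" where
  "lat_wt n = (1 + \<bar>real_of_int n\<bar>) powr (-3/2)"

lemma lat_wt_pos: "lat_wt n > 0" by (simp add: lat_wt_def)

lemma summable_lat_wt: "lat_wt summable_on UNIV"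
proof -
  have a: "(\<lambda>n::nat. lat_wt (int n)) summable_on UNIV"
  proof -
    have "summable (\<lambda>n::nat. real n powr (-3/2))" by (subst summable_real_powr_iff) auto
    then have "summable (\<lambda>n::nat. real (Suc n) powr (-3/2))" by (subst summable_Suc_iff)
    then show ?thesis
      by (subst summable_on_UNIV_nonneg_real_iff) (auto simp: lat_wt_def add_ac)
  qed
  have 1: "lat_wt summable_on {0..}"
  proof -
    have "bij_betw int UNIV {0..}"
      by (rule bij_betwI[of _ _ _ nat]) auto
    from summable_on_reindex_bij_betw[OF this, of lat_wt] a show ?thesis by simp
  qed
  have 2: "lat_wt summable_on {..0}"
  proof -
    have "bij_betw uminus {0..} {..(0::int)}"
      by (rule bij_betwI[of _ _ _ uminus]) auto
    from summable_on_reindex_bij_betw[OF this, of lat_wt] 1 show ?thesis by (auto simp: lat_wt_def[abs_def])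
  qed
  have "lat_wt summable_on ({0..} \<union> {..0})" using 1 2 by (rule summable_on_union)
  then show ?thesis by (rule summable_on_subset) auto
qed

lemma summable_lat_wt_mult: "(\<lambda>(m,n). lat_wt m * lat_wt n) summable_on UNIV"
proof -
  have "(\<lambda>(m,n). lat_wt m * lat_wt n) summable_on (UNIV \<times> UNIV)"
  proof (rule summable_on_SigmaI)
    fix m :: int
    show "((\<lambda>n. case (m, n) of (m, n) \<Rightarrow> lat_wt m * lat_wt n) has_sum (lat_wt m * infsum lat_wt UNIV)) UNIV"
      using has_sum_infsum[OF summable_lat_wt] by (auto intro: has_sum_cmult_right)
    show "(\<lambda>m. lat_wt m * infsum lat_wt UNIV) summable_on UNIV"
      using summable_lat_wt by (rule summable_on_cmult_left)
  qed (use lat_wt_pos in \<open>auto simp: less_imp_le\<close>)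
  then show ?thesis by simp
qed

section \<open>Lipschitz's formula from the reflection of polygamma functions\<close>

lemma sin_pi_nonzero: "Im z > 0 \<Longrightarrow> sin (of_real pi * z) \<noteq> (0::complex)"
proof
  assume "Im z > 0" "sin (of_real pi * z) = 0"
  then obtain n :: int where "of_real pi * z = of_real (of_int n * pi)"
    by (auto simp: sin_eq_0 mult_ac)
  hence "z = of_int n" by simp
  with \<open>Im z > 0\<close> show False by simp
qed

text \<open>Logarithmic differentiation of Gamma(z) Gamma(1 - z) = pi / sin(pi z).\<close>

lemma Digamma_reflection:
  assumes "z \<notin> \<int>"
  shows "Digamma (1 - z) - Digamma z = of_real pi * cot (of_real pi * (z::complex))"
proof -
  have nz: "z \<notin> \<int>\<^sub>\<le>\<^sub>0" "1 - z \<notin> \<int>\<^sub>\<le>\<^sub>0"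
    using assms nonpos_Ints_subset_Ints Ints_diff[of 1 "1 - z"] by auto
  have s: "sin (of_real pi * z) \<noteq> 0"
  proof
    assume "sin (of_real pi * z) = 0"
    then obtain n :: int where "of_real pi * z = of_real (of_int n * pi)"
      by (auto simp: sin_eq_0 mult_ac)
    hence "z = of_int n" by simp
    with assms show False by simp
  qed
  have 1: "((\<lambda>z. Gamma z * Gamma (1 - z)) has_field_derivative
       (Gamma z * Gamma (1 - z) * (Digamma z - Digamma (1 - z)))) (at z)"
    using nz by (auto intro!: derivative_eq_intros simp: algebra_simps)
  have 2: "((\<lambda>z. of_real pi / sin (of_real pi * z)) has_field_derivative
       - (of_real pi / sin (of_real pi * z) * (of_real pi * cot (of_real pi * z)))) (at z)"
    using s by (auto intro!: derivative_eq_intros simp: cot_def)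
  have "(\<lambda>z. Gamma z * Gamma (1 - z)) = (\<lambda>z. of_real pi / sin (of_real pi * (z::complex)))"
    using Gamma_reflection_complex by blast
  with 1 2 have "Gamma z * Gamma (1 - z) * (Digamma z - Digamma (1 - z)) =
     - (of_real pi / sin (of_real pi * z) * (of_real pi * cot (of_real pi * z)))"
    using DERIV_unique by metis
  hence "of_real pi / sin (of_real pi * z) * (Digamma z - Digamma (1 - z)) =
     of_real pi / sin (of_real pi * z) * (- (of_real pi * cot (of_real pi * z)))"
    by (simp only: Gamma_reflection_complex mult_minus_right)
  moreover have "of_real pi / sin (of_real pi * z) \<noteq> 0" using s by simp
  ultimately have "Digamma z - Digamma (1 - z) = - (of_real pi * cot (of_real pi * z))"
    using mult_left_cancel by blast
  then show ?thesis by (simp add: algebra_simps)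
qed

lemma in_Ints_Im_0: "z \<in> \<int> \<Longrightarrow> Im z = 0"
  by (elim Ints_cases) auto

text \<open>The first bound splits the decay evenly between m and n by AM-GM, for double sums; the
  second keeps all of it in n, for a single row.\<close>

lemma norm_inverse_lattice_le:
  assumes "Im z > 0"
  obtains C where "C > 0"
    "\<And>m n::int. (m, n) \<noteq> (0, 0) \<Longrightarrow>
       1 / norm (of_int m * z + of_int n) \<le> C / (sqrt (1 + \<bar>of_int m\<bar>) * sqrt (1 + \<bar>of_int n\<bar>))"
    "\<And>m n::int. (m, n) \<noteq> (0, 0) \<Longrightarrow>
       1 / norm (of_int m * z + of_int n) \<le> C / (1 + \<bar>of_int n\<bar>)"
proof -
  obtain c where c: "c > 0" "\<And>x y::real. c * (\<bar>x\<bar> + \<bar>y\<bar>) \<le> norm (of_real x * z + of_real y)"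
    using lattice_lower_bound[OF assms] by blast
  have main: "c / 2 * (1 + \<bar>of_int n\<bar>) \<le> norm (of_int m * z + of_int n)"
       "c / 2 * (sqrt (1 + \<bar>of_int m\<bar>) * sqrt (1 + \<bar>of_int n\<bar>)) \<le> norm (of_int m * z + of_int n)"
    if "(m, n) \<noteq> (0, 0)" for m n :: int
  proof -
    define x where "x = \<bar>real_of_int m\<bar>"
    define y where "y = \<bar>real_of_int n\<bar>"
    have xy: "x \<ge> 0" "y \<ge> 0" "x + y \<ge> 1" using that by (auto simp: x_def y_def)
    have le: "c * (x + y) \<le> norm (of_int m * z + of_int n)"
      using c(2)[of "of_int m" "of_int n"] by (simp add: x_def y_def)
    have "1 + y \<le> 2 * (x + y)" using xy by simp
    hence "c / 2 * (1 + y) \<le> c / 2 * (2 * (x + y))" using c(1) by (intro mult_left_mono) auto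
    thus "c / 2 * (1 + \<bar>of_int n\<bar>) \<le> norm (of_int m * z + of_int n)"
      using le unfolding y_def by (simp add: algebra_simps)
    have "sqrt (1 + x) * sqrt (1 + y) \<le> ((1 + x) + (1 + y)) / 2"
      using arith_geo_mean_sqrt[of "1 + x" "1 + y"] xy by (simp add: real_sqrt_mult)
    also have "\<dots> \<le> 2 * (x + y)" using xy by simp
    finally have "c / 2 * (sqrt (1 + x) * sqrt (1 + y)) \<le> c / 2 * (2 * (x + y))"
      using c(1) by (intro mult_left_mono) auto
    thus "c / 2 * (sqrt (1 + \<bar>of_int m\<bar>) * sqrt (1 + \<bar>of_int n\<bar>)) \<le> norm (of_int m * z + of_int n)"
      using le unfolding x_def y_def by (simp add: algebra_simps)
  qed
  have conv: "1 / N \<le> (2 / c) / B" if "c / 2 * B \<le> N" "B > 0" for N B :: real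
  proof -
    have "0 < c / 2 * B" using that c(1) by simp
    moreover have "0 < N" using calculation that(1) by linarith
    ultimately have "1 / N \<le> 1 / (c / 2 * B)" using that by (intro divide_left_mono mult_pos_pos) (use c(1) in auto)
    also have "\<dots> = (2 / c) / B" by simp
    finally show ?thesis .
  qed
  show ?thesis
  proof (rule that[of "2 / c"])
    fix m n :: int assume mn: "(m, n) \<noteq> (0, 0)"
    show "1 / norm (of_int m * z + of_int n) \<le> 2 / c / (sqrt (1 + \<bar>of_int m\<bar>) * sqrt (1 + \<bar>of_int n\<bar>))"
      by (rule conv[OF main(2)[OF mn]]) (auto intro!: mult_pos_pos)
    show "1 / norm (of_int m * z + of_int n) \<le> 2 / c / (1 + \<bar>of_int n\<bar>)"
      by (rule conv[OF main(1)[OF mn]]) auto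
  qed (use c(1) in auto)
qed

lemma lat_wt_eq: "lat_wt n = 1 / sqrt (1 + \<bar>of_int n\<bar>) ^ 3"
proof -
  have "sqrt (1 + \<bar>real_of_int n\<bar>) ^ 3 = (1 + \<bar>real_of_int n\<bar>) powr (3/2)"
    by (simp add: powr_half_sqrt [symmetric] powr_powr flip: powr_realpow)
  then show ?thesis unfolding lat_wt_def powr_minus_divide by (simp add: powr_minus_divide)
qed

lemma lat_wt_ge: "1 / (1 + \<bar>real_of_int n\<bar>)\<^sup>2 \<le> lat_wt n"
proof -
  have "(1 + \<bar>real_of_int n\<bar>) powr (-2) \<le> lat_wt n" unfolding lat_wt_def by (rule powr_mono) auto
  then show ?thesis by (simp add: powr_minus_divide)
qed

lemma Polygamma_1_reflection:
  assumes "Im z > 0"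
  shows "Polygamma 1 (1 - z) + Polygamma 1 z = of_real (pi\<^sup>2) / (sin (of_real pi * z))\<^sup>2"
proof -
  have nz: "w \<notin> \<int>" if "Im w > 0" for w :: complex
    using that in_Ints_Im_0[of w] by auto
  have z: "z \<notin> \<int>\<^sub>\<le>\<^sub>0" "1 - z \<notin> \<int>\<^sub>\<le>\<^sub>0"
    using nz[OF assms] nonpos_Ints_subset_Ints Ints_diff[of 1 "1 - z"] by auto
  have s: "sin (of_real pi * z) \<noteq> 0" by (rule sin_pi_nonzero) fact
  have 1: "((\<lambda>z. Digamma (1 - z) - Digamma z) has_field_derivative
       (- Polygamma 1 (1 - z) - Polygamma 1 z)) (at z)"
    using z by (auto intro!: derivative_eq_intros)
  have 2: "((\<lambda>z. of_real pi * cot (of_real pi * z)) has_field_derivative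
     (of_real pi * (- inverse ((sin (of_real pi * z))\<^sup>2) * of_real pi))) (at z)"
    by (intro DERIV_cmult DERIV_chain2[OF DERIV_cot]) (use s in \<open>auto intro!: derivative_eq_intros\<close>)
  have "open {z. Im z > 0}" by (rule open_halfspace_Im_gt)
  from has_field_derivative_transform_within_open[OF 1 this, of "\<lambda>z. of_real pi * cot (of_real pi * z)"]
  have "((\<lambda>z. of_real pi * cot (of_real pi * z)) has_field_derivative
       (- Polygamma 1 (1 - z) - Polygamma 1 z)) (at z)"
    using assms Digamma_reflection nz by auto
  from DERIV_unique[OF this 2] have "- Polygamma 1 (1 - z) - Polygamma 1 z =
     - (of_real (pi\<^sup>2) / (sin (of_real pi * z))\<^sup>2)"
    by (simp add: power2_eq_square divide_inverse)
  then show ?thesis by (simp add: algebra_simps)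
qed

lemma sin_pi_qexp:
  assumes "Im z > 0"
  shows "of_real (pi\<^sup>2) / (sin (of_real pi * z))\<^sup>2 = - 4 * of_real (pi\<^sup>2) * (qexp z / (1 - qexp z)\<^sup>2)"
proof -
  define e where "e = exp (\<i> * (of_real pi * z))"
  have e: "e \<noteq> 0" by (simp add: e_def)
  have q: "qexp z = e\<^sup>2" unfolding qexp_def e_def by (simp add: mult_ac flip: exp_double)
  have ei: "exp (- (\<i> * (of_real pi * z))) = inverse e" by (simp add: e_def exp_minus)
  have "sin (of_real pi * z) = (e - inverse e) / (2 * \<i>)"
    unfolding sin_exp_eq ei e_def[symmetric] by simp
  also have "\<dots> = (e\<^sup>2 - 1) / (2 * \<i> * e)" using e by (simp add: field_simps power2_eq_square)
  finally have s: "(sin (of_real pi * z))\<^sup>2 = - ((1 - qexp z)\<^sup>2 / (4 * qexp z))"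
    using e by (simp add: q power_divide power_mult_distrib power2_commute)
  have "norm (qexp z) < 1" by (rule norm_qexp_less_1) fact
  hence "1 - qexp z \<noteq> 0" by auto
  then show ?thesis unfolding s by simp
qed

lemma qeval_powers_1:
  assumes "Im z > 0"
  shows "qeval (powers 1) z = qexp z / (1 - qexp z)\<^sup>2"
proof -
  have q: "norm (qexp z) < 1" by (rule norm_qexp_less_1) fact
  have "(\<lambda>n. of_nat (Suc n) * qexp z ^ n * qexp z) sums (1 / (1 - qexp z)\<^sup>2 * qexp z)"
    by (intro sums_mult2 geometric_deriv_sums q)
  hence "(\<lambda>n. of_nat (Suc n) * qexp z ^ Suc n) sums (qexp z / (1 - qexp z)\<^sup>2)" by (simp add: mult_ac)
  hence "(\<lambda>n. of_nat n * qexp z ^ n) sums (qexp z / (1 - qexp z)\<^sup>2)" by (subst (asm) sums_Suc_iff) simp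
  moreover have "(\<lambda>n. of_nat n * qexp z ^ n) sums qeval (powers 1) z"
    using qeval_has_sum_aux(2)[OF conv_radius_powers assms, of 1] by (simp add: powers_def)
  ultimately show ?thesis by (rule sums_unique2[symmetric])
qed

lemma has_sum_int_split:
  fixes f :: "int \<Rightarrow> 'a::{topological_comm_monoid_add,t2_space}"
  assumes "((\<lambda>n. f (int n)) has_sum a) UNIV" "((\<lambda>n. f (- 1 - int n)) has_sum b) UNIV"
  shows "(f has_sum (a + b)) UNIV"
proof -
  have 1: "(f has_sum a) {0..}"
    using assms(1) by (subst (asm) has_sum_reindex_bij_witness[of _ nat int "{0..}" f]) auto
  have 2: "(f has_sum b) {..<0}"
    using assms(2) by (subst (asm) has_sum_reindex_bij_witness[of _ "\<lambda>n. nat (-1-n)" "\<lambda>n. -1 - int n" "{..<0}" f]) auto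
  have "(f has_sum (a + b)) ({0..} \<union> {..<0})"
    by (rule has_sum_Un_disjoint[OF 1 2]) auto
  also have "{0..} \<union> {..<0} = (UNIV :: int set)" by auto
  finally show ?thesis .
qed

text \<open>Polygamma and telescoping series come with \<open>sums\<close>, in a fixed order;
  unconditional convergence, known from estimates, lets their values be used in
  \<open>has_sum\<close>.\<close>

lemma has_sum_int_splitI:
  fixes f :: "int \<Rightarrow> complex"
  assumes "f summable_on UNIV" "(\<lambda>n. f (int n)) sums a" "(\<lambda>n. f (- 1 - int n)) sums b"
  shows "(f has_sum (a + b)) UNIV"
proof (rule has_sum_int_split)
  have 1: "((\<lambda>n. f (int n))) summable_on UNIV"
    using summable_on_reindex[of int UNIV f] summable_on_subset_banach[OF assms(1), of "range int"]
    by (simp add: o_def)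
  have "inj (\<lambda>n. - 1 - int n)" by (auto simp: inj_def)
  hence 2: "((\<lambda>n. f (-1 - int n))) summable_on UNIV"
    using summable_on_reindex[of "\<lambda>n. - 1 - int n" UNIV f] summable_on_subset_banach[OF assms(1), of "range (\<lambda>n. - 1 - int n)"]
    by (simp add: o_def)
  show "((\<lambda>n. f (int n)) has_sum a) UNIV"
    using 1 assms(2) has_sum_imp_sums[OF has_sum_infsum[OF 1]] sums_unique2 has_sum_infsum[OF 1] by blast
  show "((\<lambda>n. f (-1 - int n)) has_sum b) UNIV"
    using 2 assms(3) has_sum_imp_sums[OF has_sum_infsum[OF 2]] sums_unique2 has_sum_infsum[OF 2] by blast
qed

lemma summable_inverse_shift:
  assumes "Im z > 0" "k \<ge> 2"
  shows "(\<lambda>n::int. 1 / (z + of_int n) ^ k) summable_on UNIV"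
proof -
  obtain C where C: "C > 0" "\<And>m n::int. (m, n) \<noteq> (0, 0) \<Longrightarrow>
       1 / norm (of_int m * z + of_int n) \<le> C / (1 + \<bar>of_int n\<bar>)"
    using norm_inverse_lattice_le[OF assms(1)] by metis
  have "(\<lambda>n::int. norm (1 / (z + of_int n) ^ k)) summable_on UNIV"
  proof (rule summable_on_comparison_test)
    show "(\<lambda>n. C ^ k * lat_wt n) summable_on UNIV" using summable_lat_wt by (rule summable_on_cmult_right)
    fix n :: int
    have "norm (1 / (z + of_int n) ^ k) = (1 / norm (of_int 1 * z + of_int n)) ^ k"
      by (simp add: norm_divide norm_power power_one_over)
    also have "\<dots> \<le> (C / (1 + \<bar>of_int n\<bar>)) ^ k" by (intro power_mono C) auto
    also have "\<dots> = C ^ k * (1 / (1 + \<bar>of_int n\<bar>)) ^ k" by (simp add: power_divide)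
    also have "\<dots> \<le> C ^ k * (1 / (1 + \<bar>of_int n\<bar>)) ^ 2"
      using C(1) assms(2) by (intro mult_left_mono power_decreasing) auto
    also have "\<dots> \<le> C ^ k * lat_wt n"
      using C(1) lat_wt_ge[of n] by (intro mult_left_mono) (auto simp: power_divide)
    finally show "norm (1 / (z + of_int n) ^ k) \<le> C ^ k * lat_wt n" .
  qed auto
  then show ?thesis by (rule abs_summable_summable)
qed

text \<open>The terms n >= 0 form the series of \<open>Polygamma k\<close> at z. For n = -1 - j one
  has z + n = -(1 - z + j), and the sign of the power cancels the sign in the series of
  \<open>Polygamma k\<close> at 1 - z.\<close>

lemma has_sum_shift_Polygamma:
  assumes "Im z > 0" "k > 0"
  shows "((\<lambda>n::int. 1 / (z + of_int n) ^ Suc k) has_sum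
      (((-1) ^ Suc k * Polygamma k z + Polygamma k (1 - z)) / fact k)) UNIV"
proof -
  have nz: "z \<noteq> 0" "1 - z \<noteq> 0" using assms by auto
  have 1: "(\<lambda>n. 1 / (z + of_int (int n)) ^ Suc k) sums ((-1) ^ Suc k * Polygamma k z / fact k)"
    using Polygamma_LIMSEQ[of z k] nz assms by (simp add: divide_inverse)
  have "(\<lambda>n. (-1) ^ Suc k * inverse ((1 - z + of_nat n) ^ Suc k)) sums
           ((-1) ^ Suc k * ((-1) ^ Suc k * Polygamma k (1 - z) / fact k))"
    by (intro sums_mult Polygamma_LIMSEQ nz assms)
  also have "(-1) ^ Suc k * ((-1) ^ Suc k * Polygamma k (1 - z) / fact k) = Polygamma k (1 - z) / fact k"
    by (simp flip: mult.assoc power_mult_distrib)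
  also have "(\<lambda>n. (-1) ^ Suc k * inverse ((1 - z + of_nat n) ^ Suc k)) =
      (\<lambda>n. 1 / (z + of_int (- 1 - int n)) ^ Suc k)"
  proof
    fix n
    have "z + of_int (- 1 - int n) = - (1 - z + of_nat n)" by simp
    hence e: "(z + of_int (- 1 - int n)) ^ Suc k = (-1) ^ Suc k * (1 - z + of_nat n) ^ Suc k"
      by (simp only: power_minus[of "1 - z + of_nat n"])
    show "(-1) ^ Suc k * inverse ((1 - z + of_nat n) ^ Suc k) = 1 / (z + of_int (- 1 - int n)) ^ Suc k"
      unfolding e divide_inverse inverse_mult_distrib
      by (cases "even k") simp_all
  qed
  finally have 2: "(\<lambda>n. 1 / (z + of_int (- 1 - int n)) ^ Suc k) sums (Polygamma k (1 - z) / fact k)" .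
  have "(\<lambda>n::int. 1 / (z + of_int n) ^ Suc k) summable_on UNIV"
    using assms by (intro summable_inverse_shift) auto
  from has_sum_int_splitI[OF this 1 2] show ?thesis by (simp add: add_divide_distrib diff_divide_distrib)
qed

lemma has_sum_shift_2:
  assumes "Im z > 0"
  shows "((\<lambda>n::int. 1 / (z + of_int n)\<^sup>2) has_sum (- 4 * of_real (pi\<^sup>2) * qeval (powers 1) z)) UNIV"
  using has_sum_shift_Polygamma[OF assms, of 1] Polygamma_1_reflection[OF assms] sin_pi_qexp[OF assms]
  unfolding qeval_powers_1[OF assms] by (simp add: add_ac numeral_2_eq_2)

lemma qdiff_powers: "qdiff (powers k) = powers (Suc k)"
  by (rule fps_ext) (simp add: fps_nth_qdiff powers_def)

text \<open>Two differentiations of \<open>Polygamma_1_reflection\<close>: on the right each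
  multiplies n^k q^n by 2 pi i n, on the left each flips the sign of the reflected term.\<close>

lemma Polygamma_3_reflection:
  assumes "Im z > 0"
  shows "Polygamma 3 (1 - z) + Polygamma 3 z = 16 * of_real (pi ^ 4) * qeval (powers 3) z"
proof -
  define c :: complex where "c = 2 * of_real pi * \<i>"
  have nz: "z \<notin> \<int>\<^sub>\<le>\<^sub>0" "1 - z \<notin> \<int>\<^sub>\<le>\<^sub>0" if "Im z > 0" for z
    using in_Ints_Im_0[of z] that nonpos_Ints_subset_Ints Ints_diff[of 1 "1 - z"] by auto
  have op: "open {z. Im z > 0}" by (rule open_halfspace_Im_gt)
  have e1: "Polygamma 1 (1 - z) + Polygamma 1 z = - 4 * of_real (pi\<^sup>2) * qeval (powers 1) z" if "Im z > 0" for z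
    using Polygamma_1_reflection[OF that] sin_pi_qexp[OF that] qeval_powers_1[OF that] by simp
  have e2: "- Polygamma 2 (1 - z) + Polygamma 2 z = - 4 * of_real (pi\<^sup>2) * (c * qeval (powers 2) z)" if "Im z > 0" for z
  proof -
    have 1: "((\<lambda>z. Polygamma 1 (1 - z) + Polygamma 1 z) has_field_derivative
      (- Polygamma 2 (1 - z) + Polygamma 2 z)) (at z)"
      using nz[OF that] by (auto intro!: derivative_eq_intros simp: numeral_2_eq_2)
    have 2: "((\<lambda>z. - 4 * of_real (pi\<^sup>2) * qeval (powers 1) z) has_field_derivative
       - 4 * of_real (pi\<^sup>2) * (c * qeval (powers 2) z)) (at z)"
      using has_field_derivative_qeval[OF conv_radius_powers that, of 1] unfolding c_def
      by (intro DERIV_cmult) (simp add: qdiff_powers numeral_2_eq_2)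
    from has_field_derivative_transform_within_open[OF 1 op, of "\<lambda>z. - 4 * of_real (pi\<^sup>2) * qeval (powers 1) z"]
    have "((\<lambda>z. - 4 * of_real (pi\<^sup>2) * qeval (powers 1) z) has_field_derivative
       (- Polygamma 2 (1 - z) + Polygamma 2 z)) (at z)"
      using that e1 by auto
    from DERIV_unique[OF this 2] show ?thesis .
  qed
  have 1: "((\<lambda>z. - Polygamma 2 (1 - z) + Polygamma 2 z) has_field_derivative
      (Polygamma 3 (1 - z) + Polygamma 3 z)) (at z)"
    using nz[OF assms] by (auto intro!: derivative_eq_intros simp: numeral_3_eq_3 numeral_2_eq_2)
  have 2: "((\<lambda>z. - 4 * of_real (pi\<^sup>2) * (c * qeval (powers 2) z)) has_field_derivative
       - 4 * of_real (pi\<^sup>2) * (c * (c * qeval (powers 3) z))) (at z)"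
    using has_field_derivative_qeval[OF conv_radius_powers assms, of 2] unfolding c_def
    by (intro DERIV_cmult) (simp add: qdiff_powers numeral_3_eq_3 numeral_2_eq_2)
  from has_field_derivative_transform_within_open[OF 1 op, of "\<lambda>z. - 4 * of_real (pi\<^sup>2) * (c * qeval (powers 2) z)"]
  have "((\<lambda>z. - 4 * of_real (pi\<^sup>2) * (c * qeval (powers 2) z)) has_field_derivative
       (Polygamma 3 (1 - z) + Polygamma 3 z)) (at z)"
    using assms e2 by auto
  from DERIV_unique[OF this 2] show ?thesis
    by (simp add: c_def power2_eq_square power4_eq_xxxx algebra_simps)
qed

lemma has_sum_shift_4:
  assumes "Im z > 0"
  shows "((\<lambda>n::int. 1 / (z + of_int n) ^ 4) has_sum (8 / 3 * of_real (pi ^ 4) * qeval (powers 3) z)) UNIV"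
  using has_sum_shift_Polygamma[OF assms, of 3] Polygamma_3_reflection[OF assms]
  by (simp add: add_ac mult_ac fact_numeral)

section \<open>The transformation law of \<open>E\<^sub>2\<close>\<close>

lemma has_sum_symmetric:
  fixes f :: "int \<Rightarrow> complex"
  assumes "(f has_sum S) UNIV"
  shows "(\<lambda>m. f (int (Suc m)) + f (- int (Suc m))) sums (S - f 0)"
proof -
  have inj: "inj (\<lambda>n. - 1 - int n)" "inj int" by (auto simp: inj_def)
  have s: "f summable_on UNIV" using assms by (rule has_sum_imp_summable)
  have 1: "((\<lambda>n. f (int n))) summable_on UNIV" and 2: "((\<lambda>n. f (-1 - int n))) summable_on UNIV"
    using summable_on_reindex[OF inj(1), of f] summable_on_subset_banach[OF s, of "range (\<lambda>n. - 1 - int n)"]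
      summable_on_reindex[OF inj(2), of f] summable_on_subset_banach[OF s, of "range int"]
    by (simp_all add: o_def)
  note 3 = has_sum_infsum[OF 1] has_sum_infsum[OF 2]
  have S: "S = infsum (\<lambda>n. f (int n)) UNIV + infsum (\<lambda>n. f (-1 - int n)) UNIV"
    using has_sum_int_split[OF 3] assms has_sum_unique by blast
  have "(\<lambda>n. f (int n)) sums infsum (\<lambda>n. f (int n)) UNIV"
    using 3(1) by (rule has_sum_imp_sums)
  hence 4: "(\<lambda>n. f (int (Suc n))) sums (infsum (\<lambda>n. f (int n)) UNIV - f 0)"
    using sums_Suc_iff[of "\<lambda>n. f (int n)"] by simp
  have "(\<lambda>n. f (int (Suc n)) + f (-1 - int n)) sums (S - f 0)"
    using sums_add[OF 4 has_sum_imp_sums[OF 3(2)]] unfolding S by (simp add: algebra_simps)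
  moreover have "-1 - int n = - int (Suc n)" for n by simp
  ultimately show ?thesis by (simp only:)
qed

text \<open>The double series of r^k q^(m r) converges absolutely; grouped by n = m r it yields
  sigma_k(n), grouped by m the values of \<open>powers k\<close> at m z.\<close>

lemma has_sum_Lambert:
  assumes "Im z > 0" "k > 0"
  shows "((\<lambda>m. qeval (powers k) (of_nat m * z)) has_sum qeval (sigma_fps k) z) {1..}"
proof -
  define g where "g = (\<lambda>(n::nat, d::nat). of_nat d ^ k * qexp z ^ n)"
  define D where "D = Sigma {1..} (\<lambda>n. {d::nat. d dvd n})"
  have fin: "finite {d. d dvd n}" if "n \<in> {1..}" for n :: nat using that by auto
  have sg: "of_nat (sigma_k k n) = (\<Sum>d\<in>{d. d dvd n}. (of_nat d ^ k :: 'a::{comm_semiring_1}))"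
    if "n \<in> {1..}" for n using that by (simp add: sigma_k_def)
  have "(\<lambda>x. norm (g x)) summable_on D"
    unfolding D_def
  proof (rule summable_on_SigmaI)
    fix n :: nat assume n: "n \<in> {1..}"
    show "((\<lambda>d. norm (g (n, d))) has_sum (of_nat (sigma_k k n) * norm (qexp z) ^ n)) {d. d dvd n}"
      using fin[OF n] by (intro has_sum_finiteI)
        (auto simp: g_def sg[OF n] norm_mult norm_power sum_distrib_right)
  next
    have "summable (\<lambda>n. norm (fps_nth (sigma_fps k) n * qexp z ^ n))"
      by (rule qeval_has_sum_aux[OF conv_radius_sigma_fps assms(1)])
    hence "(\<lambda>n. of_nat (sigma_k k n) * norm (qexp z) ^ n) summable_on UNIV"
      by (subst summable_on_UNIV_nonneg_real_iff) (auto simp: sigma_fps_def norm_mult norm_power)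
    then show "(\<lambda>n. of_nat (sigma_k k n) * norm (qexp z) ^ n) summable_on {1..}"
      by (rule summable_on_subset) auto
  qed auto
  hence "g summable_on D" by (rule abs_summable_summable)
  have "(g has_sum qeval (sigma_fps k) z) D"
    unfolding D_def
  proof (rule has_sum_SigmaI)
    fix n :: nat assume n: "n \<in> {1..}"
    show "((\<lambda>d. g (n, d)) has_sum (of_nat (sigma_k k n) * qexp z ^ n)) {d. d dvd n}"
      using fin[OF n] by (intro has_sum_finiteI)
        (auto simp: g_def sg[OF n] sum_distrib_right)
  next
    have "((\<lambda>n. of_nat (sigma_k k n) * qexp z ^ n) has_sum qeval (sigma_fps k) z) UNIV"
      using qeval_has_sum[OF conv_radius_sigma_fps assms(1), of k] by (simp add: sigma_fps_def)
    then show "((\<lambda>n. of_nat (sigma_k k n) * qexp z ^ n) has_sum qeval (sigma_fps k) z) {1..}"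
      by (rule has_sum_cong_neutral[THEN iffD1, rotated 3])
        (use assms in \<open>auto simp: sigma_k_def not_le\<close>)
  qed (use \<open>g summable_on D\<close> in \<open>simp add: D_def\<close>)
  also have "(g has_sum qeval (sigma_fps k) z) D \<longleftrightarrow>
    ((\<lambda>(m::nat, r::nat). of_nat r ^ k * qexp z ^ (m * r)) has_sum qeval (sigma_fps k) z) ({1..} \<times> {1..})"
  proof (rule has_sum_reindex_bij_witness[of _ "\<lambda>(m, r). (m * r, r)" "\<lambda>(n, d). (n div d, d)"])
    fix x assume "x \<in> D"
    then obtain n d where x: "x = (n, d)" "n > 0" "d dvd n" by (auto simp: D_def)
    then have "d > 0" "n div d > 0" by (auto intro!: Nat.gr0I simp: dvd_div_eq_0_iff)
    with x show "(case x of (n, d) \<Rightarrow> (n div d, d)) \<in> {1..} \<times> {1..}"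
      "(case case x of (n, d) \<Rightarrow> (n div d, d) of (m, r) \<Rightarrow> (m * r, r)) = x"
      "(case case x of (n, d) \<Rightarrow> (n div d, d) of (m, r) \<Rightarrow> of_nat r ^ k * qexp z ^ (m * r)) = g x"
      by (simp_all add: g_def Suc_le_eq)
  qed (auto simp: D_def)
  finally show ?thesis
  proof (rule has_sum_SigmaD)
    fix m :: nat assume m: "m \<in> {1..}"
    have Im: "Im (of_nat m * z) > 0" using m assms by simp
    have "((\<lambda>r. of_nat r ^ k * qexp z ^ (m * r)) has_sum qeval (powers k) (of_nat m * z)) UNIV"
      using qeval_has_sum[OF conv_radius_powers Im, of k] by (simp add: powers_def qexp_mult_nat power_mult)
    \<comment> \<open>The index r = 0 contributes nothing because k > 0.\<close>
    then show "((\<lambda>r. case (m, r) of (m, r) \<Rightarrow> of_nat r ^ k * qexp z ^ (m * r)) has_sum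
        qeval (powers k) (of_nat m * z)) {1..}"
      by (rule has_sum_cong_neutral[THEN iffD1, rotated 3])
        (use assms in \<open>auto simp: sigma_k_def not_le\<close>)
  qed
qed

lemma has_sum_Suc_iff: "((\<lambda>m. f (Suc m)) has_sum S) UNIV \<longleftrightarrow> (f has_sum S) {1..}"
  by (rule has_sum_reindex_bij_witness[of _ "\<lambda>m. m - 1" Suc]) auto

text \<open>The difference of the Digamma series at 1 - w and w pairs n with -(n + 1); a telescoping
  series changes this to the symmetric pairing of n + 1 with -(n + 1), at the cost of the term
  1/w.\<close>

lemma cot_sums:
  assumes "Im w > 0"
  shows "(\<lambda>m. 1 / (w + of_nat (Suc m)) + 1 / (w - of_nat (Suc m))) sums
           (of_real pi * cot (of_real pi * w) - 1 / w)"
proof -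
  have nz: "w \<noteq> 0" "1 - w \<noteq> 0" "w \<notin> \<int>" using assms in_Ints_Im_0[of w] by auto
  have e: "inverse (1 - w + of_nat n) = - (1 / (w - of_nat (Suc n)))" for n
    by (simp add: divide_inverse flip: inverse_minus_eq)
  have "(\<lambda>n. (inverse (of_nat (Suc n)) - inverse (1 - w + of_nat n)) - (inverse (of_nat (Suc n)) - inverse (w + of_nat n)))
     sums ((\<Sum>n. inverse (of_nat (Suc n)) - inverse (1 - w + of_nat n)) - (\<Sum>n. inverse (of_nat (Suc n)) - inverse (w + of_nat n)))"
    by (intro sums_diff summable_sums summable_Digamma nz)
  also have "((\<Sum>n. inverse (of_nat (Suc n)) - inverse (1 - w + of_nat n)) - (\<Sum>n. inverse (of_nat (Suc n)) - inverse (w + of_nat n)))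
     = Digamma (1 - w) - Digamma w" unfolding Digamma_def by simp
  finally have 1: "(\<lambda>n. 1 / (w + of_nat n) + 1 / (w - of_nat (Suc n))) sums (of_real pi * cot (of_real pi * w))"
    unfolding Digamma_reflection[OF nz(3)] e by (simp add: divide_inverse add_ac)
  have "(\<lambda>n. 1 / (w + of_nat n)) \<longlonglongrightarrow> 0"
    unfolding divide_inverse mult_1_left
    by (intro filterlim_compose[OF tendsto_inverse_0] tendsto_add_filterlim_at_infinity[OF tendsto_const] tendsto_of_nat)
  hence 2: "(\<lambda>n. 1 / (w + of_nat n) - 1 / (w + of_nat (Suc n))) sums (1 / (w + of_nat 0) - 0)"
    by (rule telescope_sums')
  from sums_diff[OF 1 2] show ?thesis by (simp add: algebra_simps)
qed

lemma cot_pi_qexp: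
  assumes "Im w > 0"
  shows "cot (of_real pi * w) = \<i> * (qexp w + 1) / (qexp w - 1)"
proof -
  define e where "e = exp (\<i> * (of_real pi * w))"
  have e: "e \<noteq> 0" by (simp add: e_def)
  have q: "qexp w = e\<^sup>2" unfolding qexp_def e_def by (simp add: mult_ac flip: exp_double)
  have ei: "exp (- (\<i> * (of_real pi * w))) = inverse e" by (simp add: e_def exp_minus)
  have "norm (qexp w) < 1" by (rule norm_qexp_less_1) fact
  hence "e\<^sup>2 - 1 \<noteq> 0" using q by auto
  moreover have "sin (of_real pi * w) = (e - inverse e) / (2 * \<i>)"
    unfolding sin_exp_eq ei e_def[symmetric] by simp
  moreover have "\<dots> = (e\<^sup>2 - 1) / (2 * \<i> * e)" using e by (simp add: field_simps power2_eq_square)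
  moreover have "cos (of_real pi * w) = (e + inverse e) / 2"
    unfolding cos_exp_eq ei e_def[symmetric] by simp
  moreover have "\<dots> = (e\<^sup>2 + 1) / (2 * e)" using e by (simp add: field_simps power2_eq_square)
  ultimately show ?thesis using e by (simp add: cot_def q)
qed

text \<open>Subtracting a telescoping term makes Eisenstein's double series for \<open>E\<^sub>2\<close> absolutely convergent, so that
  both orders of summation give the same value; the quasi-period of \<open>E\<^sub>2\<close> is the telescoped limit.\<close>
definition lat_term :: "complex \<Rightarrow> complex" where
  "lat_term w = 1 / w\<^sup>2 - (1 / (w - 1) - 1 / w)"

text \<open>Row 0 is left out. Rows m and -m are taken together because the columns of 1/w converge
  only in this pairing, see \<open>col_inv_sums\<close>.\<close>

definition eis_pair :: "complex \<Rightarrow> nat \<times> int \<Rightarrow> complex" where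
  "eis_pair z = (\<lambda>(m, n). lat_term (of_nat (Suc m) * z + of_int n) + lat_term (- of_nat (Suc m) * z + of_int n))"

lemma has_sum_telescope_int:
  assumes "Im w \<noteq> 0" "(\<lambda>n::int. 1 / (w + of_int n - 1) - 1 / (w + of_int n)) summable_on UNIV"
  shows "((\<lambda>n::int. 1 / (w + of_int n - 1) - 1 / (w + of_int n)) has_sum 0) UNIV"
proof -
  have l1: "(\<lambda>n. 1 / (w + of_nat n - 1)) \<longlonglongrightarrow> 0"
    unfolding divide_inverse mult_1_left add_diff_eq[symmetric] diff_conv_add_uminus add.commute[of _ "-1"] add.assoc[symmetric]
    by (intro filterlim_compose[OF tendsto_inverse_0] tendsto_add_filterlim_at_infinity[OF tendsto_const] tendsto_of_nat)
  have "(\<lambda>n. 1 / (w + of_nat n - 1) - 1 / (w + of_nat (Suc n) - 1)) sums (1 / (w + of_nat 0 - 1) - 0)"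
    using l1 by (rule telescope_sums')
  hence 1: "(\<lambda>n. 1 / (w + of_int (int n) - 1) - 1 / (w + of_int (int n))) sums (1 / (w - 1))" by simp
  have "(\<lambda>n. inverse ((1 - w) + of_nat n)) \<longlonglongrightarrow> 0"
    by (intro filterlim_compose[OF tendsto_inverse_0] tendsto_add_filterlim_at_infinity[OF tendsto_const] tendsto_of_nat)
  hence "(\<lambda>n. inverse ((1 - w) + of_nat n) - inverse ((1 - w) + of_nat (Suc n))) sums (inverse ((1 - w) + of_nat 0) - 0)"
    by (rule telescope_sums')
  moreover have "inverse ((1 - w) + of_nat n) = - (1 / (w + of_int (- 1 - int n)))" for n
    by (simp add: divide_inverse algebra_simps flip: inverse_minus_eq)
  moreover have "inverse ((1 - w) + of_nat (Suc n)) = - (1 / (w + of_int (- 1 - int n) - 1))" for n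
    by (simp add: divide_inverse algebra_simps flip: inverse_minus_eq)
  moreover have "inverse (1 - w) = - (1 / (w - 1))"
    by (simp add: divide_inverse flip: inverse_minus_eq)
  ultimately have 2: "(\<lambda>n. 1 / (w + of_int (- 1 - int n) - 1) - 1 / (w + of_int (- 1 - int n))) sums (- (1 / (w - 1)))"
    by simp
  from has_sum_int_splitI[OF assms(2) 1 2] show ?thesis by simp
qed

section \<open>Summation by rows\<close>

context
  fixes z :: complex
  assumes z: "Im z > 0"
begin

lemma lat_nonzero: "(m, n) \<noteq> (0, 0) \<Longrightarrow> of_int m * z + of_int n \<noteq> 0"
proof
  assume a: "of_int m * z + of_int n = 0" "(m, n) \<noteq> (0, 0)"
  have "Im (of_int m * z + of_int n) = 0" using a(1) by simp
  with z have "m = 0" by simp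
  with a show False by auto
qed

text \<open>The telescoping term turns 1/w^2 into -1 / (w^2 (w - 1)), which decays
  cubically.\<close>

lemma lat_term_bound:
  obtains C where "\<And>m n. m \<noteq> 0 \<Longrightarrow> norm (lat_term (of_int m * z + of_int n)) \<le> C * (lat_wt m * lat_wt n)"
proof -
  obtain C where C: "C > 0" "\<And>m n::int. (m, n) \<noteq> (0, 0) \<Longrightarrow>
       1 / norm (of_int m * z + of_int n) \<le> C / (sqrt (1 + \<bar>of_int m\<bar>) * sqrt (1 + \<bar>of_int n\<bar>))"
    using norm_inverse_lattice_le[OF z] by metis
  show ?thesis
  proof (rule that)
    fix m n :: int assume m: "m \<noteq> 0"
    define w where "w = of_int m * z + of_int n"
    have w1: "w - 1 = of_int m * z + of_int (n - 1)" by (simp add: w_def)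
    have nz: "w \<noteq> 0" "w - 1 \<noteq> 0" unfolding w1 unfolding w_def using m by (auto intro!: lat_nonzero simp del: of_int_diff)
    define a b b' where "a = sqrt (1 + \<bar>real_of_int m\<bar>)" and "b = sqrt (1 + \<bar>real_of_int n\<bar>)"
       and "b' = sqrt (1 + \<bar>real_of_int (n - 1)\<bar>)"
    have pos: "a > 0" "b > 0" "b' > 0" by (auto simp: a_def b_def b'_def)
    \<comment> \<open>1 + |n| <= 4 (1 + |n - 1|): passing from w - 1 to w costs a factor 2.\<close>
    have "b \<le> sqrt (4 * (1 + \<bar>real_of_int (n - 1)\<bar>))" unfolding b_def
      by (rule real_sqrt_le_mono) (simp add: abs_real_def)
    hence bb: "b \<le> 2 * b'" unfolding b'_def by (simp only: real_sqrt_mult real_sqrt_four)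
    have "1 / norm (w - 1) \<le> C / (a * b')" unfolding w1 a_def b'_def using m by (intro C) auto
    also have "\<dots> \<le> C / (a * (b / 2))" using pos bb C(1) by (intro divide_left_mono mult_left_mono mult_pos_pos) auto
    finally have 1: "1 / norm (w - 1) \<le> 2 * C / (a * b)" by (simp add: mult.commute)
    have 2: "1 / norm w \<le> C / (a * b)" unfolding w_def a_def b_def using m by (intro C) auto
    have "lat_term w = - (1 / w * (1 / w) * (1 / (w - 1)))"
      unfolding lat_term_def using nz by (simp add: field_simps power2_eq_square)
    hence "norm (lat_term w) = 1 / norm w * (1 / norm w) * (1 / norm (w - 1))"
      by (simp add: norm_mult norm_divide)
    also have "\<dots> \<le> C / (a * b) * (C / (a * b)) * (2 * C / (a * b))"
      using 1 2 pos C(1) by (intro mult_mono) auto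
    also have "\<dots> = 2 * C ^ 3 * (1 / a ^ 3 * (1 / b ^ 3))" by (simp add: field_simps power3_eq_cube)
    also have "\<dots> = 2 * C ^ 3 * (lat_wt m * lat_wt n)" by (simp add: lat_wt_eq a_def b_def)
    finally show "norm (lat_term (of_int m * z + of_int n)) \<le> (2 * C ^ 3) * (lat_wt m * lat_wt n)" by (simp add: w_def)
  qed
qed

lemma eis_pair_summable: "eis_pair z summable_on UNIV"
proof -
  obtain C where C: "\<And>m n. m \<noteq> 0 \<Longrightarrow> norm (lat_term (of_int m * z + of_int n)) \<le> C * (lat_wt m * lat_wt n)"
    using lat_term_bound by blast
  have "(\<lambda>x. norm (eis_pair z x)) summable_on UNIV"
  proof (rule summable_on_comparison_test)
    define h where "h = (\<lambda>(m, n). (int (Suc m), n :: int))"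
    have "inj h" by (auto simp: inj_def h_def)
    have "((\<lambda>(m,n). lat_wt m * lat_wt n) \<circ> h) summable_on UNIV"
      using summable_on_reindex[OF \<open>inj h\<close>, of "\<lambda>(m,n). lat_wt m * lat_wt n"]
         summable_on_subset_banach[OF summable_lat_wt_mult, of "range h"] by simp
    then show "(\<lambda>x. (2 * C) * ((\<lambda>(m,n). lat_wt m * lat_wt n) \<circ> h) x) summable_on UNIV"
      by (rule summable_on_cmult_right)
    fix x :: "nat \<times> int"
    obtain m n where x: "x = (m, n)" by (cases x)
    have "norm (eis_pair z x) \<le> C * (lat_wt (int (Suc m)) * lat_wt n) + C * (lat_wt (- int (Suc m)) * lat_wt n)"
      unfolding x eis_pair_def prod.case
      using C[of "int (Suc m)" n] C[of "- int (Suc m)" n] by (intro norm_triangle_mono) auto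
    also have "lat_wt (- int (Suc m)) = lat_wt (int (Suc m))" by (simp add: lat_wt_def)
    finally show "norm (eis_pair z x) \<le> (2 * C) * ((\<lambda>(m,n). lat_wt m * lat_wt n) \<circ> h) x"
      by (simp add: x h_def mult_ac)
  qed auto
  then show ?thesis by (rule abs_summable_summable)
qed

lemma lat_term_row_summable:
  assumes "m \<noteq> 0"
  shows "(\<lambda>n. lat_term (of_int m * z + of_int n)) summable_on UNIV"
proof -
  obtain C where C: "\<And>m n. m \<noteq> 0 \<Longrightarrow> norm (lat_term (of_int m * z + of_int n)) \<le> C * (lat_wt m * lat_wt n)"
    using lat_term_bound by blast
  have "(\<lambda>n. norm (lat_term (of_int m * z + of_int n))) summable_on UNIV"
    by (rule summable_on_comparison_test[of "\<lambda>n. C * (lat_wt m * lat_wt n)"])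
       (use C assms summable_lat_wt in \<open>auto intro!: summable_on_cmult_right\<close>)
  then show ?thesis by (rule abs_summable_summable)
qed

text \<open>Along a row the telescoping part sums to 0, so what remains is the row sum of 1/w^2,
  given by Lipschitz's formula. Row -m is row m reflected by n -> -n.\<close>

lemma has_sum_lat_term_row:
  assumes "m > 0"
  shows "((\<lambda>n. lat_term (of_nat m * z + of_int n)) has_sum (- 4 * of_real (pi\<^sup>2) * qeval (powers 1) (of_nat m * z))) UNIV"
    "((\<lambda>n. lat_term (- of_nat m * z + of_int n)) has_sum (- 4 * of_real (pi\<^sup>2) * qeval (powers 1) (of_nat m * z))) UNIV"
proof -
  let ?S = "- 4 * of_real (pi\<^sup>2) * qeval (powers 1) (of_nat m * z)"
  have Im: "Im (of_nat m * z) > 0" using assms z by simp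
  have *: "((\<lambda>n. lat_term (w + of_int n)) has_sum ?S) UNIV"
    if "((\<lambda>n. 1 / (w + of_int n)\<^sup>2) has_sum ?S) UNIV" "(\<lambda>n. lat_term (w + of_int n)) summable_on UNIV" "Im w \<noteq> 0" for w
  proof -
    have "(\<lambda>n. 1 / (w + of_int n)\<^sup>2 - lat_term (w + of_int n)) summable_on UNIV"
      using summable_on_add[OF has_sum_imp_summable[OF that(1)] summable_on_uminus[THEN iffD2, OF that(2)]] by simp
    hence "((\<lambda>n::int. 1 / (w + of_int n - 1) - 1 / (w + of_int n)) has_sum 0) UNIV"
      by (intro has_sum_telescope_int that) (simp add: lat_term_def)
    from has_sum_add[OF that(1) has_sum_uminusI[OF this]] show ?thesis by (simp add: lat_term_def algebra_simps)
  qed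
  show "((\<lambda>n. lat_term (of_nat m * z + of_int n)) has_sum ?S) UNIV"
    using lat_term_row_summable[of "int m"] assms Im by (intro * has_sum_shift_2) auto
  have "((\<lambda>n. 1 / (of_nat m * z + of_int n)\<^sup>2) has_sum ?S) UNIV" using Im by (rule has_sum_shift_2)
  also have "?this \<longleftrightarrow> ((\<lambda>n. 1 / (- of_nat m * z + of_int n)\<^sup>2) has_sum ?S) UNIV"
    by (rule has_sum_reindex_bij_witness[of _ uminus uminus]) (auto simp: power2_eq_square algebra_simps)
  finally show "((\<lambda>n. lat_term (- of_nat m * z + of_int n)) has_sum ?S) UNIV"
    using lat_term_row_summable[of "- int m"] assms Im by (intro *) auto
qed

lemma eis_pair_row:
  "((\<lambda>n. eis_pair z (m, n)) has_sum (- 8 * of_real (pi\<^sup>2) * qeval (powers 1) (of_nat (Suc m) * z))) UNIV"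
  using has_sum_add[OF has_sum_lat_term_row(1)[of "Suc m"] has_sum_lat_term_row(2)[of "Suc m"]]
  by (simp add: eis_pair_def algebra_simps)

lemma has_sum_eis_pair: "(eis_pair z has_sum (- 8 * of_real (pi\<^sup>2) * qeval (sigma_fps 1) z)) (UNIV \<times> UNIV)"
proof (rule has_sum_SigmaI)
  fix m :: nat
  show "((\<lambda>n. eis_pair z (m, n)) has_sum (- 8 * of_real (pi\<^sup>2) * qeval (powers 1) (of_nat (Suc m) * z))) UNIV"
    by (rule eis_pair_row)
  show "((\<lambda>m. - 8 * of_real (pi\<^sup>2) * qeval (powers 1) (of_nat (Suc m) * z)) has_sum (- 8 * of_real (pi\<^sup>2) * qeval (sigma_fps 1) z)) UNIV"
    using has_sum_Lambert[OF z, of 1] by (intro has_sum_cmult_right) (simp only: has_sum_Suc_iff[symmetric] zero_less_one)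
  show "eis_pair z summable_on UNIV \<times> UNIV" using eis_pair_summable by simp
qed

end

section \<open>Summation by columns, in terms of w = -1/z\<close>

context
  fixes z w :: complex
  assumes z: "Im z > 0"
  defines "w \<equiv> - 1 / z"
begin

lemma Im_w: "Im w > 0"
proof -
  have "Im w = Im z / ((Re z)\<^sup>2 + (Im z)\<^sup>2)" by (simp add: w_def Im_divide)
  moreover have "(Re z)\<^sup>2 + (Im z)\<^sup>2 > 0" using z by (simp add: add_nonneg_pos)
  ultimately show ?thesis using z by simp
qed

lemma z_nz: "z \<noteq> 0" using z by auto

text \<open>The sum of 1/(m z + n) over m nonzero in pairs m, -m: as m z + n = -z (n w - m), it is
  the partial fraction series of the cotangent at n w. For n = 0 each pair cancels.\<close>

definition col_inv :: "int \<Rightarrow> complex" where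
  "col_inv n = (if n = 0 then 0 else - (of_real pi * cot (of_real pi * (of_int n * w)) - 1 / (of_int n * w)) / z)"

text \<open>The same for squares: Lipschitz's formula at |n| w without its term m = 0, where n w z =
  -n. For n = 0 the value is 2 zeta(2) / z^2.\<close>

definition col_sq :: "int \<Rightarrow> complex" where
  "col_sq n = (if n = 0 then 2 * (of_real pi ^ 2 / 6) / z\<^sup>2 else
      (- 4 * of_real (pi\<^sup>2) * qeval (powers 1) (of_int \<bar>n\<bar> * w)) / z\<^sup>2 - 1 / (of_int n)\<^sup>2)"

lemma col_inv_minus: "col_inv (- n) = - col_inv n"
proof -
  have "cot (- x) = - cot x" for x :: complex by (simp add: cot_def)
  then show ?thesis by (simp add: col_inv_def diff_divide_distrib)
qed

lemma lat_to_w: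
  "1 / (of_nat m * z + of_int n) = - (1 / (of_int n * w - of_nat m)) / z"
  "1 / (- of_nat m * z + of_int n) = - (1 / (of_int n * w + of_nat m)) / z"
proof -
  have "of_nat m * z + of_int n = - (z * (of_int n * w - of_nat m))"
       "- of_nat m * z + of_int n = - (z * (of_int n * w + of_nat m))"
    using z_nz by (simp_all add: w_def field_simps)
  then show "1 / (of_nat m * z + of_int n) = - (1 / (of_int n * w - of_nat m)) / z"
     "1 / (- of_nat m * z + of_int n) = - (1 / (of_int n * w + of_nat m)) / z"
    by (simp_all add: divide_simps)
qed

lemma col_inv_sums:
  "(\<lambda>m. 1 / (of_nat (Suc m) * z + of_int n) + 1 / (- of_nat (Suc m) * z + of_int n)) sums col_inv n"
proof -
  have pos: "(\<lambda>m. 1 / (of_nat (Suc m) * z + of_int n) + 1 / (- of_nat (Suc m) * z + of_int n)) sums col_inv n"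
    if "n > 0" for n
  proof -
    have "Im (of_int n * w) > 0" using that Im_w by simp
    note cot_sums[OF this]
    from sums_divide[OF sums_minus[OF this], of z] have "(\<lambda>m. - (1 / (of_int n * w + of_nat (Suc m)) + 1 / (of_int n * w - of_nat (Suc m))) / z) sums col_inv n"
      using that by (simp add: col_inv_def)
    also have "(\<lambda>m. - (1 / (of_int n * w + of_nat (Suc m)) + 1 / (of_int n * w - of_nat (Suc m))) / z) =
      (\<lambda>m. 1 / (of_nat (Suc m) * z + of_int n) + 1 / (- of_nat (Suc m) * z + of_int n))"
      unfolding lat_to_w by (simp add: diff_divide_distrib add.commute)
    finally show ?thesis .
  qed
  consider "n = 0" | "n > 0" | "n < 0" by linarith
  then show ?thesis
  proof cases
    case 1
    then show ?thesis by (simp add: col_inv_def del: of_nat_Suc)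
  next
    case 2
    then show ?thesis by (rule pos)
  next
    case 3
    have e: "1 / (of_nat (Suc m) * z + of_int n) + 1 / (- of_nat (Suc m) * z + of_int n) =
          - (1 / (of_nat (Suc m) * z + of_int (-n)) + 1 / (- of_nat (Suc m) * z + of_int (-n)))" for m
    proof -
      have "of_nat (Suc m) * z + of_int n = - (- of_nat (Suc m) * z + of_int (-n))"
           "- of_nat (Suc m) * z + of_int n = - (of_nat (Suc m) * z + of_int (-n))" by (simp_all add: algebra_simps)
      then show ?thesis by (simp only: divide_minus_right) (rule minus_add[symmetric])
    qed
    from sums_minus[OF pos[of "-n"]] 3 show ?thesis unfolding e col_inv_minus by simp
  qed
qed

lemma col_sq_sums:
  "(\<lambda>m. 1 / (of_nat (Suc m) * z + of_int n)\<^sup>2 + 1 / (- of_nat (Suc m) * z + of_int n)\<^sup>2) sums col_sq n"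
proof -
  have pos: "(\<lambda>m. 1 / (of_nat (Suc m) * z + of_int n)\<^sup>2 + 1 / (- of_nat (Suc m) * z + of_int n)\<^sup>2) sums col_sq n"
    if "n > 0" for n
  proof -
    have "Im (of_int n * w) > 0" using that Im_w by simp
    from sums_divide[OF has_sum_symmetric[OF has_sum_shift_2[OF this]], of "z\<^sup>2"]
    have "(\<lambda>m. (1 / (of_int n * w + of_nat (Suc m))\<^sup>2 + 1 / (of_int n * w - of_nat (Suc m))\<^sup>2) / z\<^sup>2) sums
         ((- 4 * of_real (pi\<^sup>2) * qeval (powers 1) (of_int n * w) - 1 / (of_int n * w)\<^sup>2) / z\<^sup>2)" by (simp del: of_nat_Suc)
    also have "((- 4 * of_real (pi\<^sup>2) * qeval (powers 1) (of_int n * w) - 1 / (of_int n * w)\<^sup>2) / z\<^sup>2) = col_sq n"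
      using that z_nz by (simp add: col_sq_def diff_divide_distrib w_def power_mult_distrib power_divide)
    also have "(\<lambda>m. (1 / (of_int n * w + of_nat (Suc m))\<^sup>2 + 1 / (of_int n * w - of_nat (Suc m))\<^sup>2) / z\<^sup>2) =
       (\<lambda>m. 1 / (of_nat (Suc m) * z + of_int n)\<^sup>2 + 1 / (- of_nat (Suc m) * z + of_int n)\<^sup>2)"
    proof
      fix m
      have sq: "1 / x\<^sup>2 = (1 / x)\<^sup>2" for x :: complex by (simp add: power_divide)
      show "(1 / (of_int n * w + of_nat (Suc m))\<^sup>2 + 1 / (of_int n * w - of_nat (Suc m))\<^sup>2) / z\<^sup>2 =
         1 / (of_nat (Suc m) * z + of_int n)\<^sup>2 + 1 / (- of_nat (Suc m) * z + of_int n)\<^sup>2"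
        unfolding sq lat_to_w by (simp add: power_divide add_divide_distrib add.commute power_mult_distrib del: of_nat_Suc)
    qed
    finally show ?thesis .
  qed
  consider "n = 0" | "n > 0" | "n < 0" by linarith
  then show ?thesis
  proof cases
    case 1
    have "(\<lambda>m. complex_of_real (1 / (real m + 1)\<^sup>2)) sums complex_of_real (pi\<^sup>2 / 6)"
      using inverse_squares_sums by (subst sums_of_real_iff) (simp add: add.commute)
    from sums_mult[OF this, of "2 / z\<^sup>2"]
    have "(\<lambda>m. 2 / z\<^sup>2 * complex_of_real (1 / (real m + 1)\<^sup>2)) sums col_sq n"
      using 1 by (simp add: col_sq_def)
    moreover have "2 / z\<^sup>2 * complex_of_real (1 / (real m + 1)\<^sup>2) =
       1 / (of_nat (Suc m) * z + of_int n)\<^sup>2 + 1 / (- of_nat (Suc m) * z + of_int n)\<^sup>2" for m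
    proof -
      have "real m + 1 = real (Suc m)" by simp
      then show ?thesis using 1 by (simp only:) (simp add: power_mult_distrib del: of_nat_Suc)
    qed
    ultimately show ?thesis by simp
  next
    case 2
    then show ?thesis by (rule pos)
  next
    case 3
    have e: "1 / (of_nat (Suc m) * z + of_int n)\<^sup>2 + 1 / (- of_nat (Suc m) * z + of_int n)\<^sup>2 =
          (1 / (of_nat (Suc m) * z + of_int (-n))\<^sup>2 + 1 / (- of_nat (Suc m) * z + of_int (-n))\<^sup>2)" for m
    proof -
      have "of_nat (Suc m) * z + of_int n = - (- of_nat (Suc m) * z + of_int (-n))"
           "- of_nat (Suc m) * z + of_int n = - (of_nat (Suc m) * z + of_int (-n))" by (simp_all add: algebra_simps)
      then show ?thesis by (simp only: power2_minus add.commute)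
    qed
    have "col_sq (- n) = col_sq n" by (simp add: col_sq_def)
    with pos[of "-n"] 3 show ?thesis unfolding e by simp
  qed
qed

text \<open>Convergence of the column comes from that of the double series, its value from three
  paired series; the one for 1/(w - 1) belongs to column n - 1.\<close>

lemma eis_pair_col: "((\<lambda>m. eis_pair z (m, n)) has_sum (col_sq n - (col_inv (n - 1) - col_inv n))) UNIV"
proof -
  have "(\<lambda>(m,n). eis_pair z (m, n)) summable_on (UNIV \<times> UNIV)"
    using eis_pair_summable[OF z] by simp
  hence "(\<lambda>(n,m). eis_pair z (m, n)) summable_on (UNIV \<times> UNIV)"
    using summable_on_swap[of "eis_pair z" UNIV UNIV] by simp
  hence s: "(\<lambda>m. eis_pair z (m, n)) summable_on UNIV"
    by (rule summable_on_SigmaD1) auto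
  have "(\<lambda>m. (1 / (of_nat (Suc m) * z + of_int n)\<^sup>2 + 1 / (- of_nat (Suc m) * z + of_int n)\<^sup>2) -
    ((1 / (of_nat (Suc m) * z + of_int (n - 1)) + 1 / (- of_nat (Suc m) * z + of_int (n - 1))) -
    (1 / (of_nat (Suc m) * z + of_int n) + 1 / (- of_nat (Suc m) * z + of_int n))))
     sums (col_sq n - (col_inv (n - 1) - col_inv n))"
    by (intro sums_diff col_sq_sums col_inv_sums)
  also have "(\<lambda>m. (1 / (of_nat (Suc m) * z + of_int n)\<^sup>2 + 1 / (- of_nat (Suc m) * z + of_int n)\<^sup>2) -
    ((1 / (of_nat (Suc m) * z + of_int (n - 1)) + 1 / (- of_nat (Suc m) * z + of_int (n - 1))) -
    (1 / (of_nat (Suc m) * z + of_int n) + 1 / (- of_nat (Suc m) * z + of_int n)))) = (\<lambda>m. eis_pair z (m, n))"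
    by (simp add: eis_pair_def lat_term_def fun_eq_iff diff_add_eq[symmetric] add_diff_eq del: of_nat_Suc)
  finally have "(\<lambda>m. eis_pair z (m, n)) sums (col_sq n - (col_inv (n - 1) - col_inv n))" .
  with has_sum_imp_sums[OF has_sum_infsum[OF s]] has_sum_infsum[OF s] show ?thesis
    using sums_unique2 by metis
qed

lemma has_sum_eis_cols:
  "((\<lambda>n. col_sq n - (col_inv (n - 1) - col_inv n)) has_sum (- 8 * of_real (pi\<^sup>2) * qeval (sigma_fps 1) z)) UNIV"
proof (rule has_sum_SigmaD)
  have "((\<lambda>(n,m). eis_pair z (m, n)) has_sum (- 8 * of_real (pi\<^sup>2) * qeval (sigma_fps 1) z)) (UNIV \<times> UNIV)"
    using has_sum_eis_pair[OF z] by (subst (asm) has_sum_swap)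
  then show "((\<lambda>(n,m). eis_pair z (m, n)) has_sum (- 8 * of_real (pi\<^sup>2) * qeval (sigma_fps 1) z)) (SIGMA n:UNIV. UNIV)" .
qed (use eis_pair_col in auto)

text \<open>With q = \<open>qexp w\<close>, q^n -> 0 and so cot(pi n w) -> -i. This limit is the
  source of the quasi-period of E2.\<close>

lemma col_inv_tendsto: "(\<lambda>n. col_inv (int n)) \<longlonglongrightarrow> \<i> * of_real pi / z"
proof -
  have q: "norm (qexp w) < 1" using Im_w by (rule norm_qexp_less_1)
  have l1: "(\<lambda>n. qexp w ^ n) \<longlonglongrightarrow> 0" using q by (rule LIMSEQ_power_zero)
  have wnz: "w \<noteq> 0" using Im_w by auto
  have l2: "(\<lambda>n. 1 / (of_nat n * w)) \<longlonglongrightarrow> 0"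
    using tendsto_mult_left_zero[OF lim_inverse_n, of "inverse w"] by (simp add: divide_inverse mult.commute)
  have "(\<lambda>n. - (of_real pi * (\<i> * (qexp w ^ n + 1) / (qexp w ^ n - 1)) - 1 / (of_nat n * w)) / z) \<longlonglongrightarrow>
     - (of_real pi * (\<i> * (0 + 1) / (0 - 1)) - 0) / z"
    using z_nz by (intro tendsto_intros l1 l2) auto
  hence "(\<lambda>n. - (of_real pi * (\<i> * (qexp w ^ n + 1) / (qexp w ^ n - 1)) - 1 / (of_nat n * w)) / z) \<longlonglongrightarrow> \<i> * of_real pi / z"
    by (simp add: mult_ac)
  moreover have "eventually (\<lambda>n. - (of_real pi * (\<i> * (qexp w ^ n + 1) / (qexp w ^ n - 1)) - 1 / (of_nat n * w)) / z = col_inv (int n)) sequentially"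
    using eventually_gt_at_top[of 0]
  proof eventually_elim
    case (elim n)
    have "Im (of_nat n * w) > 0" using elim Im_w by simp
    from cot_pi_qexp[OF this] elim show ?case by (simp add: col_inv_def qexp_mult_nat)
  qed
  ultimately show ?thesis by (rule Lim_transform_eventually)
qed

text \<open>Equates the two orders of summation. Columns n and -n together give twice the series of
  \<open>powers 1\<close> at n w, the removed terms give -2 zeta(2), and the oddness of
  \<open>col_inv\<close> leaves two telescoping sums, each with limit i pi / z at its upper
  end.\<close>

lemma E2_S_aux:
  "- 8 * of_real (pi\<^sup>2) * qeval (sigma_fps 1) z = 2 * (of_real pi ^ 2 / 6) / z\<^sup>2 - 2 * (of_real pi ^ 2 / 6)
     - 8 * of_real (pi\<^sup>2) * qeval (sigma_fps 1) w / z\<^sup>2 + 2 * (\<i> * of_real pi / z)"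
proof -
  define c where "c = (\<lambda>n. col_sq n - (col_inv (n - 1) - col_inv n))"
  define U where "U = (\<lambda>n. col_inv (int n))"
  have U0: "U 0 = 0" by (simp add: U_def col_inv_def)
  have c0: "c 0 = 2 * (of_real pi ^ 2 / 6) / z\<^sup>2 + U 1"
    using col_inv_minus[of 1] by (simp add: c_def U_def col_sq_def) (simp add: col_inv_def)
  define F where "F = (\<lambda>m. 2 * ((- 4 * of_real (pi\<^sup>2) * qeval (powers 1) (of_nat (Suc m) * w)) / z\<^sup>2 - complex_of_real (1 / (real m + 1)\<^sup>2)) + ((U (Suc (Suc m)) - U (Suc m)) + (U (Suc m) - U m)))"
  have "(\<lambda>m. c (int (Suc m)) + c (- int (Suc m))) sums (- 8 * of_real (pi\<^sup>2) * qeval (sigma_fps 1) z - c 0)"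
    using has_sum_eis_cols unfolding c_def by (rule has_sum_symmetric)
  moreover have "(\<lambda>m. c (int (Suc m)) + c (- int (Suc m))) = F"
    unfolding F_def
  proof
    fix m
    have a: "- int (Suc m) - 1 = - int (Suc (Suc m))" by simp
    have b: "col_sq (int (Suc m)) = (- 4 * of_real (pi\<^sup>2) * qeval (powers 1) (of_nat (Suc m) * w)) / z\<^sup>2 - complex_of_real (1 / (real m + 1)\<^sup>2)"
      unfolding col_sq_def by (simp add: add.commute)
    have "col_sq (- int (Suc m)) = col_sq (int (Suc m))" by (simp add: col_sq_def del: of_nat_Suc)
    then show "c (int (Suc m)) + c (- int (Suc m)) =
       2 * ((- 4 * of_real (pi\<^sup>2) * qeval (powers 1) (of_nat (Suc m) * w)) / z\<^sup>2 - complex_of_real (1 / (real m + 1)\<^sup>2)) + ((U (Suc (Suc m)) - U (Suc m)) + (U (Suc m) - U m))"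
      unfolding c_def a col_inv_minus U_def b by simp
  qed
  moreover have "F sums (2 * ((- 4 * of_real (pi\<^sup>2) * qeval (sigma_fps 1) w) / z\<^sup>2 - complex_of_real (pi\<^sup>2 / 6)) + ((\<i> * of_real pi / z - U (Suc 0)) + (\<i> * of_real pi / z - U 0)))"
    unfolding F_def
  proof (rule sums_add[OF sums_mult[OF sums_diff[OF sums_divide[OF sums_mult]]] sums_add])
    have "((\<lambda>m. qeval (powers 1) (of_nat (Suc m) * w)) has_sum qeval (sigma_fps 1) w) UNIV"
      using has_sum_Lambert[OF Im_w, of 1] has_sum_Suc_iff[of "\<lambda>m. qeval (powers 1) (of_nat m * w)"] by simp
    then show "(\<lambda>m. qeval (powers 1) (of_nat (Suc m) * w)) sums qeval (sigma_fps 1) w" by (rule has_sum_imp_sums)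
    show "(\<lambda>m. complex_of_real (1 / (real m + 1)\<^sup>2)) sums complex_of_real (pi\<^sup>2 / 6)"
      using inverse_squares_sums by (subst sums_of_real_iff) (simp add: add.commute)
    have U: "U \<longlonglongrightarrow> \<i> * of_real pi / z" using col_inv_tendsto by (simp add: U_def)
    show "(\<lambda>m. U (Suc m) - U m) sums (\<i> * of_real pi / z - U 0)" using U by (rule telescope_sums)
    have "(\<lambda>m. U (Suc m)) \<longlonglongrightarrow> \<i> * of_real pi / z" using U by (rule LIMSEQ_Suc)
    then show "(\<lambda>m. U (Suc (Suc m)) - U (Suc m)) sums (\<i> * of_real pi / z - U (Suc 0))" by (rule telescope_sums)
  qed
  ultimately have "- 8 * of_real (pi\<^sup>2) * qeval (sigma_fps 1) z - c 0 =
     2 * ((- 4 * of_real (pi\<^sup>2) * qeval (sigma_fps 1) w) / z\<^sup>2 - complex_of_real (pi\<^sup>2 / 6)) + ((\<i> * of_real pi / z - U (Suc 0)) + (\<i> * of_real pi / z - U 0))"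
    by (auto dest: sums_unique2)
  then show ?thesis unfolding c0 U0 by (simp add: algebra_simps)
qed

end

definition E2 :: "complex \<Rightarrow> complex" where
  "E2 z = 1 - 24 * qeval (sigma_fps 1) z"

lemma E2_S:
  assumes "Im z > 0"
  shows "E2 (- 1 / z) = z\<^sup>2 * E2 z - 6 * \<i> * z / of_real pi"
proof -
  have z: "z \<noteq> 0" using assms by auto
  define x y p where "x = qeval (sigma_fps 1) z" and "y = qeval (sigma_fps 1) (- 1 / z)" and "p = complex_of_real pi"
  have p: "p \<noteq> 0" by (simp add: p_def)
  have "- 8 * p\<^sup>2 * x = 2 * (p ^ 2 / 6) / z\<^sup>2 - 2 * (p ^ 2 / 6) - 8 * p\<^sup>2 * y / z\<^sup>2 + 2 * (\<i> * p / z)"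
    using E2_S_aux[OF assms] by (simp add: x_def y_def p_def)
  hence "(- 8 * p\<^sup>2 * x) * (3 * z\<^sup>2) = (2 * (p ^ 2 / 6) / z\<^sup>2 - 2 * (p ^ 2 / 6) - 8 * p\<^sup>2 * y / z\<^sup>2 + 2 * (\<i> * p / z)) * (3 * z\<^sup>2)"
    by simp
  also have "\<dots> = p\<^sup>2 - p\<^sup>2 * z\<^sup>2 - 24 * p\<^sup>2 * y + 6 * \<i> * p * z"
    using z by (simp add: field_simps power2_eq_square)
  finally have "p * (p * (1 - 24 * y)) = p * (p * (z\<^sup>2 * (1 - 24 * x)) - 6 * \<i> * z)"
    by (simp add: algebra_simps power2_eq_square)
  hence "p * (1 - 24 * y) = p * (z\<^sup>2 * (1 - 24 * x)) - 6 * \<i> * z" using p by simp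
  hence "1 - 24 * y = z\<^sup>2 * (1 - 24 * x) - 6 * \<i> * z / p" using p by (simp add: field_simps)
  then show ?thesis by (simp add: E2_def x_def y_def p_def)
qed

section \<open>A maximum principle for level one\<close>

abbreviation uhp :: "complex set" where "uhp \<equiv> {z. Im z > 0}"

lemma Im_minus_inverse: "Im (- 1 / z) = Im z / (norm z)\<^sup>2"
  by (simp add: Im_divide cmod_power2)

lemma Im_minus_inverse_pos: "Im z > 0 \<Longrightarrow> Im (- 1 / z) > 0"
  unfolding Im_minus_inverse by (intro divide_pos_pos) auto

lemma shift_invariant_reduce:
  assumes "\<And>z::complex. Im z > 0 \<Longrightarrow> norm (h (z + 1)) = norm (h z)" "Im z > 0"
  shows "\<exists>w. Im w = Im z \<and> \<bar>Re w\<bar> \<le> 1/2 \<and> norm (h w) = norm (h z)"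
proof -
  have nat: "norm (h (z + of_nat n)) = norm (h z)" if "Im z > 0" for n z
  proof (induction n)
    case (Suc n)
    have "norm (h (z + of_nat n + 1)) = norm (h (z + of_nat n))" by (rule assms) (use that in simp)
    then show ?case using Suc by (simp add: add_ac)
  qed simp
  have int: "norm (h (z + of_int n)) = norm (h z)" for n
  proof (cases n)
    case (nonneg m)
    then show ?thesis using nat[of z m] assms(2) by simp
  next
    case (neg m)
    have "norm (h (z + of_int n + of_nat (Suc m))) = norm (h (z + of_int n))"
      by (rule nat) (use assms(2) in simp)
    then show ?thesis using neg by (simp add: add_ac)
  qed
  define n where "n = - round (Re z)"
  have "\<bar>Re z + of_int n\<bar> \<le> 1/2"
    using of_int_round_abs_le[of "Re z"] unfolding n_def by (simp add: abs_minus_commute)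
  then show ?thesis using int[of n] by (intro exI[of _ "z + of_int n"]) auto
qed

text \<open>Im w >= 1/2 is a weaker goal than the fundamental domain and easier to reach: if |Re w|
  <= 1/2 and Im w < 1/2 then |w|^2 <= 1/2, so the inversion at least doubles the imaginary part. The
  induction is on the number of doublings.\<close>

lemma modular_reduce:
  fixes h :: "complex \<Rightarrow> complex"
  assumes T: "\<And>z. Im z > 0 \<Longrightarrow> norm (h (z + 1)) = norm (h z)"
    and S: "\<And>z. Im z > 0 \<Longrightarrow> norm (h (- 1 / z)) = norm (h z)"
    and z: "Im z > 0"
  shows "\<exists>w. Im w \<ge> 1/2 \<and> \<bar>Re w\<bar> \<le> 1/2 \<and> norm (h w) = norm (h z)"
proof -
  have "\<exists>w. Im w \<ge> 1/2 \<and> \<bar>Re w\<bar> \<le> 1/2 \<and> norm (h w) = norm (h z)"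
    if "Im z > 0" "Im z * 2 ^ k \<ge> 1 / 2" for z k
    using that
  proof (induction k arbitrary: z)
    case 0
    have "\<exists>w. Im w = Im z \<and> \<bar>Re w\<bar> \<le> 1/2 \<and> norm (h w) = norm (h z)"
      by (rule shift_invariant_reduce[where h = h], rule T) (use 0 in auto)
    then obtain w where "Im w = Im z" "\<bar>Re w\<bar> \<le> 1/2" "norm (h w) = norm (h z)" by blast
    with 0 show ?case by (intro exI[of _ w]) auto
  next
    case (Suc k)
    have "\<exists>w. Im w = Im z \<and> \<bar>Re w\<bar> \<le> 1/2 \<and> norm (h w) = norm (h z)"
      by (rule shift_invariant_reduce[where h = h], rule T) (use Suc.prems in auto)
    then obtain w where w: "Im w = Im z" "\<bar>Re w\<bar> \<le> 1/2" "norm (h w) = norm (h z)"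
      by blast
    show ?case
    proof (cases "Im z \<ge> 1/2")
      case True
      then show ?thesis using w by (intro exI[of _ w]) auto
    next
      case False
      have "(norm w)\<^sup>2 = (Re w)\<^sup>2 + (Im w)\<^sup>2" by (rule cmod_power2)
      also have "\<dots> \<le> (1/2)\<^sup>2 + (1/2)\<^sup>2"
        using w False Suc.prems by (intro add_mono) (auto simp: abs_le_square_iff[symmetric])
      finally have n: "(norm w)\<^sup>2 \<le> 1/2" by (simp add: power2_eq_square)
      have wp: "Im w > 0" using w Suc.prems by simp
      have np: "(norm w)\<^sup>2 > 0" using wp by auto
      have "2 * Im w \<le> Im (- 1 / w)"
        unfolding Im_minus_inverse using n np wp by (simp add: field_simps)
      hence "2 * Im w * 2 ^ k \<le> Im (- 1 / w) * 2 ^ k" by (intro mult_right_mono) auto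
      hence "Im (- 1 / w) * 2 ^ k \<ge> 1/2" using Suc.prems w by simp
      from Suc.IH[OF Im_minus_inverse_pos[OF wp] this] show ?thesis using S[OF wp] w by simp
    qed
  qed
  moreover obtain k where "1 / (2 * Im z) < 2 ^ k" using real_arch_pow[of 2 "1 / (2 * Im z)"] by auto
  then have "Im z * 2 ^ k \<ge> 1 / 2" using z by (simp add: field_simps)
  ultimately show ?thesis using z by blast
qed

text \<open>By reduction and decay |h| attains its supremum on the compact rectangle
  \<open>K\<close>; hence h is constant, and the decay leaves only 0. Invariance is asked of |h|
  alone, which admits multipliers of modulus 1.\<close>

lemma level_one_vanish:
  fixes h :: "complex \<Rightarrow> complex"
  assumes hol: "h holomorphic_on uhp"
    and T: "\<And>z. Im z > 0 \<Longrightarrow> norm (h (z + 1)) = norm (h z)"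
    and S: "\<And>z. Im z > 0 \<Longrightarrow> norm (h (- 1 / z)) = norm (h z)"
    and lim: "\<And>e. e > 0 \<Longrightarrow> \<exists>Y. \<forall>z. Im z \<ge> Y \<longrightarrow> norm (h z) < e"
    and z: "Im z > 0"
  shows "h z = 0"
proof (rule ccontr)
  assume hz: "h z \<noteq> 0"
  obtain Y where Y: "\<And>w. Im w \<ge> Y \<Longrightarrow> norm (h w) < norm (h z)"
    using lim[of "norm (h z)"] hz by auto
  define K where "K = cbox (Complex (-1/2) (1/2)) (Complex (1/2) Y)"
  have inK: "w \<in> K \<longleftrightarrow> \<bar>Re w\<bar> \<le> 1/2 \<and> Im w \<ge> 1/2 \<and> Im w \<le> Y" for w
    unfolding K_def in_cbox_complex_iff by auto
  have red: "\<exists>w. Im w \<ge> 1/2 \<and> \<bar>Re w\<bar> \<le> 1/2 \<and> norm (h w) = norm (h y)" if "Im y > 0" for y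
    by (rule modular_reduce[where h = h], rule T, assumption, rule S) (use that in auto)
  obtain w1 where w1: "Im w1 \<ge> 1/2" "\<bar>Re w1\<bar> \<le> 1/2" "norm (h w1) = norm (h z)"
    using red[OF z] by blast
  have "w1 \<in> K" using Y[of w1] w1 unfolding inK by force
  moreover have "continuous_on K (\<lambda>z. norm (h z))"
    using inK by (intro continuous_on_norm continuous_on_subset[OF holomorphic_on_imp_continuous_on[OF hol]]) auto
  moreover have "compact K" by (simp add: K_def)
  ultimately obtain z0 where z0: "z0 \<in> K" "\<And>y. y \<in> K \<Longrightarrow> norm (h y) \<le> norm (h z0)"
    using continuous_attains_sup[of K "\<lambda>z. norm (h z)"] by blast
  have z1: "norm (h z) \<le> norm (h z0)" using z0(2)[OF \<open>w1 \<in> K\<close>] w1 by simp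
  have z0p: "Im z0 > 0" using z0(1) inK by auto
  have "norm (h y) \<le> norm (h z0)" if yp: "y \<in> uhp" for y
  proof -
    obtain w where w: "Im w \<ge> 1/2" "\<bar>Re w\<bar> \<le> 1/2" "norm (h w) = norm (h y)"
      using red[of y] yp by auto
    show ?thesis
    proof (cases "Im w \<ge> Y")
      case True
      then show ?thesis using Y[OF True] w z1 by simp
    next
      case False
      then show ?thesis using z0(2)[of w] w inK[of w] by simp
    qed
  qed
  moreover have "connected uhp" by (intro convex_connected convex_halfspace_Im_gt)
  ultimately have "h constant_on uhp"
    by (intro maximum_modulus_principle[OF hol open_halfspace_Im_gt _ open_halfspace_Im_gt, where \<xi> = z0])
      (use z0p in auto)
  then obtain c where c: "\<And>y. y \<in> uhp \<Longrightarrow> h y = c" unfolding constant_on_def by blast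
  have "norm (h (Complex 0 (max Y 1))) < norm (h z)" by (rule Y) simp
  with c[of "Complex 0 (max Y 1)"] c[of z] z show False by simp
qed

section \<open>Calculus of power series in q on the half-plane\<close>

definition conv1 :: "complex fps \<Rightarrow> bool" where
  "conv1 F \<longleftrightarrow> fps_conv_radius F \<ge> 1"

lemma conv1_add: "conv1 F \<Longrightarrow> conv1 G \<Longrightarrow> conv1 (F + G)"
  and conv1_diff: "conv1 F \<Longrightarrow> conv1 G \<Longrightarrow> conv1 (F - G)"
  and conv1_mult: "conv1 F \<Longrightarrow> conv1 G \<Longrightarrow> conv1 (F * G)"
  and conv1_power: "conv1 F \<Longrightarrow> conv1 (F ^ n)"
  and conv1_const: "conv1 (fps_const c)"
  and conv1_1: "conv1 1"
  and conv1_numeral: "conv1 (numeral k)"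
  and conv1_X: "conv1 fps_X"
  using fps_conv_radius_add[of F G] fps_conv_radius_diff[of F G] fps_conv_radius_mult[of F G]
    fps_conv_radius_power[of F n]
  by (auto simp: conv1_def min_def split: if_splits)

lemma conv1_sigma_fps: "conv1 (sigma_fps k)" and conv1_qdiff: "conv1 F \<Longrightarrow> conv1 (qdiff F)"
  using conv_radius_sigma_fps[of k] conv_radius_qdiff[of F] by (auto simp: conv1_def)

lemmas conv1_intros = conv1_add conv1_diff conv1_mult conv1_power conv1_const conv1_1 conv1_numeral conv1_X conv1_sigma_fps conv1_qdiff

lemma conv1_eball: "conv1 F \<Longrightarrow> Im z > 0 \<Longrightarrow> ereal (norm (qexp z)) < fps_conv_radius F"
  unfolding conv1_def by (rule in_eball_qexp)

lemma qeval_add: "conv1 F \<Longrightarrow> conv1 G \<Longrightarrow> Im z > 0 \<Longrightarrow> qeval (F + G) z = qeval F z + qeval G z"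
  and qeval_diff: "conv1 F \<Longrightarrow> conv1 G \<Longrightarrow> Im z > 0 \<Longrightarrow> qeval (F - G) z = qeval F z - qeval G z"
  and qeval_mult: "conv1 F \<Longrightarrow> conv1 G \<Longrightarrow> Im z > 0 \<Longrightarrow> qeval (F * G) z = qeval F z * qeval G z"
  and qeval_power: "conv1 F \<Longrightarrow> Im z > 0 \<Longrightarrow> qeval (F ^ n) z = qeval F z ^ n"
  and qeval_const: "qeval (fps_const c) z = c"
  and qeval_1: "qeval 1 z = 1"
  and qeval_numeral: "qeval (numeral k) z = numeral k"
  and qeval_X: "qeval fps_X z = qexp z"
  by (auto simp: qeval_def conv1_eball eval_fps_add eval_fps_diff eval_fps_mult eval_fps_power)

lemmas qeval_simps = qeval_add qeval_diff qeval_mult qeval_power qeval_const qeval_1 qeval_numeral qeval_X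

lemma holomorphic_qeval: "conv1 F \<Longrightarrow> qeval F holomorphic_on uhp"
proof -
  assume "conv1 F"
  then have "\<forall>z\<in>uhp. \<exists>d. (qeval F has_field_derivative d) (at z)"
    using has_field_derivative_qeval unfolding conv1_def by blast
  then show ?thesis by (subst holomorphic_on_open) (auto simp: open_halfspace_Im_gt)
qed

lemma qeval_shift: "qeval F (z + 1) = qeval F z"
  by (simp add: qeval_def qexp_add_1)

text \<open>F = q^k G, and Im z >= e keeps q in a closed disc inside the unit disc, where G is
  bounded.\<close>

lemma qeval_bound:
  assumes "conv1 F" "\<And>i. i < k \<Longrightarrow> fps_nth F i = 0" "e > 0"
  obtains C where "C > 0" "\<And>z. Im z \<ge> e \<Longrightarrow> norm (qeval F z) \<le> C * norm (qexp z) ^ k"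
proof -
  define r where "r = exp (- 2 * pi * e)"
  have r: "r < 1" "r \<ge> 0" using assms(3) by (auto simp: r_def)
  define G where "G = fps_shift k F"
  have G: "conv1 G" using assms(1) by (simp add: G_def conv1_def)
  have "compact (cball (0::complex) r)" by simp
  moreover have "continuous_on (cball 0 r) (eval_fps G)"
  proof (rule continuous_on_eval_fps[THEN continuous_on_subset])
    have "ereal r < fps_conv_radius G" using r G unfolding conv1_def
      by (metis ereal_less(3) less_le_trans)
    then show "cball 0 r \<subseteq> eball 0 (fps_conv_radius G)"
      by (auto simp: in_eball_iff dist_norm) (meson ereal_less_eq(3) le_less_trans)
  qed
  ultimately have "bounded (eval_fps G ` cball 0 r)"
    using compact_continuous_image compact_imp_bounded by blast
  then obtain C where C: "C > 0" "\<And>w. w \<in> cball 0 r \<Longrightarrow> norm (eval_fps G w) \<le> C"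
    unfolding bounded_pos by auto
  have "norm (qeval F z) \<le> C * norm (qexp z) ^ k" if z: "Im z \<ge> e" for z
  proof -
    have zp: "Im z > 0" using z assms(3) by simp
    have F: "F = fps_X ^ k * G"
      by (rule fps_ext) (auto simp: G_def fps_X_power_mult_nth assms(2))
    have "qeval F z = qexp z ^ k * qeval G z"
      unfolding F using G zp by (simp add: qeval_simps conv1_intros)
    moreover have "norm (qeval G z) \<le> C" unfolding qeval_def
      using z by (intro C) (simp add: norm_qexp r_def)
    ultimately show ?thesis by (simp add: norm_mult norm_power mult.commute[of C] mult_left_mono)
  qed
  with C(1) show ?thesis by (rule that)
qed

text \<open>After division by the leading power of q the series still vanishes on the half-plane;
  its constant term is then O(q) as Im z grows, hence 0, against the choice of the power.\<close>

lemma qeval_eq_0_imp: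
  assumes "conv1 F" "\<And>z. Im z > 0 \<Longrightarrow> qeval F z = 0"
  shows "F = 0"
proof (rule ccontr)
  assume F: "F \<noteq> 0"
  define k where "k = subdegree F"
  define G where "G = fps_shift k F"
  have G: "conv1 G" using assms(1) by (simp add: G_def conv1_def)
  have FG: "F = fps_X ^ k * G"
    using subdegree_decompose[of F] unfolding G_def k_def by (subst mult.commute)
  have "qeval G z = 0" if "Im z > 0" for z
  proof -
    have "qeval F z = qexp z ^ k * qeval G z"
      unfolding FG using G that by (simp add: qeval_simps conv1_intros)
    then show ?thesis using assms(2)[OF that] by simp
  qed
  note G0 = this
  define H where "H = fps_shift 1 G"
  have H: "conv1 H" using G by (simp add: H_def conv1_def)
  have GH: "G = fps_const (fps_nth G 0) + fps_X * H"
    by (rule fps_ext) (simp add: H_def)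
  obtain C where C: "C > 0" "\<And>z. Im z \<ge> 1 \<Longrightarrow> norm (qeval H z) \<le> C * norm (qexp z) ^ 0"
    using qeval_bound[OF H, of 0 1] by auto
  have bd: "norm (fps_nth G 0) \<le> C * exp (- 2 * pi * y)" if y: "y \<ge> 1" for y
  proof -
    define z where "z = Complex 0 y"
    have z: "Im z = y" "Im z > 0" using y by (auto simp: z_def)
    have "0 = fps_nth G 0 + qexp z * qeval H z"
      using G0[OF z(2)] H z(2) by (subst (asm) GH) (simp add: qeval_simps conv1_intros)
    then have "fps_nth G 0 = - (qexp z * qeval H z)" by (simp add: add_eq_0_iff)
    then have "norm (fps_nth G 0) = norm (qexp z) * norm (qeval H z)" by (simp add: norm_mult)
    also have "\<dots> \<le> norm (qexp z) * C" using C(2)[of z] z y by (intro mult_left_mono) auto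
    finally show ?thesis using z by (simp add: norm_qexp mult.commute)
  qed
  have "(\<lambda>n. C * exp (- 2 * pi) ^ n) \<longlonglongrightarrow> C * 0"
    by (intro tendsto_mult_left LIMSEQ_power_zero) auto
  moreover have "norm (fps_nth G 0) \<le> C * exp (- 2 * pi) ^ n" if "n \<ge> 1" for n
    using bd[of "real n"] that by (simp add: exp_of_nat_mult[symmetric] mult_ac)
  ultimately have "norm (fps_nth G 0) \<le> C * 0"
    by (intro tendsto_lowerbound[where F = sequentially]) (auto intro!: eventually_sequentiallyI[of 1])
  then have "fps_nth F k = 0" by (simp add: G_def)
  with F show False by (simp add: k_def nth_subdegree_nonzero)
qed

section \<open>The functions \<open>\<eta>\<^sup>2\<close> and \<open>E\<^sub>4\<close>\<close>

text \<open>This is -log of prod (1 - q^n): expanding the logarithms gives q^n the coefficient sum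
  over d | n of 1/d, which is sigma(n)/n.\<close>

definition euler_log :: "complex fps" where
  "euler_log = Abs_fps (\<lambda>n. of_nat (sigma_k 1 n) / of_nat n)"

text \<open>eta^2, of weight 1, written as an exponential: it visibly has no zeros, and its
  logarithmic derivative is a multiple of E2. The term i pi z / 6 is the factor q^(1/12).\<close>

definition eta2 :: "complex \<Rightarrow> complex" where
  "eta2 z = exp (\<i> * of_real pi * z / 6 - 2 * qeval euler_log z)"

lemma conv1_euler_log: "conv1 euler_log"
  unfolding conv1_def
proof (rule conv_radius_bounded_powers)
  fix n show "norm (fps_nth euler_log n) \<le> real n ^ 1"
    using sigma_k_le[of 1 n] by (cases "n = 0") (auto simp: euler_log_def norm_divide field_simps power2_eq_square simp flip: of_nat_mult)
qed

lemma qdiff_euler_log: "qdiff euler_log = sigma_fps 1"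
  by (rule fps_ext) (auto simp: fps_nth_qdiff euler_log_def sigma_fps_def sigma_k_def)

lemma eta2_nonzero [simp]: "eta2 z \<noteq> 0"
  by (simp add: eta2_def)

lemma has_field_derivative_ups':
  "conv1 F \<Longrightarrow> Im z > 0 \<Longrightarrow> (qeval F has_field_derivative (2 * of_real pi * \<i> * qeval (qdiff F) z)) (at z)"
  unfolding conv1_def by (rule has_field_derivative_qeval)

lemma has_field_derivative_eta2:
  assumes "Im z > 0"
  shows "(eta2 has_field_derivative (eta2 z * (\<i> * of_real pi / 6 * E2 z))) (at z)"
proof -
  have "((\<lambda>z. exp (\<i> * of_real pi * z / 6 - 2 * qeval euler_log z)) has_field_derivative
     (exp (\<i> * of_real pi * z / 6 - 2 * qeval euler_log z) * (\<i> * of_real pi / 6 - 2 * (2 * of_real pi * \<i> * qeval (qdiff euler_log) z)))) (at z)"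
    by (auto intro!: derivative_eq_intros has_field_derivative_ups' conv1_euler_log assms)
  then show ?thesis unfolding eta2_def[abs_def] qdiff_euler_log E2_def by (simp add: algebra_simps)
qed

lemma eta2_T: "eta2 (z + 1) = exp (\<i> * of_real pi / 6) * eta2 z"
proof -
  have "\<i> * of_real pi * (z + 1) / 6 - 2 * qeval euler_log (z + 1) =
     \<i> * of_real pi / 6 + (\<i> * of_real pi * z / 6 - 2 * qeval euler_log z)"
    unfolding qeval_shift by (simp add: algebra_simps add_divide_distrib)
  then show ?thesis unfolding eta2_def exp_add[symmetric] by simp
qed

lemma minus_inverse_deriv: "z \<noteq> 0 \<Longrightarrow> ((\<lambda>z::complex. - 1 / z) has_field_derivative (1 / z\<^sup>2)) (at z)"
  by (auto intro!: derivative_eq_intros simp: power2_eq_square)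

text \<open>By \<open>E2_S\<close> the quotient of eta2(-1/z) and z eta2(z) has derivative 0. Its
  constant value is found at z = i, the fixed point of the inversion.\<close>

lemma eta2_S:
  assumes "Im z > 0"
  shows "eta2 (- 1 / z) = - \<i> * z * eta2 z"
proof -
  define \<phi> where "\<phi> = (\<lambda>z. eta2 (- 1 / z) / (z * eta2 z))"
  have "(\<phi> has_field_derivative 0) (at z within uhp)" if "z \<in> uhp" for z
  proof -
    have z: "Im z > 0" "z \<noteq> 0" using that by auto
    define a b where "a = eta2 (- 1 / z)" and "b = eta2 z"
    have nz: "a \<noteq> 0" "b \<noteq> 0" by (auto simp: a_def b_def)
    have 1: "((\<lambda>z. eta2 (- 1 / z)) has_field_derivative
        (a * (\<i> * of_real pi / 6 * E2 (- 1 / z)) * (1 / z\<^sup>2))) (at z)"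
      unfolding a_def
      by (rule DERIV_chain2[OF has_field_derivative_eta2 minus_inverse_deriv]) (use z Im_minus_inverse_pos in auto)
    have 2: "((\<lambda>z. z * eta2 z) has_field_derivative (b + z * (b * (\<i> * of_real pi / 6 * E2 z)))) (at z)"
      unfolding b_def by (auto intro!: derivative_eq_intros has_field_derivative_eta2 z)
    have "(\<phi> has_field_derivative ((a * (\<i> * of_real pi / 6 * E2 (- 1 / z)) * (1 / z\<^sup>2) * (z * b) -
         a * (b + z * (b * (\<i> * of_real pi / 6 * E2 z)))) / (z * b * (z * b)))) (at z)"
      unfolding \<phi>_def using DERIV_divide[OF 1 2] z nz by (simp add: a_def b_def)
    moreover have "a * (\<i> * of_real pi / 6 * E2 (- 1 / z)) * (1 / z\<^sup>2) * (z * b) -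
         a * (b + z * (b * (\<i> * of_real pi / 6 * E2 z))) = 0"
      unfolding E2_S[OF z(1)] using z by (simp add: field_simps power2_eq_square)
    ultimately show ?thesis by (simp add: has_field_derivative_at_within)
  qed
  then obtain c where c: "\<And>z. z \<in> uhp \<Longrightarrow> \<phi> z = c"
    using has_field_derivative_zero_constant[OF convex_halfspace_Im_gt, of 0 \<phi>] by blast
  have "- 1 / \<i> = \<i>" by simp
  then have "c = 1 / \<i>" using c[of \<i>] unfolding \<phi>_def by simp
  then have "\<phi> z = - \<i>" using c[of z] assms by simp
  moreover have "z \<noteq> 0" using assms by auto
  ultimately show ?thesis unfolding \<phi>_def by (simp add: field_simps)
qed

text \<open>\<open>euler_log\<close> is bounded for Im z >= e, so |eta^2| is comparable to
  |q|^(1/12) from both sides.\<close>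

lemma eta2_bounds:
  assumes "e > 0"
  obtains c C where "c > 0" "C > 0" "\<And>z. Im z \<ge> e \<Longrightarrow> c * exp (- pi * Im z / 6) \<le> norm (eta2 z)"
    "\<And>z. Im z \<ge> e \<Longrightarrow> norm (eta2 z) \<le> C * exp (- pi * Im z / 6)"
proof -
  obtain K where K: "K > 0" "\<And>z. Im z \<ge> e \<Longrightarrow> norm (qeval euler_log z) \<le> K * norm (qexp z) ^ 0"
    using qeval_bound[OF conv1_euler_log, of 0 e] assms by auto
  have n: "norm (eta2 z) = exp (- 2 * Re (qeval euler_log z)) * exp (- pi * Im z / 6)" for z
    by (simp add: eta2_def norm_exp_eq_Re flip: exp_add)
  have R: "\<bar>Re (qeval euler_log z)\<bar> \<le> K" if "Im z \<ge> e" for z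
    using abs_Re_le_cmod[of "qeval euler_log z"] K(2)[OF that] by simp
  show ?thesis
  proof (rule that[of "exp (- 2 * K)" "exp (2 * K)"])
    fix z assume "Im z \<ge> e"
    from R[OF this] show "exp (- 2 * K) * exp (- pi * Im z / 6) \<le> norm (eta2 z)"
      "norm (eta2 z) \<le> exp (2 * K) * exp (- pi * Im z / 6)"
      unfolding n by (auto intro!: mult_right_mono)
  qed auto
qed

lemma holomorphic_eta2: "eta2 holomorphic_on uhp"
  unfolding eta2_def[abs_def] by (intro holomorphic_intros holomorphic_qeval conv1_euler_log) auto

text \<open>E2^2 - 12 q dE2/dq, a form for which differentiating the law of E2 gives the law of
  weight 4; \<open>Ramanujan_fps\<close> supplies the coefficients 240 sigma_3(n).\<close>

definition E4 :: "complex \<Rightarrow> complex" where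
  "E4 z = (E2 z)\<^sup>2 + 288 * qeval (qdiff (sigma_fps 1)) z"

lemma holomorphic_E2: "E2 holomorphic_on uhp"
  unfolding E2_def[abs_def] by (intro holomorphic_intros holomorphic_qeval conv1_intros)

lemma holomorphic_E4: "E4 holomorphic_on uhp"
  unfolding E4_def[abs_def] by (intro holomorphic_intros holomorphic_qeval conv1_intros holomorphic_E2)

lemma E2_T: "E2 (z + 1) = E2 z"
  by (simp add: E2_def qeval_shift)

lemma E4_T: "E4 (z + 1) = E4 z"
  by (simp add: E4_def E2_T qeval_shift)

lemma has_field_derivative_E2:
  assumes "Im z > 0"
  shows "(E2 has_field_derivative (- 48 * of_real pi * \<i> * qeval (qdiff (sigma_fps 1)) z)) (at z)"
  unfolding E2_def[abs_def]
  by (auto intro!: derivative_eq_intros has_field_derivative_ups' conv1_intros assms)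

text \<open>The derivative of \<open>E2_S\<close> brings terms with E2 / pi and 1 / pi^2, which
  cancel those in the square of \<open>E2_S\<close>.\<close>

lemma E4_S:
  assumes "Im z > 0"
  shows "E4 (- 1 / z) = z ^ 4 * E4 z"
proof -
  have z: "z \<noteq> 0" using assms by auto
  define x y p E where "x = qeval (qdiff (sigma_fps 1)) z" and "y = qeval (qdiff (sigma_fps 1)) (- 1 / z)"
    and "p = complex_of_real pi" and "E = E2 z"
  have p: "p \<noteq> 0" by (simp add: p_def)
  have 1: "((\<lambda>z. E2 (- 1 / z)) has_field_derivative ((- 48 * p * \<i> * y) * (1 / z\<^sup>2))) (at z)"
    unfolding p_def y_def
    by (rule DERIV_chain2[OF has_field_derivative_E2 minus_inverse_deriv]) (use assms z Im_minus_inverse_pos in auto)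
  have 2: "((\<lambda>z. z\<^sup>2 * E2 z - 6 * \<i> * z / of_real pi) has_field_derivative
       (2 * z * E + z\<^sup>2 * (- 48 * p * \<i> * x) - 6 * \<i> / p)) (at z)"
    unfolding p_def x_def E_def
    by (auto intro!: derivative_eq_intros has_field_derivative_E2 assms)
  have "((\<lambda>z. E2 (- 1 / z)) has_field_derivative (2 * z * E + z\<^sup>2 * (- 48 * p * \<i> * x) - 6 * \<i> / p)) (at z)"
    by (rule has_field_derivative_transform_within_open[OF 2 open_halfspace_Im_gt[of 0]])
       (use assms E2_S in auto)
  from DERIV_unique[OF 1 this] have "- 48 * p * \<i> * y = z\<^sup>2 * (2 * z * E + z\<^sup>2 * (- 48 * p * \<i> * x) - 6 * \<i> / p)"
    using z by (simp add: field_simps)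
  hence "(- 48 * p * \<i> * y) * (6 * \<i> / p) = (z\<^sup>2 * (2 * z * E + z\<^sup>2 * (- 48 * p * \<i> * x) - 6 * \<i> / p)) * (6 * \<i> / p)" by simp
  hence y: "288 * y = 12 * \<i> * z ^ 3 * E / p + 288 * z ^ 4 * x + 36 * z\<^sup>2 / p\<^sup>2"
    using p by (simp add: field_simps power2_eq_square power3_eq_cube power4_eq_xxxx)
  have "E4 (- 1 / z) = (z\<^sup>2 * E - 6 * \<i> * z / p)\<^sup>2 + 288 * y"
    unfolding E4_def y_def E2_S[OF assms] p_def E_def by simp
  also have "\<dots> = z ^ 4 * (E\<^sup>2 + 288 * x)"
    unfolding y using p by (simp add: field_simps power2_eq_square power3_eq_cube power4_eq_xxxx)
  finally show ?thesis by (simp add: E4_def x_def E_def)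
qed

section \<open>The lattice sum G4 and Ramanujan's identity\<close>

text \<open>The term with \<open>m = n = 0\<close> vanishes because \<open>1 / 0 = 0\<close>.\<close>
definition G4 :: "complex \<Rightarrow> complex" where
  "G4 z = (\<Sum>\<^sub>\<infinity>(m, n)\<in>UNIV. 1 / (of_int m * z + of_int n) ^ 4)"

lemma summable_G4:
  assumes "Im z > 0"
  shows "(\<lambda>(m, n). 1 / (of_int m * z + of_int n) ^ 4) summable_on (UNIV :: (int \<times> int) set)"
proof -
  obtain C where C: "C > 0" "\<And>m n::int. (m, n) \<noteq> (0, 0) \<Longrightarrow>
       1 / norm (of_int m * z + of_int n) \<le> C / (sqrt (1 + \<bar>of_int m\<bar>) * sqrt (1 + \<bar>of_int n\<bar>))"
    using norm_inverse_lattice_le[OF assms] by metis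
  have "(\<lambda>x. norm ((\<lambda>(m, n). 1 / (of_int m * z + of_int n) ^ 4) x)) summable_on (UNIV :: (int \<times> int) set)"
  proof (rule summable_on_comparison_test)
    show "(\<lambda>x. C ^ 4 * ((\<lambda>(m,n). lat_wt m * lat_wt n) x)) summable_on UNIV"
      using summable_lat_wt_mult by (rule summable_on_cmult_right)
    fix x :: "int \<times> int"
    obtain m n where x: "x = (m, n)" by (cases x)
    show "norm ((\<lambda>(m, n). 1 / (of_int m * z + of_int n) ^ 4) x) \<le> C ^ 4 * ((\<lambda>(m,n). lat_wt m * lat_wt n) x)"
    proof (cases "(m, n) = (0, 0)")
      case True
      then show ?thesis using C(1) lat_wt_pos by (auto simp: x less_imp_le)
    next
      case False
      define a b where "a = sqrt (1 + \<bar>real_of_int m\<bar>)" and "b = sqrt (1 + \<bar>real_of_int n\<bar>)"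
      have ab: "a \<ge> 1" "b \<ge> 1" by (auto simp: a_def b_def)
      have "norm (1 / (of_int m * z + of_int n) ^ 4) = (1 / norm (of_int m * z + of_int n)) ^ 4"
        by (simp add: norm_divide norm_power power_one_over)
      also have "\<dots> \<le> (C / (a * b)) ^ 4" unfolding a_def b_def using C(2)[OF False] by (intro power_mono) auto
      also have "\<dots> = C ^ 4 * ((1 / a) ^ 4 * (1 / b) ^ 4)" by (simp add: power_divide power_mult_distrib)
      also have "\<dots> \<le> C ^ 4 * ((1 / a) ^ 3 * (1 / b) ^ 3)"
        using ab C(1) by (intro mult_left_mono mult_mono power_decreasing) auto
      also have "\<dots> = C ^ 4 * (lat_wt m * lat_wt n)" by (simp add: lat_wt_eq a_def b_def power_divide)
      finally show ?thesis by (simp add: x)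
    qed
  qed auto
  then show ?thesis by (rule abs_summable_summable)
qed

lemma G4_S:
  assumes "Im z > 0"
  shows "G4 (- 1 / z) = z ^ 4 * G4 z"
proof -
  have z: "z \<noteq> 0" using assms by auto
  have "G4 (- 1 / z) = (\<Sum>\<^sub>\<infinity>(m, n)\<in>UNIV. z ^ 4 * (1 / (of_int m * z + of_int n) ^ 4))"
    unfolding G4_def
  proof (rule infsum_reindex_bij_witness[of _ "\<lambda>(m, n). (- n, m)" "\<lambda>(m, n). (n, - m)"])
    fix x :: "int \<times> int"
    obtain m n where x: "x = (m, n)" by (cases x)
    have "of_int m * (- 1 / z) + of_int n = (of_int n * z + of_int (- m)) / z" using z by (simp add: field_simps)
    then show "(case case x of (m, n) \<Rightarrow> (n, - m) of (m, n) \<Rightarrow> z ^ 4 * (1 / (of_int m * z + of_int n) ^ 4)) =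
       (case x of (m, n) \<Rightarrow> 1 / (of_int m * (- 1 / z) + of_int n) ^ 4)"
      by (simp add: x power_divide)
  qed auto
  also have "\<dots> = z ^ 4 * G4 z" unfolding G4_def
    using infsum_cmult_right'[of "z ^ 4" "\<lambda>(m, n). 1 / (of_int m * z + of_int n) ^ 4" UNIV]
    by (simp add: case_prod_unfold)
  finally show ?thesis .
qed

text \<open>Rows m and -m agree by n -> -n, and each is Lipschitz's formula of order 4. The constant
  from row 0 stays unevaluated; \<open>Ramanujan_fps\<close> relates it to the other one by
  comparing coefficients of q.\<close>

lemma G4_expansion:
  obtains a where "\<And>z. Im z > 0 \<Longrightarrow> G4 z = a + 16 / 3 * of_real (pi ^ 4) * qeval (sigma_fps 3) z"
proof (rule that)
  fix z assume z: "Im z > 0"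
  define c where "c = 8 / 3 * complex_of_real (pi ^ 4)"
  define a where "a = (\<Sum>\<^sub>\<infinity>n::int. 1 / complex_of_int n ^ 4)"
  define r where "r = (\<lambda>m::int. if m = 0 then a else c * qeval (powers 3) (of_int \<bar>m\<bar> * z))"
  have "(r has_sum G4 z) UNIV"
  proof (rule has_sum_SigmaD)
    show "((\<lambda>(m, n). 1 / (of_int m * z + of_int n) ^ 4) has_sum G4 z) (UNIV \<times> (UNIV :: int set))"
      using summable_G4[OF z] unfolding G4_def by simp
  next
    fix m :: int
    show "((\<lambda>n. case (m, n) of (m, n) \<Rightarrow> 1 / (of_int m * z + of_int n) ^ 4) has_sum r m) UNIV"
    proof (cases "m = 0")
      case True
      have "(\<lambda>n. 1 / complex_of_int n ^ 4) summable_on UNIV"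
        using summable_on_SigmaD1[of "\<lambda>m n. 1 / (of_int m * z + of_int n) ^ 4" UNIV "\<lambda>_. UNIV" 0] summable_G4[OF z] by simp
      then show ?thesis using True by (simp add: r_def a_def)
    next
      case False
      have Im: "Im (of_int \<bar>m\<bar> * z) > 0" using z False by simp
      have h: "((\<lambda>n. 1 / (of_int \<bar>m\<bar> * z + of_int n) ^ 4) has_sum r m) UNIV"
        using has_sum_shift_4[OF Im] False by (simp add: r_def c_def)
      show ?thesis
      proof (cases "m > 0")
        case True
        then show ?thesis using h by simp
      next
        case mn: False
        have "((\<lambda>n. 1 / (of_int \<bar>m\<bar> * z + of_int n) ^ 4) has_sum r m) UNIV \<longleftrightarrow>
              ((\<lambda>n. 1 / (of_int m * z + of_int n) ^ 4) has_sum r m) UNIV"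
        proof (rule has_sum_reindex_bij_witness[of _ uminus uminus])
          fix n :: int
          have e: "of_int m * z + of_int (- n) = - (of_int \<bar>m\<bar> * z + of_int n)" using mn by simp
          have "(- x) ^ 4 = x ^ 4" for x :: complex by simp
          with e show "1 / (of_int m * z + of_int (- n)) ^ 4 = 1 / (of_int \<bar>m\<bar> * z + of_int n) ^ 4"
            by presburger
        qed auto
        then show ?thesis using h by simp
      qed
    qed
  qed
  from has_sum_symmetric[OF this]
  have "(\<lambda>m. 2 * c * qeval (powers 3) (of_nat (Suc m) * z)) sums (G4 z - a)" by (simp add: r_def add.commute mult.assoc)
  moreover have "((\<lambda>m. 2 * c * qeval (powers 3) (of_nat (Suc m) * z)) has_sum (2 * c * qeval (sigma_fps 3) z)) UNIV"
    using has_sum_Lambert[OF z, of 3] has_sum_Suc_iff[of "\<lambda>m. qeval (powers 3) (of_nat m * z)"]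
    by (intro has_sum_cmult_right) simp
  then have "(\<lambda>m. 2 * c * qeval (powers 3) (of_nat (Suc m) * z)) sums (2 * c * qeval (sigma_fps 3) z)"
    by (rule has_sum_imp_sums)
  ultimately have "G4 z - a = 2 * c * qeval (sigma_fps 3) z" by (rule sums_unique2)
  then have "G4 z = a + 2 * c * qeval (sigma_fps 3) z" by (simp add: diff_eq_eq add.commute)
  then show "G4 z = (\<Sum>\<^sub>\<infinity>n::int. 1 / complex_of_int n ^ 4) + 16 / 3 * of_real (pi ^ 4) * qeval (sigma_fps 3) z"
    by (simp add: c_def a_def)
qed

lemma exp_decay:
  fixes K :: real
  assumes "K > 0" "e > 0"
  shows "\<exists>Y\<ge>1. \<forall>y\<ge>Y. K * exp (- pi * y) < e"
proof (intro exI[of _ "max 1 (K / e)"] conjI allI impI)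
  fix y assume y: "y \<ge> max 1 (K / e)"
  have "1 * y \<le> pi * y" using pi_gt3 y by (intro mult_right_mono) auto
  moreover have "K / e \<le> y" using y by simp
  ultimately have "K / e < 1 + pi * y" by linarith
  also have "\<dots> \<le> exp (pi * y)" by (rule exp_ge_add_one_self)
  finally show "K * exp (- pi * y) < e" using assms by (simp add: field_simps exp_minus)
qed simp

text \<open>F^3 / Delta with Delta = \<open>eta2\<close> ^ 12 has weight 0, and it decays because
  F^3 has order at least 3 and Delta has order 1.\<close>

lemma weight4_level1_vanish:
  assumes F: "conv1 F" "fps_nth F 0 = 0"
    and S: "\<And>z. Im z > 0 \<Longrightarrow> qeval F (- 1 / z) = z ^ 4 * qeval F z"
  shows "F = 0"
proof (rule qeval_eq_0_imp[OF F(1)])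
  fix z :: complex assume z: "Im z > 0"
  define h where "h = (\<lambda>z. qeval F z ^ 3 / eta2 z ^ 12)"
  have "h z = 0"
  proof (rule level_one_vanish[OF _ _ _ _ z])
    show "h holomorphic_on uhp"
      unfolding h_def by (intro holomorphic_intros holomorphic_qeval holomorphic_eta2 F) auto
    show "norm (h (z + 1)) = norm (h z)" for z
      by (simp add: h_def qeval_shift eta2_T norm_divide norm_mult norm_power power_mult_distrib norm_exp_eq_Re)
    show "norm (h (- 1 / z)) = norm (h z)" if "Im z > 0" for z
    proof -
      have "z \<noteq> 0" using that by auto
      then show ?thesis unfolding h_def S[OF that] eta2_S[OF that]
        by (simp add: norm_divide norm_mult norm_power power_mult_distrib flip: power_mult)
    qed
    fix e :: real assume e: "e > 0"
    obtain C where C: "C > 0" "\<And>z. Im z \<ge> 1 \<Longrightarrow> norm (qeval F z) \<le> C * norm (qexp z) ^ 1"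
      using qeval_bound[OF F(1), of 1 1] F(2) by auto
    obtain c where c: "c > 0" "\<And>z. Im z \<ge> 1 \<Longrightarrow> c * exp (- pi * Im z / 6) \<le> norm (eta2 z)"
      by (rule eta2_bounds[of 1]) auto
    define K where "K = C ^ 3 / c ^ 12"
    have K: "K > 0" using C c by (simp add: K_def)
    have bd: "norm (h z) \<le> K * exp (- 4 * pi * Im z)" if "Im z \<ge> 1" for z
    proof -
      have "norm (h z) = norm (qeval F z) ^ 3 / norm (eta2 z) ^ 12" by (simp add: h_def norm_divide norm_power)
      also have "\<dots> \<le> (C * norm (qexp z) ^ 1) ^ 3 / (c * exp (- pi * Im z / 6)) ^ 12"
        using C(2)[OF that] c(2)[OF that] c(1) C(1) by (intro frac_le power_mono) auto
      also have "\<dots> = K * exp (- 4 * pi * Im z)"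
        by (simp add: K_def power_mult_distrib norm_qexp divide_simps flip: exp_of_nat_mult exp_add)
      finally show ?thesis .
    qed
    obtain Y where Y: "Y \<ge> 1" "\<And>y. y \<ge> Y \<Longrightarrow> K * exp (- pi * y) < e" using exp_decay[OF K e] by blast
    have "norm (h z) < e" if z: "Im z \<ge> Y" for z
    proof -
      have "norm (h z) \<le> K * exp (- 4 * pi * Im z)" by (rule bd) (use Y z in simp)
      also have "\<dots> \<le> K * exp (- pi * Im z)" using K Y z by (intro mult_left_mono) auto
      finally show ?thesis using Y(2)[OF z] by simp
    qed
    then show "\<exists>Y. \<forall>z. Im z \<ge> Y \<longrightarrow> norm (h z) < e" by blast
  qed
  then show "qeval F z = 0" by (simp add: h_def)
qed

lemma sigma_k_1: "sigma_k k 1 = 1" "sigma_k k (Suc 0) = 1" "sigma_k k 0 = 0"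
  by (auto simp: sigma_k_def)

text \<open>A multiple of the left side minus the series of G4 has weight 4 and no constant term, so
  it is 0. The coefficient of q on the left, -48 + 288 = 240, then gives the ratio of the constants
  in G4.\<close>

theorem Ramanujan_fps: "(1 - 24 * sigma_fps 1)\<^sup>2 + 288 * qdiff (sigma_fps 1) = 1 + 240 * sigma_fps 3"
proof -
  obtain a where a: "\<And>z. Im z > 0 \<Longrightarrow> G4 z = a + 16 / 3 * of_real (pi ^ 4) * qeval (sigma_fps 3) z"
    using G4_expansion by blast
  define b where "b = 16 / 3 * complex_of_real (pi ^ 4)"
  have b: "b \<noteq> 0" by (simp add: b_def)
  define W where "W = (1 - 24 * sigma_fps 1)\<^sup>2 + 288 * qdiff (sigma_fps 1)"
  define F where "F = fps_const a * W - (fps_const a + fps_const b * sigma_fps 3)"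
  have cr: "conv1 W" unfolding W_def by (intro conv1_intros)
  have W: "qeval W z = E4 z" if "Im z > 0" for z
    using that by (simp add: W_def E4_def E2_def qeval_simps conv1_intros)
  have F: "qeval F z = a * E4 z - G4 z" if "Im z > 0" for z
    using that a[OF that] by (simp add: F_def W qeval_simps conv1_intros cr b_def)
  have "F = 0"
  proof (rule weight4_level1_vanish)
    show "conv1 F" unfolding F_def by (intro conv1_intros cr)
    show "fps_nth F 0 = 0" by (simp add: F_def W_def sigma_fps_def sigma_k_1 qdiff_def power2_eq_square)
    show "qeval F (- 1 / z) = z ^ 4 * qeval F z" if "Im z > 0" for z
      unfolding F[OF that] F[OF Im_minus_inverse_pos[OF that]] E4_S[OF that] G4_S[OF that] by (simp add: algebra_simps)
  qed
  then have e: "fps_const a * W = fps_const a + fps_const b * sigma_fps 3" by (simp add: F_def)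
  have "fps_nth W 1 = 240"
    by (simp add: W_def power2_eq_square fps_mult_nth_1 fps_nth_qdiff sigma_fps_def sigma_k_1 fps_one_nth)
  then have ab: "240 * a = b" using arg_cong[OF e, of "\<lambda>F. fps_nth F 1"] by (simp add: sigma_fps_def sigma_k_1 mult.commute)
  with b have anz: "a \<noteq> 0" by auto
  have "fps_const a * W = fps_const a * (1 + 240 * sigma_fps 3)"
    unfolding e ab[symmetric] by (simp add: algebra_simps flip: fps_const_mult numeral_fps_const)
  with anz show ?thesis by (simp add: W_def)
qed

section \<open>Slash operators indexed by integer matrices\<close>

type_synonym mat2 = "int \<times> int \<times> int \<times> int"

fun mmul :: "mat2 \<Rightarrow> mat2 \<Rightarrow> mat2" where
  "mmul (a, b, c, d) (a', b', c', d') = (a * a' + b * c', a * b' + b * d', c * a' + d * c', c * b' + d * d')"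

fun mdet :: "mat2 \<Rightarrow> int" where
  "mdet (a, b, c, d) = a * d - b * c"

fun minv :: "mat2 \<Rightarrow> mat2" where
  "minv (a, b, c, d) = (d, - b, - c, a)"

fun mob :: "mat2 \<Rightarrow> complex \<Rightarrow> complex" where
  "mob (a, b, c, d) z = (of_int a * z + of_int b) / (of_int c * z + of_int d)"

fun autf :: "mat2 \<Rightarrow> complex \<Rightarrow> complex" where
  "autf (a, b, c, d) z = of_int c * z + of_int d"

fun lower_left :: "mat2 \<Rightarrow> int" where
  "lower_left (a, b, c, d) = c"

abbreviation mI :: mat2 where "mI \<equiv> (1, 0, 0, 1)"
abbreviation mS :: mat2 where "mS \<equiv> (0, -1, 1, 0)"
abbreviation mT :: mat2 where "mT \<equiv> (1, 1, 0, 1)"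

lemma mmul_assoc: "mmul (mmul A B) C = mmul A (mmul B C)"
  by (cases A; cases B; cases C) (simp add: algebra_simps)

lemma mdet_mmul: "mdet (mmul A B) = mdet A * mdet B"
  by (cases A; cases B) (simp add: algebra_simps)

lemma mmul_mI [simp]: "mmul mI A = A" "mmul A mI = A"
  by (cases A; simp)+

lemma mmul_minv: "mdet A = 1 \<Longrightarrow> mmul A (minv A) = mI" "mdet A = 1 \<Longrightarrow> mmul (minv A) A = mI"
  by (cases A; simp add: algebra_simps)+

lemma mdet_minv [simp]: "mdet (minv A) = mdet A"
  by (cases A) (simp add: algebra_simps)

lemma autf_nonzero:
  assumes "mdet M > 0" "Im z > 0"
  shows "autf M z \<noteq> 0"
proof (cases M)
  case M: (fields a b c d)
  show ?thesis
  proof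
    assume j: "autf M z = 0"
    have "(c, d) \<noteq> (0, 0)" using assms(1) M by auto
    with lat_nonzero[OF assms(2), of c d] j show False by (simp add: M)
  qed
qed

lemma Im_mob:
  assumes "mdet M > 0" "Im z > 0"
  shows "Im (mob M z) = of_int (mdet M) * Im z / (norm (autf M z))\<^sup>2"
proof (cases M)
  case M: (fields a b c d)
  have "Im ((of_int a * z + of_int b) / (of_int c * z + of_int d)) =
     (of_int (a * d - b * c) * Im z) / (norm (of_int c * z + of_int d))\<^sup>2"
    unfolding Im_divide cmod_power2 by (simp add: algebra_simps)
  then show ?thesis by (simp add: M)
qed

lemma Im_mob_pos:
  assumes "mdet M > 0" "Im z > 0"
  shows "Im (mob M z) > 0"
  unfolding Im_mob[OF assms] using assms autf_nonzero[OF assms] by simp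

lemma autf_mmul:
  assumes "autf B z \<noteq> 0"
  shows "autf (mmul A B) z = autf A (mob B z) * autf B z"
  using assms by (cases A; cases B) (simp add: field_simps)

lemma mob_mmul:
  assumes "autf B z \<noteq> 0"
  shows "mob (mmul A B) z = mob A (mob B z)"
proof (cases A; cases B)
  fix a b c d a' b' c' d'
  assume A: "A = (a, b, c, d)" and B: "B = (a', b', c', d')"
  define j n where "j = of_int c' * z + of_int d'" and "n = of_int a' * z + of_int b'"
  have j: "j \<noteq> 0" using assms by (simp add: B j_def)
  have "mob (mmul A B) z = (of_int a * n + of_int b * j) / (of_int c * n + of_int d * j)"
    by (simp add: A B j_def n_def algebra_simps)
  also have "of_int a * n + of_int b * j = (of_int a * (n / j) + of_int b) * j" using j by (simp add: field_simps)
  also have "of_int c * n + of_int d * j = (of_int c * (n / j) + of_int d) * j" using j by (simp add: field_simps)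
  finally show ?thesis using j by (simp add: A B j_def n_def)
qed

lemma holomorphic_mob:
  assumes "mdet M > 0"
  shows "mob M holomorphic_on uhp"
proof (cases M)
  case M: (fields a b c d)
  have "of_int c * z + of_int d \<noteq> 0" if "z \<in> uhp" for z
    using autf_nonzero[OF assms, of z] that by (simp add: M)
  then have "(\<lambda>z. (of_int a * z + of_int b) / (of_int c * z + of_int d)) holomorphic_on uhp"
    by (intro holomorphic_intros) auto
  then show ?thesis by (simp add: M fun_eq_iff[symmetric] cong: holomorphic_cong)
qed

lemma holomorphic_autf: "autf M holomorphic_on uhp"
proof (cases M)
  case M: (fields a b c d)
  have "(\<lambda>z. of_int c * z + of_int d) holomorphic_on uhp"
    by (intro holomorphic_intros)
  then show ?thesis by (simp add: M cong: holomorphic_cong)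
qed

text \<open>Euclid's algorithm on the first column writes M as a word in T and S. The equivalence
  for T also covers T^-1; for S the implication covers S^-1 = S^3.\<close>

lemma sl2_induct [consumes 1, case_names id T S]:
  assumes det: "mdet M = 1"
    and id: "P mI"
    and T: "\<And>M. mdet M = 1 \<Longrightarrow> P (mmul mT M) \<longleftrightarrow> P M"
    and S: "\<And>M. mdet M = 1 \<Longrightarrow> P M \<Longrightarrow> P (mmul mS M)"
  shows "P M"
proof -
  have Tnat: "P (mmul (1, int k, 0, 1) M) \<longleftrightarrow> P M" if "mdet M = 1" for k M
  proof (induction k)
    case (Suc k)
    have "mmul (1, int (Suc k), 0, 1) M = mmul mT (mmul (1, int k, 0, 1) M)"
      by (cases M) (simp add: algebra_simps)
    then show ?case using T[of "mmul (1, int k, 0, 1) M"] Suc that by (simp add: mdet_mmul)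
  qed simp
  have Tint: "P (mmul (1, k, 0, 1) M) \<longleftrightarrow> P M" if "mdet M = 1" for k M
  proof (cases "k \<ge> 0")
    case True
    then show ?thesis using Tnat[OF that, of "nat k"] by simp
  next
    case False
    have "mmul (1, int (nat (- k)), 0, 1) (mmul (1, k, 0, 1) M) = M"
      using False by (cases M) (simp add: algebra_simps)
    then show ?thesis using Tnat[of "mmul (1, k, 0, 1) M" "nat (- k)"] that by (simp add: mdet_mmul)
  qed
  have S': "P M" if "mdet M = 1" "P (mmul mS M)" for M
  proof -
    have "M = mmul mS (mmul mS (mmul mS (mmul mS M)))" by (cases M) simp
    then show ?thesis using S[of "mmul mS (mmul mS (mmul mS M))"] S[of "mmul mS (mmul mS M)"] S[of "mmul mS M"] that
      by (simp add: mdet_mmul)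
  qed
  have "mdet M = 1 \<longrightarrow> P M"
  proof (induction "nat \<bar>lower_left M\<bar>" arbitrary: M rule: less_induct)
    case less
    obtain a b c d where M: "M = (a, b, c, d)" by (cases M)
    show ?case
    proof
      assume det: "mdet M = 1"
      show "P M"
      proof (cases "c = 0")
        case True
        with det have "a * d = 1" by (simp add: M)
        then consider "a = 1" "d = 1" | "a = -1" "d = -1" using zmult_eq_1_iff by blast
        then show ?thesis
        proof cases
          case 1
          then show ?thesis using Tint[of mI b] id True by (simp add: M)
        next
          case 2
          \<comment> \<open>S^2 = -1 reduces the diagonal -1, -1 to a power of T.\<close>
          have "P (mmul mS (mmul mS (mmul (1, -b, 0, 1) mI)))" using Tint[of mI "-b"] id
            by (intro S) (simp_all add: mdet_mmul)
          then show ?thesis using 2 True by (simp add: M)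
        qed
      next
        case False
        define q where "q = a div c"
        define M' where "M' = mmul mS (mmul (1, - q, 0, 1) M)"
        have "lower_left M' = a mod c" by (simp add: M'_def M q_def minus_div_mult_eq_mod algebra_simps)
        moreover have "\<bar>a mod c\<bar> < \<bar>c\<bar>" using False by (rule abs_mod_less)
        moreover have "mdet M' = 1" using det by (simp add: M'_def mdet_mmul)
        ultimately have "P M'" using less.hyps[of M'] by (simp add: M)
        then have "P (mmul (1, - q, 0, 1) M)" unfolding M'_def by (rule S'[rotated]) (simp add: mdet_mmul det)
        then show ?thesis using Tint det by blast
      qed
    qed
  qed
  with det show ?thesis by blast
qed

text \<open>6 / (pi i), the quasi-period in E2(-1/z) = z^2 E2(z) + kappa z.\<close>

definition \<kappa> :: complex where "\<kappa> = - 6 * \<i> / of_real pi"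

text \<open>The correction kappa c / (c z + d) absorbs the quasi-period, so that left multiplication
  by SL2(Z) has no effect. The determinant makes diag(t, 1) give t E2(t z), the scaling for which
  the corrections of different t agree; E4 and eta^2 carry no such factor.\<close>

definition slashE2 :: "mat2 \<Rightarrow> complex \<Rightarrow> complex" where
  "slashE2 M z = of_int (mdet M) * E2 (mob M z) / (autf M z)\<^sup>2 - \<kappa> * of_int (lower_left M) / autf M z"

definition slashE4 :: "mat2 \<Rightarrow> complex \<Rightarrow> complex" where
  "slashE4 M z = E4 (mob M z) / autf M z ^ 4"

definition slashEta :: "mat2 \<Rightarrow> complex \<Rightarrow> complex" where
  "slashEta M z = eta2 (mob M z) / autf M z"

text \<open>With c( ) the lower left entry and j = \<open>autf\<close>, the cocycle identity c(M g)
  j(g) = c(M) det g + c(g) j(M g) splits the correction term.\<close>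

lemma slashE2_right:
  assumes "mdet M > 0" "mdet g = 1" "Im z > 0"
  shows "slashE2 (mmul M g) z = slashE2 M (mob g z) / (autf g z)\<^sup>2 - \<kappa> * of_int (lower_left g) / autf g z"
proof -
  have jg: "autf g z \<noteq> 0" using assms by (intro autf_nonzero) auto
  have w: "Im (mob g z) > 0" using assms by (intro Im_mob_pos) auto
  have jM: "autf M (mob g z) \<noteq> 0" using assms w by (intro autf_nonzero) auto
  obtain a b c d a' b' c' d' where M: "M = (a, b, c, d)" and g: "g = (a', b', c', d')"
    by (cases M; cases g)
  have "of_int (lower_left (mmul M g)) * autf g z = of_int c * of_int (mdet g) + of_int c' * autf (mmul M g) z"
    by (simp add: M g algebra_simps)
  hence "of_int (lower_left (mmul M g)) * autf g z = of_int c + of_int c' * (autf M (mob g z) * autf g z)"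
    using assms by (simp add: autf_mmul[OF jg])
  hence "of_int (lower_left (mmul M g)) / (autf M (mob g z) * autf g z) =
      of_int c / (autf M (mob g z) * (autf g z)\<^sup>2) + of_int c' / autf g z"
    using jg jM by (simp add: field_simps power2_eq_square)
  note prev = this
  have ll: "lower_left M = c" "lower_left g = c'" by (simp_all add: M g)
  have h: "\<kappa> * of_int (lower_left (mmul M g)) / (autf M (mob g z) * autf g z) =
      \<kappa> * (of_int (lower_left M) / (autf M (mob g z) * (autf g z)\<^sup>2) + of_int (lower_left g) / autf g z)"
    by (simp only: ll times_divide_eq_right[symmetric] prev)
  show ?thesis
    unfolding slashE2_def mdet_mmul mob_mmul[OF jg] autf_mmul[OF jg] h assms(2)
    by (simp add: power_mult_distrib diff_divide_distrib algebra_simps)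
qed

lemma slashE4_right:
  assumes "mdet M > 0" "mdet g = 1" "Im z > 0"
  shows "slashE4 (mmul M g) z = slashE4 M (mob g z) / autf g z ^ 4"
proof -
  have jg: "autf g z \<noteq> 0" using assms by (intro autf_nonzero) auto
  then show ?thesis by (simp add: slashE4_def mob_mmul autf_mmul power_mult_distrib)
qed

lemma slashEta_right:
  assumes "mdet M > 0" "mdet g = 1" "Im z > 0"
  shows "slashEta (mmul M g) z = slashEta M (mob g z) / autf g z"
proof -
  have jg: "autf g z \<noteq> 0" using assms by (intro autf_nonzero) auto
  then show ?thesis by (simp add: slashEta_def mob_mmul autf_mmul)
qed

section \<open>Left multiplication by T and S\<close>

lemma autf_mS: "autf (mmul mS M) z = mob M z * autf M z" if "autf M z \<noteq> 0"
  using that by (cases M) simp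

lemma mob_mS: "mob (mmul mS M) z = - 1 / mob M z"
  by (cases M) simp

lemma autf_mT: "autf (mmul mT M) z = autf M z"
  by (cases M) simp

lemma mob_mT: "mob (mmul mT M) z = mob M z + 1" if "autf M z \<noteq> 0"
  using that by (cases M) (simp add: field_simps)

lemma lower_left_mT: "lower_left (mmul mT M) = lower_left M"
  by (cases M) simp

context
  fixes M :: mat2 and z :: complex
  assumes det: "mdet M > 0" and z: "Im z > 0"
begin

lemma jnz: "autf M z \<noteq> 0" and wpos: "Im (mob M z) > 0" and wnz: "mob M z \<noteq> 0"
  using autf_nonzero[OF det z] Im_mob_pos[OF det z] by auto

lemma slashE2_T: "slashE2 (mmul mT M) z = slashE2 M z"
  using jnz by (simp add: slashE2_def mdet_mmul autf_mT mob_mT lower_left_mT E2_T)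

lemma slashE4_T: "slashE4 (mmul mT M) z = slashE4 M z"
  using jnz by (simp add: slashE4_def autf_mT mob_mT E4_T)

lemma slashEta_T: "slashEta (mmul mT M) z = exp (\<i> * of_real pi / 6) * slashEta M z"
  using jnz by (simp add: slashEta_def autf_mT mob_mT eta2_T)

lemma slashE4_S: "slashE4 (mmul mS M) z = slashE4 M z"
  using jnz wnz unfolding slashE4_def autf_mS[OF jnz] mob_mS E4_S[OF wpos] by (simp add: power_mult_distrib)

lemma slashEta_S: "slashEta (mmul mS M) z = - \<i> * slashEta M z"
  using jnz wnz unfolding slashEta_def autf_mS[OF jnz] mob_mS eta2_S[OF wpos] by simp

text \<open>S replaces the lower left entry c by a. This change of the correction term cancels the
  quasi-period of E2, because det M = a j - c w j with w j = a z + b.\<close>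

lemma slashE2_S: "slashE2 (mmul mS M) z = slashE2 M z"
proof -
  obtain a b c d where M: "M = (a, b, c, d)" by (cases M)
  define j w D where "j = autf M z" and "w = mob M z" and "D = complex_of_int (mdet M)"
  have nz: "j \<noteq> 0" "w \<noteq> 0" using jnz wnz by (auto simp: j_def w_def)
  have S: "E2 (- 1 / w) = w\<^sup>2 * E2 w + \<kappa> * w"
    unfolding w_def E2_S[OF wpos] by (simp add: \<kappa>_def)
  have wj: "w * j = of_int a * z + of_int b" using nz by (simp add: w_def j_def M)
  have "D - of_int a * j = - of_int c * (w * j)" unfolding wj by (simp add: D_def j_def M algebra_simps)
  hence D: "D = of_int a * j - of_int c * (w * j)" by (simp add: algebra_simps)
  have "D / (w * j\<^sup>2) = of_int a / (w * j) - of_int c / j"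
    unfolding D using nz by (simp add: diff_divide_distrib power2_eq_square)
  hence e: "\<kappa> * D / (w * j\<^sup>2) - \<kappa> * of_int a / (w * j) = - \<kappa> * of_int c / j"
    by (simp add: times_divide_eq_right[symmetric] right_diff_distrib[symmetric] del: times_divide_eq_right)
  have "slashE2 (mmul mS M) z = D * (w\<^sup>2 * E2 w + \<kappa> * w) / (w * j)\<^sup>2 - \<kappa> * of_int a / (w * j)"
    unfolding slashE2_def autf_mS[OF jnz] mob_mS w_def[symmetric] S j_def[symmetric]
    by (simp add: mdet_mmul D_def M)
  also have "\<dots> = D * E2 w / j\<^sup>2 + (\<kappa> * D / (w * j\<^sup>2) - \<kappa> * of_int a / (w * j))"
    using nz by (simp add: add_divide_distrib distrib_left power_mult_distrib power2_eq_square mult_ac)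
  also have "\<dots> = slashE2 M z" unfolding e by (simp add: slashE2_def D_def w_def j_def M)
  finally show ?thesis .
qed

end

lemma slashE2_left:
  assumes "mdet g = 1" "mdet M > 0" "Im z > 0"
  shows "slashE2 (mmul g M) z = slashE2 M z"
  using assms(1)
proof (induction rule: sl2_induct)
  case (T g)
  then show ?case using slashE2_T[of "mmul g M" z] assms by (simp add: mmul_assoc mdet_mmul)
next
  case (S g)
  then show ?case using slashE2_S[of "mmul g M" z] assms by (simp add: mmul_assoc mdet_mmul)
qed simp

lemma slashE4_left:
  assumes "mdet g = 1" "mdet M > 0" "Im z > 0"
  shows "slashE4 (mmul g M) z = slashE4 M z"
  using assms(1)
proof (induction rule: sl2_induct)
  case (T g)
  then show ?case using slashE4_T[of "mmul g M" z] assms by (simp add: mmul_assoc mdet_mmul)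
next
  case (S g)
  then show ?case using slashE4_S[of "mmul g M" z] assms by (simp add: mmul_assoc mdet_mmul)
qed simp

section \<open>The multiplier of eta^2 through congruences\<close>

text \<open>The exponent of the character of \<open>SL\<^sub>2(\<int>)\<close> belonging to \<open>\<eta>\<^sup>2\<close>, a twelfth root of unity.\<close>
fun psi :: "mat2 \<Rightarrow> int" where
  "psi (a, b, c, d) = (1 - c\<^sup>2) * (b * d + 3 * (c - 1) * d + c + 3) + c * (a + d - 3)"

definition chi :: "mat2 \<Rightarrow> complex" where
  "chi g = exp (\<i> * of_real pi / 6 * of_int (psi g))"

lemma exp_period_12:
  assumes "[m = n] (mod 12)"
  shows "exp (\<i> * of_real pi / 6 * of_int m) = exp (\<i> * of_real pi / 6 * of_int n)"
proof -
  obtain k where k: "m = n + 12 * k" using assms by (metis cong_iff_lin cong_sym mult.commute)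
  have "exp (\<i> * of_real pi / 6 * of_int m) = exp (\<i> * of_real pi / 6 * of_int n) * exp (2 * of_int k * of_real pi * \<i>)"
    unfolding k exp_add[symmetric] by (simp add: algebra_simps)
  also have "exp (2 * of_int k * of_real pi * \<i>) = 1"
    using exp_integer_2pi[of "of_int k"] by (simp add: mult_ac)
  finally show ?thesis by simp
qed

text \<open>f and g respect congruences, so a claim about all solutions of g = 1 becomes a finite
  check on residues; g will be a determinant.\<close>

lemma residue_check:
  fixes f g :: "int \<Rightarrow> int \<Rightarrow> int \<Rightarrow> int \<Rightarrow> int"
  assumes f: "\<And>a b c d a' b' c' d'. [a = a'] (mod m) \<Longrightarrow> [b = b'] (mod m) \<Longrightarrow> [c = c'] (mod m) \<Longrightarrow>
      [d = d'] (mod m) \<Longrightarrow> [f a b c d = f a' b' c' d'] (mod m)"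
    and g: "\<And>a b c d a' b' c' d'. [a = a'] (mod m) \<Longrightarrow> [b = b'] (mod m) \<Longrightarrow> [c = c'] (mod m) \<Longrightarrow>
      [d = d'] (mod m) \<Longrightarrow> [g a b c d = g a' b' c' d'] (mod m)"
    and R: "\<And>x. x mod m \<in> R"
    and check: "\<forall>a\<in>R. \<forall>b\<in>R. \<forall>c\<in>R. \<forall>d\<in>R. g a b c d mod m = 1 \<longrightarrow> f a b c d mod m = 0"
    and gm: "g a b c d mod m = 1"
  shows "[f a b c d = 0] (mod m)"
proof -
  note cong = unique_euclidean_semiring_class.cong_def
  have c: "[x = x mod m] (mod m)" for x by (simp add: cong)
  have "g (a mod m) (b mod m) (c mod m) (d mod m) mod m = 1"
    using g[OF c c c c, of a b c d] gm by (simp add: cong)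
  then have "f (a mod m) (b mod m) (c mod m) (d mod m) mod m = 0" using check R by blast
  then show ?thesis using f[OF c c c c, of a b c d] by (simp add: cong)
qed

lemma mod_3_in: "(x::int) mod 3 \<in> {0, 1, 2}" and mod_4_in: "(x::int) mod 4 \<in> {0, 1, 2, 3}"
  by (simp_all, presburger+)

text \<open>Splitting 12 = 3 * 4 leaves 3^4 + 4^4 cases in place of 12^4.\<close>

lemma residue_check_12:
  fixes f g :: "int \<Rightarrow> int \<Rightarrow> int \<Rightarrow> int \<Rightarrow> int"
  assumes f: "\<And>m a b c d a' b' c' d'. [a = a'] (mod m) \<Longrightarrow> [b = b'] (mod m) \<Longrightarrow> [c = c'] (mod m) \<Longrightarrow>
      [d = d'] (mod m) \<Longrightarrow> [f a b c d = f a' b' c' d'] (mod m)"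
    and g: "\<And>m a b c d a' b' c' d'. [a = a'] (mod m) \<Longrightarrow> [b = b'] (mod m) \<Longrightarrow> [c = c'] (mod m) \<Longrightarrow>
      [d = d'] (mod m) \<Longrightarrow> [g a b c d = g a' b' c' d'] (mod m)"
    and 3: "\<forall>a\<in>{0, 1, 2}. \<forall>b\<in>{0, 1, 2}. \<forall>c\<in>{0, 1, 2}. \<forall>d\<in>{0, 1, 2}. g a b c d mod 3 = 1 \<longrightarrow> f a b c d mod 3 = 0"
    and 4: "\<forall>a\<in>{0, 1, 2, 3}. \<forall>b\<in>{0, 1, 2, 3}. \<forall>c\<in>{0, 1, 2, 3}. \<forall>d\<in>{0, 1, 2, 3}.
      g a b c d mod 4 = 1 \<longrightarrow> f a b c d mod 4 = 0"
    and 1: "g a b c d = 1"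
  shows "[f a b c d = 0] (mod 12)"
proof -
  have "[f a b c d = 0] (mod 3)" by (rule residue_check[OF f g mod_3_in 3]) (simp_all add: 1)
  moreover have "[f a b c d = 0] (mod 4)" by (rule residue_check[OF f g mod_4_in 4]) (simp_all add: 1)
  moreover have "coprime 3 (4::int)" using coprime_add_one_right[of "3::int"] by simp
  ultimately have "[f a b c d = 0] (mod 3 * 4)" by (rule coprime_cong_mult)
  then show ?thesis by simp
qed

lemma psi_cong:
  "[a = a'] (mod m) \<Longrightarrow> [b = b'] (mod m) \<Longrightarrow> [c = c'] (mod m) \<Longrightarrow> [d = d'] (mod m)
       \<Longrightarrow> [psi (a, b, c, d) = psi (a', b', c', d')] (mod m)"
  unfolding psi.simps by (intro cong_add cong_mult cong_diff cong_pow cong_refl)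

lemma psi_T:
  assumes "a * d - b * c = 1"
  shows "[psi (a + c, b + d, c, d) = psi (a, b, c, d) + 1] (mod 12)"
proof -
  have "[psi (a + c, b + d, c, d) - (psi (a, b, c, d) + 1) = 0] (mod 12)"
    by (rule residue_check_12[where f = "\<lambda>a b c d. psi (a + c, b + d, c, d) - (psi (a, b, c, d) + 1)"
      and g = "\<lambda>a b c d. a * d - b * c" and a = a and b = b and c = c and d = d])
      ((intro psi_cong cong_add cong_mult cong_diff cong_refl; assumption)+, simp, simp, simp add: assms)
  then show ?thesis by (simp only: cong_diff_iff_cong_0)
qed

lemma psi_S:
  assumes "a * d - b * c = 1"
  shows "[psi (- c, - d, a, b) = psi (a, b, c, d) - 3] (mod 12)"
proof -
  have "[psi (0 - c, 0 - d, a, b) - (psi (a, b, c, d) - 3) = 0] (mod 12)"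
    by (rule residue_check_12[where f = "\<lambda>a b c d. psi (0 - c, 0 - d, a, b) - (psi (a, b, c, d) - 3)"
      and g = "\<lambda>a b c d. a * d - b * c" and a = a and b = b and c = c and d = d])
      ((intro psi_cong cong_add cong_mult cong_diff cong_refl; assumption)+, simp, simp, simp add: assms)
  then show ?thesis by (simp only: cong_diff_iff_cong_0 diff_0)
qed

text \<open>In terms of functions: eta^2(z) eta^2(11z), the newform of weight 2 and level 11, has
  trivial character.\<close>

lemma psi_level_11:
  assumes "a * d - b * (11 * c) = 1"
  shows "[psi (a, b, 11 * c, d) + psi (a, 11 * b, c, d) = 0] (mod 12)"
  by (rule residue_check_12[where f = "\<lambda>a b c d. psi (a, b, 11 * c, d) + psi (a, 11 * b, c, d)"
      and g = "\<lambda>a b c d. a * d - b * (11 * c)" and a = a and b = b and c = c and d = d])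
      ((intro psi_cong cong_add cong_mult cong_diff cong_refl; assumption)+, simp, simp, simp add: assms)

text \<open>The product eta^2(11z) eta^2(22z) begins with q^(11/4), so its character has order 4 and
  the relation holds modulo 3, not modulo 12.\<close>

lemma psi_level_22:
  assumes "a * d - b * (22 * c) = 1"
  shows "[psi (a, 11 * b, 2 * c, d) + psi (a, 22 * b, c, d) = 0] (mod 3)"
  by (rule residue_check[where f = "\<lambda>a b c d. psi (a, 11 * b, 2 * c, d) + psi (a, 22 * b, c, d)"
      and g = "\<lambda>a b c d. a * d - b * (22 * c)" and a = a and b = b and c = c and d = d, OF _ _ mod_3_in])
    ((intro psi_cong cong_add cong_mult cong_diff cong_refl; assumption)+, simp, simp add: assms)

lemma slashEta_left:
  assumes "mdet g = 1" "mdet M > 0" "Im z > 0"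
  shows "slashEta (mmul g M) z = chi g * slashEta M z"
  using assms(1)
proof (induction rule: sl2_induct)
  case id
  show ?case by (simp add: chi_def)
next
  case (T g)
  obtain a b c d where g: "g = (a, b, c, d)" by (cases g)
  have "chi (mmul mT g) = exp (\<i> * of_real pi / 6 * of_int (psi g + 1))"
    unfolding chi_def by (rule exp_period_12) (use psi_T[of a d b c] T in \<open>simp add: g del: psi.simps\<close>)
  also have "\<dots> = exp (\<i> * of_real pi / 6) * chi g"
    by (simp add: chi_def exp_add[symmetric] algebra_simps add_divide_distrib)
  finally show ?case using slashEta_T[of "mmul g M" z] assms T by (simp add: mmul_assoc mdet_mmul)
next
  case (S g)
  obtain a b c d where g: "g = (a, b, c, d)" by (cases g)
  have "chi (mmul mS g) = exp (\<i> * of_real pi / 6 * of_int (psi g - 3))"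
    unfolding chi_def by (rule exp_period_12) (use psi_S[of a d b c] S in \<open>simp add: g del: psi.simps\<close>)
  also have "\<dots> = chi g * exp (- (of_real (pi / 2) * \<i>))"
    by (simp add: chi_def exp_add[symmetric] algebra_simps diff_divide_distrib)
  also have "exp (- (of_real (pi / 2) * \<i>)) = - \<i>"
  proof -
    have "exp (- (of_real (pi / 2) * \<i>)) = cis (- (pi / 2))" by (simp add: cis_conv_exp mult.commute)
    then show ?thesis by (simp add: complex_eq_iff)
  qed
  finally show ?case using slashEta_S[of "mmul g M" z] assms S by (simp add: mmul_assoc mdet_mmul)
qed

section \<open>Growth at the cusps\<close>

definition upper_slot :: "mat2 \<Rightarrow> mat2 \<Rightarrow> bool" where
  "upper_slot M U \<longleftrightarrow> (\<exists>g. mdet g = 1 \<and> M = mmul g U)"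

text \<open>Hermite normal form: Bezout coefficients complete the first column, divided by its gcd,
  to a unimodular matrix. Slashing ignores SL2(Z) on the left up to a root of unity, so growth is
  read off from the triangular matrix.\<close>

lemma upper_triangularize:
  assumes "mdet (a, b, c, d) > 0"
  obtains \<beta> where "upper_slot (a, b, c, d) (gcd a c, \<beta>, 0, mdet (a, b, c, d) div gcd a c)"
    "gcd a c dvd mdet (a, b, c, d)" "gcd a c > 0"
proof -
  define \<alpha> where "\<alpha> = gcd a c"
  have "\<alpha> \<noteq> 0" using assms by (auto simp: \<alpha>_def)
  then have \<alpha>: "\<alpha> > 0" unfolding \<alpha>_def by (simp add: order_less_le)
  obtain a' c' where ac: "a = \<alpha> * a'" "c = \<alpha> * c'" unfolding \<alpha>_def by (metis dvd_def gcd_dvd1 gcd_dvd2)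
  obtain u v where uv: "u * a + v * c = \<alpha>" unfolding \<alpha>_def using bezout_int by blast
  have "\<alpha> * (u * a' + v * c') = \<alpha> * 1" using uv unfolding ac by (simp add: algebra_simps)
  then have 1: "u * a' + v * c' = 1" using \<alpha> by (simp del: mult_1_right)
  define \<beta> where "\<beta> = u * b + v * d"
  have D: "mdet (a, b, c, d) = \<alpha> * (a' * d - b * c')" by (simp add: ac algebra_simps)
  define \<delta> where "\<delta> = a' * d - b * c'"
  have "mmul (a', - v, c', u) (\<alpha>, \<beta>, 0, \<delta>) = (a, b, c, d)"
  proof -
    have "a' * \<beta> + - v * \<delta> = b * (u * a' + v * c')" by (simp add: \<beta>_def \<delta>_def algebra_simps)
    moreover have "c' * \<beta> + u * \<delta> = d * (u * a' + v * c')" by (simp add: \<beta>_def \<delta>_def algebra_simps)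
    ultimately show ?thesis using 1 by (simp add: ac mult.commute)
  qed
  moreover have "mdet (a', - v, c', u) = 1" using 1 by (simp add: algebra_simps)
  moreover have "mdet (a, b, c, d) div \<alpha> = \<delta>" unfolding D \<delta>_def using \<alpha> by simp
  ultimately have "upper_slot (a, b, c, d) (\<alpha>, \<beta>, 0, mdet (a, b, c, d) div \<alpha>)"
    unfolding upper_slot_def by (metis (no_types))
  moreover have "\<alpha> dvd mdet (a, b, c, d)" unfolding D by simp
  ultimately show ?thesis using \<alpha> that unfolding \<alpha>_def by blast
qed

definition bdd_inf :: "(complex \<Rightarrow> complex) \<Rightarrow> bool" where
  "bdd_inf f \<longleftrightarrow> (\<exists>C>0. \<forall>z. Im z \<ge> 1 \<longrightarrow> norm (f z) \<le> C)"

lemma bdd_inf_const: "bdd_inf (\<lambda>z. c)"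
  unfolding bdd_inf_def by (rule exI[of _ "norm c + 1"]) (auto intro: add_nonneg_pos)

lemma bdd_inf_add: "bdd_inf f \<Longrightarrow> bdd_inf g \<Longrightarrow> bdd_inf (\<lambda>z. f z + g z)"
  unfolding bdd_inf_def by (meson add_pos_pos norm_triangle_mono)

lemma bdd_inf_mult: "bdd_inf f \<Longrightarrow> bdd_inf g \<Longrightarrow> bdd_inf (\<lambda>z. f z * g z)"
  unfolding bdd_inf_def norm_mult by (meson mult_mono mult_pos_pos norm_ge_zero less_imp_le)

lemma bdd_inf_diff: "bdd_inf f \<Longrightarrow> bdd_inf g \<Longrightarrow> bdd_inf (\<lambda>z. f z - g z)"
  using bdd_inf_add[of f "\<lambda>z. -1 * g z"] bdd_inf_mult[OF bdd_inf_const[of "-1"], of g] by simp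

lemma bdd_inf_power: "bdd_inf f \<Longrightarrow> bdd_inf (\<lambda>z. f z ^ n)"
  by (induction n) (auto intro: bdd_inf_const bdd_inf_mult)

lemmas bdd_inf_intros = bdd_inf_const bdd_inf_add bdd_inf_mult bdd_inf_diff bdd_inf_power

lemma qeval_bdd: "conv1 F \<Longrightarrow> e > 0 \<Longrightarrow> \<exists>C>0. \<forall>z. Im z \<ge> e \<longrightarrow> norm (qeval F z) \<le> C"
  using qeval_bound[of F 0 e] by (metis less_nat_zero_code mult.right_neutral power_0)

lemma E2_eq_qeval: "Im z > 0 \<Longrightarrow> E2 z = qeval (1 - 24 * sigma_fps 1) z"
  by (simp add: E2_def qeval_simps conv1_intros)

lemma E4_eq_qeval: "Im z > 0 \<Longrightarrow> E4 z = qeval (1 + 240 * sigma_fps 3) z"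
  unfolding Ramanujan_fps[symmetric] by (simp add: E4_def E2_def qeval_simps conv1_intros)

lemma upper_slot_Im:
  assumes "\<alpha> > 0" "\<epsilon> > 0"
  shows "Im (mob (\<alpha>, \<beta>, 0, \<epsilon>) z) = real_of_int \<alpha> / real_of_int \<epsilon> * Im z" "autf (\<alpha>, \<beta>, 0, \<epsilon>) z = of_int \<epsilon>"
  by (simp_all add: Im_divide_of_real[of _ "of_int \<epsilon>", simplified])

lemma mob_upper_ge:
  assumes "\<alpha> > 0" "\<epsilon> > 0" "Im z \<ge> 1"
  shows "Im (mob (\<alpha>, \<beta>, 0, \<epsilon>) z) \<ge> 1 / real_of_int \<epsilon>"
  unfolding upper_slot_Im[OF assms(1,2)]
proof -
  have "1 * 1 \<le> real_of_int \<alpha> * Im z" using assms by (intro mult_mono) auto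
  then show "1 / real_of_int \<epsilon> \<le> real_of_int \<alpha> / real_of_int \<epsilon> * Im z" using assms by (simp add: field_simps)
qed

text \<open>For the triangular representative \<open>autf\<close> is constant, and the image of Im z
  >= 1 stays at height at least 1/epsilon, where the q-series are bounded.\<close>

lemma
  assumes "mdet M > 0"
  shows bdd_inf_slashE2: "bdd_inf (slashE2 M)" and bdd_inf_slashE4: "bdd_inf (slashE4 M)"
proof -
  obtain a b c d where M: "M = (a, b, c, d)" by (cases M)
  obtain \<beta> where slot: "upper_slot M (gcd a c, \<beta>, 0, mdet M div gcd a c)" "gcd a c dvd mdet M" "gcd a c > 0"
    using upper_triangularize[of a b c d] assms unfolding M by blast
  define \<alpha> \<epsilon> where "\<alpha> = gcd a c" and "\<epsilon> = mdet M div gcd a c"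
  have pos: "\<alpha> > 0" "\<epsilon> > 0" using slot assms by (auto simp: \<alpha>_def \<epsilon>_def pos_imp_zdiv_pos_iff intro: zdvd_imp_le)
  define U where "U = (\<alpha>, \<beta>, 0 :: int, \<epsilon>)"
  have U: "mdet U > 0" using pos by (simp add: U_def)
  obtain g where g: "mdet g = 1" "M = mmul g U" using slot(1) unfolding upper_slot_def U_def \<alpha>_def \<epsilon>_def by blast
  have e: "1 / real_of_int \<epsilon> > 0" using pos by simp
  have crE: "conv1 (1 - 24 * sigma_fps 1)" and crV: "conv1 (1 + 240 * sigma_fps 3)" by (intro conv1_intros)+
  obtain C where C: "C > 0" "\<And>z. Im z \<ge> 1 / real_of_int \<epsilon> \<Longrightarrow> norm (qeval (1 - 24 * sigma_fps 1) z) \<le> C"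
    using qeval_bdd[OF crE e] by blast
  obtain C' where C': "C' > 0" "\<And>z. Im z \<ge> 1 / real_of_int \<epsilon> \<Longrightarrow> norm (qeval (1 + 240 * sigma_fps 3) z) \<le> C'"
    using qeval_bdd[OF crV e] by blast
  show "bdd_inf (slashE2 M)" unfolding bdd_inf_def
  proof (intro exI conjI allI impI)
    show "of_int \<alpha> / of_int \<epsilon> * C > 0" using pos C by simp
    fix z assume z: "Im z \<ge> 1"
    have w: "Im (mob U z) \<ge> 1 / real_of_int \<epsilon>" unfolding U_def using pos z by (rule mob_upper_ge)
    then have w0: "Im (mob U z) > 0" using e by linarith
    have "slashE2 M z = slashE2 U z" unfolding g(2) using g(1) U z by (intro slashE2_left) auto
    also have "\<dots> = of_int \<alpha> / of_int \<epsilon> * E2 (mob U z)"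
      using pos by (simp add: slashE2_def U_def power2_eq_square)
    finally have "norm (slashE2 M z) = of_int \<alpha> / of_int \<epsilon> * norm (E2 (mob U z))" using pos by (simp add: norm_mult norm_divide)
    also have "\<dots> \<le> of_int \<alpha> / of_int \<epsilon> * C" unfolding E2_eq_qeval[OF w0] using pos w by (intro mult_left_mono C) auto
    finally show "norm (slashE2 M z) \<le> of_int \<alpha> / of_int \<epsilon> * C" .
  qed
  show "bdd_inf (slashE4 M)" unfolding bdd_inf_def
  proof (intro exI conjI allI impI)
    show "C' / of_int \<epsilon> ^ 4 > 0" using pos C' by simp
    fix z assume z: "Im z \<ge> 1"
    have w: "Im (mob U z) \<ge> 1 / real_of_int \<epsilon>" unfolding U_def using pos z by (rule mob_upper_ge)
    then have w0: "Im (mob U z) > 0" using e by linarith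
    have "slashE4 M z = slashE4 U z" unfolding g(2) using g(1) U z by (intro slashE4_left) auto
    also have "\<dots> = E4 (mob U z) / of_int \<epsilon> ^ 4" by (simp add: slashE4_def U_def)
    finally have "norm (slashE4 M z) = norm (E4 (mob U z)) / of_int \<epsilon> ^ 4" using pos by (simp add: norm_power norm_divide)
    also have "\<dots> \<le> C' / of_int \<epsilon> ^ 4" unfolding E4_eq_qeval[OF w0] using pos w by (intro divide_right_mono C') auto
    finally show "norm (slashE4 M z) \<le> C' / of_int \<epsilon> ^ 4" .
  qed
qed

lemma norm_chi [simp]: "norm (chi g) = 1"
  by (simp add: chi_def norm_exp_eq_Re)

text \<open>r is the quotient alpha / epsilon of the diagonal of the triangular form, the factor by
  which it scales imaginary parts. The lower bound serves negative exponents.\<close>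

lemma slashEta_bounds:
  assumes "mdet (a, b, c, d) > 0"
  defines "r \<equiv> (of_int (gcd a c))\<^sup>2 / real_of_int (mdet (a, b, c, d))"
  obtains k K where "k > 0" "K > 0"
    "\<And>z. Im z \<ge> 1 \<Longrightarrow> k * exp (- pi * r * Im z / 6) \<le> norm (slashEta (a, b, c, d) z)"
    "\<And>z. Im z \<ge> 1 \<Longrightarrow> norm (slashEta (a, b, c, d) z) \<le> K * exp (- pi * r * Im z / 6)"
proof -
  define M where "M = (a, b, c, d)"
  obtain \<beta> where slot: "upper_slot M (gcd a c, \<beta>, 0, mdet M div gcd a c)" "gcd a c dvd mdet M" "gcd a c > 0"
    using upper_triangularize[of a b c d] assms(1) unfolding M_def by blast
  have det: "mdet M > 0" using assms by (simp add: M_def)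
  define \<alpha> \<epsilon> where "\<alpha> = gcd a c" and "\<epsilon> = mdet M div gcd a c"
  have pos: "\<alpha> > 0" "\<epsilon> > 0" using slot det by (auto simp: \<alpha>_def \<epsilon>_def pos_imp_zdiv_pos_iff intro: zdvd_imp_le)
  have D: "mdet M = \<alpha> * \<epsilon>" using slot(2) by (simp add: \<alpha>_def \<epsilon>_def)
  have r: "r = real_of_int \<alpha> / real_of_int \<epsilon>" unfolding r_def M_def[symmetric] D \<alpha>_def[symmetric]
    using pos by (simp add: power2_eq_square)
  define U where "U = (\<alpha>, \<beta>, 0 :: int, \<epsilon>)"
  have U: "mdet U > 0" using pos by (simp add: U_def)
  obtain g where g: "mdet g = 1" "M = mmul g U" using slot(1) unfolding upper_slot_def U_def \<alpha>_def \<epsilon>_def by blast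
  have e: "1 / real_of_int \<epsilon> > 0" using pos by simp
  obtain k K where k: "k > 0" "K > 0" "\<And>z. Im z \<ge> 1 / real_of_int \<epsilon> \<Longrightarrow> k * exp (- pi * Im z / 6) \<le> norm (eta2 z)"
    "\<And>z. Im z \<ge> 1 / real_of_int \<epsilon> \<Longrightarrow> norm (eta2 z) \<le> K * exp (- pi * Im z / 6)"
    using eta2_bounds[OF e] by metis
  have n: "norm (slashEta M z) = norm (eta2 (mob U z)) / \<epsilon>"
     "Im (mob U z) \<ge> 1 / real_of_int \<epsilon>" "Im (mob U z) = r * Im z" if z: "Im z \<ge> 1" for z
  proof -
    have "slashEta M z = chi g * slashEta U z" unfolding g(2) using g(1) U z by (intro slashEta_left) auto
    then show "norm (slashEta M z) = norm (eta2 (mob U z)) / \<epsilon>" using pos by (simp add: norm_mult slashEta_def U_def norm_divide)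
    show "Im (mob U z) \<ge> 1 / real_of_int \<epsilon>" unfolding U_def using pos z by (rule mob_upper_ge)
    show "Im (mob U z) = r * Im z" unfolding U_def r using upper_slot_Im(1)[OF pos] .
  qed
  show ?thesis
  proof (rule that[of "k / \<epsilon>" "K / \<epsilon>"])
    fix z assume z: "Im z \<ge> 1"
    show "k / \<epsilon> * exp (- pi * r * Im z / 6) \<le> norm (slashEta (a, b, c, d) z)"
      using divide_right_mono[OF k(3)[OF n(2)[OF z]], of \<epsilon>] pos
      unfolding M_def[symmetric] n(1)[OF z] n(3)[OF z] by (simp add: mult_ac)
    show "norm (slashEta (a, b, c, d) z) \<le> K / \<epsilon> * exp (- pi * r * Im z / 6)"
      using divide_right_mono[OF k(4)[OF n(2)[OF z]], of \<epsilon>] pos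
      unfolding M_def[symmetric] n(1)[OF z] n(3)[OF z] by (simp add: mult_ac)
  qed (use k pos in auto)
qed

lemma slashEta_nonzero: "mdet M > 0 \<Longrightarrow> Im z > 0 \<Longrightarrow> slashEta M z \<noteq> 0"
  using autf_nonzero[of M z] by (simp add: slashEta_def)

lemma slashEta_powi_bound:
  assumes "mdet (a, b, c, d) > 0"
  shows "\<exists>K>0. \<forall>z. Im z \<ge> 1 \<longrightarrow> norm (slashEta (a, b, c, d) z powi e) \<le>
     K * exp (- pi * Im z / 6 * (of_int e * ((of_int (gcd a c))\<^sup>2 / real_of_int (mdet (a, b, c, d)))))"
proof -
  define r where "r = (of_int (gcd a c))\<^sup>2 / real_of_int (mdet (a, b, c, d))"
  obtain k K where k: "k > 0" "K > 0"
    "\<And>z. Im z \<ge> 1 \<Longrightarrow> k * exp (- pi * r * Im z / 6) \<le> norm (slashEta (a, b, c, d) z)"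
    "\<And>z. Im z \<ge> 1 \<Longrightarrow> norm (slashEta (a, b, c, d) z) \<le> K * exp (- pi * r * Im z / 6)"
    using slashEta_bounds[OF assms] unfolding r_def by metis
  show ?thesis unfolding r_def[symmetric]
  proof (cases "e \<ge> 0")
    case True
    show "\<exists>K>0. \<forall>z. Im z \<ge> 1 \<longrightarrow> norm (slashEta (a, b, c, d) z powi e) \<le> K * exp (- pi * Im z / 6 * (of_int e * r))"
    proof (intro exI conjI allI impI)
      show "K ^ nat e > 0" using k by simp
      fix z assume z: "Im z \<ge> 1"
      have "norm (slashEta (a, b, c, d) z powi e) = norm (slashEta (a, b, c, d) z) ^ nat e"
        using True by (simp add: power_int_def norm_power)
      also have "\<dots> \<le> (K * exp (- pi * r * Im z / 6)) ^ nat e" using k(4)[OF z] by (intro power_mono) auto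
      also have "\<dots> = K ^ nat e * exp (- pi * Im z / 6 * (of_int e * r))"
        using True by (simp add: power_mult_distrib exp_of_nat_mult[symmetric] mult_ac)
      finally show "norm (slashEta (a, b, c, d) z powi e) \<le> K ^ nat e * exp (- pi * Im z / 6 * (of_int e * r))" .
    qed
  next
    case False
    show "\<exists>K>0. \<forall>z. Im z \<ge> 1 \<longrightarrow> norm (slashEta (a, b, c, d) z powi e) \<le> K * exp (- pi * Im z / 6 * (of_int e * r))"
    proof (intro exI conjI allI impI)
      show "inverse k ^ nat (- e) > 0" using k by simp
      fix z assume z: "Im z \<ge> 1"
      have kp: "k * exp (- pi * r * Im z / 6) > 0" using k by simp
      have "norm (slashEta (a, b, c, d) z powi e) = inverse (norm (slashEta (a, b, c, d) z)) ^ nat (- e)"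
        using False by (simp add: power_int_def norm_power norm_inverse)
      also have "\<dots> \<le> inverse (k * exp (- pi * r * Im z / 6)) ^ nat (- e)"
        using k(3)[OF z] kp by (intro power_mono le_imp_inverse_le) auto
      also have "\<dots> = inverse k ^ nat (- e) * exp (- pi * Im z / 6 * (of_int e * r))"
        using False by (simp add: power_mult_distrib exp_of_nat_mult[symmetric] mult_ac flip: exp_minus)
      finally show "norm (slashEta (a, b, c, d) z powi e) \<le> inverse k ^ nat (- e) * exp (- pi * Im z / 6 * (of_int e * r))" .
    qed
  qed
qed

text \<open>Left multiplication by diag(t, 1): slashing at \<open>dscale t M\<close> is f(t z)
  slashed by M.\<close>

fun dscale :: "int \<Rightarrow> mat2 \<Rightarrow> mat2" where
  "dscale t (a, b, c, d) = (t * a, t * b, c, d)"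

text \<open>Conjugation by diag(t, 1), integral when t divides the lower left entry. For t | 22 it
  moves an element of Gamma_0(22) past the scaling and keeps it in SL2(Z).\<close>

fun conj_dscale :: "int \<Rightarrow> mat2 \<Rightarrow> mat2" where
  "conj_dscale t (a, b, c, d) = (a, t * b, c div t, d)"

lemma mdet_dscale [simp]: "mdet (dscale t M) = t * mdet M"
  by (cases M) (simp add: algebra_simps)

lemma dscale_mmul: "dscale t (mmul A B) = mmul (dscale t A) B"
  by (cases A; cases B) (simp add: algebra_simps)

lemma dscale_mmul_conj: "t dvd lower_left g \<Longrightarrow> dscale t (mmul g M) = mmul (conj_dscale t g) (dscale t M)"
  by (cases g; cases M; cases "t = 0") (auto simp: algebra_simps elim!: dvdE)

lemma mdet_conj_dscale: "t dvd lower_left g \<Longrightarrow> t \<noteq> 0 \<Longrightarrow> mdet (conj_dscale t g) = mdet g"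
  by (cases g) (auto elim!: dvdE)

text \<open>The exponents of \<open>etaq\<close> refer to \<open>\<eta>\<^sup>2(z), \<eta>\<^sup>2(2z), \<eta>\<^sup>2(11z), \<eta>\<^sup>2(22z)\<close>.\<close>
fun etaq :: "int \<times> int \<times> int \<times> int \<Rightarrow> mat2 \<Rightarrow> complex \<Rightarrow> complex" where
  "etaq (e1, e2, e3, e4) M z = slashEta (dscale 1 M) z powi e1 * slashEta (dscale 2 M) z powi e2 *
     slashEta (dscale 11 M) z powi e3 * slashEta (dscale 22 M) z powi e4"

fun weight :: "int \<times> int \<times> int \<times> int \<Rightarrow> int" where
  "weight (e1, e2, e3, e4) = e1 + e2 + e3 + e4"

lemma etaq_right:
  assumes "mdet M = 1" "mdet g = 1" "Im z > 0"
  shows "etaq e (mmul M g) z = etaq e M (mob g z) / autf g z powi (weight e)"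
proof -
  obtain e1 e2 e3 e4 where e: "e = (e1, e2, e3, e4)" by (cases e)
  have j: "autf g z \<noteq> 0" using assms by (intro autf_nonzero) auto
  show ?thesis unfolding e etaq.simps dscale_mmul weight.simps
    using assms j by (simp add: slashEta_right power_int_divide_distrib power_int_add)
qed

fun psi_sum :: "int \<times> int \<times> int \<times> int \<Rightarrow> mat2 \<Rightarrow> int" where
  "psi_sum (e1, e2, e3, e4) g = e1 * psi (conj_dscale 1 g) + e2 * psi (conj_dscale 2 g) + e3 * psi (conj_dscale 11 g) + e4 * psi (conj_dscale 22 g)"

lemma chi_powi: "chi g powi e = exp (\<i> * of_real pi / 6 * of_int (e * psi g))"
  unfolding chi_def using exp_power_int[of "\<i> * of_real pi / 6 * of_int (psi g)" e] by (simp add: mult_ac)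

lemma etaq_left:
  assumes "mdet g = 1" "22 dvd lower_left g" "mdet M = 1" "Im z > 0" "[psi_sum e g = 0] (mod 12)"
  shows "etaq e (mmul g M) z = etaq e M z"
proof -
  obtain e1 e2 e3 e4 where e: "e = (e1, e2, e3, e4)" by (cases e)
  have dvd: "2 dvd lower_left g" "11 dvd lower_left g" using assms(2) by presburger+
  have N: "slashEta (dscale t (mmul g M)) z = chi (conj_dscale t g) * slashEta (dscale t M) z" if "t dvd lower_left g" "t > 0" for t
    unfolding dscale_mmul_conj[OF that(1)] using that assms by (intro slashEta_left) (auto simp: mdet_conj_dscale)
  have "chi (conj_dscale 1 g) powi e1 * chi (conj_dscale 2 g) powi e2 * chi (conj_dscale 11 g) powi e3 * chi (conj_dscale 22 g) powi e4
     = exp (\<i> * of_real pi / 6 * of_int (psi_sum e g))"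
    unfolding chi_powi exp_add[symmetric] e psi_sum.simps by (simp add: algebra_simps del: psi.simps conj_dscale.simps)
  also have "\<dots> = 1" using exp_period_12[OF assms(5)] by simp
  finally have c: "chi (conj_dscale 1 g) powi e1 * chi (conj_dscale 2 g) powi e2 * chi (conj_dscale 11 g) powi e3 * chi (conj_dscale 22 g) powi e4 = 1" .
  have "etaq e (mmul g M) z = (chi (conj_dscale 1 g) powi e1 * chi (conj_dscale 2 g) powi e2 * chi (conj_dscale 11 g) powi e3 * chi (conj_dscale 22 g) powi e4) * etaq e M z"
    using assms(2) dvd by (simp add: e N power_int_mult_distrib mult_ac)
  then show ?thesis unfolding c by simp
qed

text \<open>The two relations modulo 12 are \<open>psi_level_11\<close> for g and for its conjugate
  by diag(2, 1).\<close>

lemma psi_relations: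
  assumes "mdet g = 1" "22 dvd lower_left g"
  obtains k l m where "psi (conj_dscale 1 g) + psi (conj_dscale 11 g) = 12 * k"
    "psi (conj_dscale 2 g) + psi (conj_dscale 22 g) = 12 * l" "psi (conj_dscale 11 g) + psi (conj_dscale 22 g) = 3 * m"
proof -
  obtain a b c d where g: "g = (a, b, 22 * c, d)" using assms(2) by (cases g) (auto elim!: dvdE)
  have 1: "[psi (a, b, 11 * (2 * c), d) + psi (a, 11 * b, 2 * c, d) = 0] (mod 12)"
    by (rule psi_level_11) (use assms(1) in \<open>simp add: g\<close>)
  have 2: "[psi (a, 2 * b, 11 * c, d) + psi (a, 11 * (2 * b), c, d) = 0] (mod 12)"
    by (rule psi_level_11) (use assms(1) in \<open>simp add: g\<close>)
  have 3: "[psi (a, 11 * b, 2 * c, d) + psi (a, 22 * b, c, d) = 0] (mod 3)"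
    by (rule psi_level_22) (use assms(1) in \<open>simp add: g\<close>)
  have c: "(22 * c) div 2 = 11 * c" "(22 * c) div 11 = 2 * c" by simp_all
  show ?thesis using 1 2 3 that unfolding g conj_dscale.simps cong_0_iff dvd_def c
    by (auto simp del: psi.simps)
qed

text \<open>Ligozat's criterion: the expression is 22 times the sum of e_t gcd(t, c)^2 / t,
  proportional to the order at a cusp with denominator c. The four choices of the gcds of c with 2
  and 11 are the four cusps of level 22.\<close>

fun cusp_ok :: "int \<times> int \<times> int \<times> int \<Rightarrow> bool" where
  "cusp_ok (e1, e2, e3, e4) \<longleftrightarrow> (\<forall>g2\<in>{1, 2}. \<forall>g11\<in>{1, 11}.
     22 * e1 + 11 * g2\<^sup>2 * e2 + 2 * g11\<^sup>2 * e3 + (g2 * g11)\<^sup>2 * e4 \<ge> 0)"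

text \<open>As a and c are coprime, the first column of \<open>dscale t M\<close> has gcd gcd(t, c),
  and the decay exponents of the four factors add up to the quantity in
  \<open>cusp_ok\<close>.\<close>

lemma bdd_inf_etaq:
  assumes "mdet M = 1" "cusp_ok e"
  shows "bdd_inf (etaq e M)"
proof -
  obtain e1 e2 e3 e4 where e: "e = (e1, e2, e3, e4)" by (cases e)
  obtain a b c d where M: "M = (a, b, c, d)" by (cases M)
  have cop: "coprime a c"
  proof (rule coprimeI)
    fix x assume "x dvd a" "x dvd c"
    then have "x dvd mdet M" by (simp add: M)
    then show "is_unit x" using assms(1) by simp
  qed
  have gcd: "gcd (t * a) c = gcd t c" for t
    using cop by (metis coprime_commute gcd.commute gcd_mult_right_right_cancel mult.commute)
  define g2 g11 where "g2 = gcd 2 c" and "g11 = gcd 11 c"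
  have g2: "g2 \<in> {1, 2}"
  proof -
    have "g2 dvd 2" by (simp add: g2_def)
    then have "g2 \<le> 2" "g2 \<ge> 0" by (auto intro: zdvd_imp_le simp: g2_def)
    moreover have "g2 \<noteq> 0" by (simp add: g2_def)
    ultimately show ?thesis by auto
  qed
  have p11: "prime (11::int)" by simp
  have g11: "g11 \<in> {1, 11}"
  proof (cases "11 dvd c")
    case True
    then show ?thesis by (simp add: g11_def gcd_proj1_if_dvd)
  next
    case False
    then have "coprime 11 c" using p11 by (rule prime_imp_coprime[rotated])
    then show ?thesis by (simp add: g11_def)
  qed
  have g22: "gcd 22 c = g2 * g11"
  proof -
    have c: "coprime 2 (11::int)" by simp
    show ?thesis
    proof (cases "11 dvd c")
      case True
      then obtain k where k: "c = 11 * k" by blast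
      have "gcd (11 * 2) (11 * k) = 11 * gcd 2 k" using gcd_mult_distrib_int[of 11 2 k] by simp
      moreover have "gcd 2 (11 * k) = gcd 2 k" using c by (rule gcd_mult_right_left_cancel)
      ultimately show ?thesis by (simp add: g2_def g11_def k)
    next
      case False
      then have "coprime c 11" using p11 by (metis coprime_commute prime_imp_coprime)
      then have "gcd (2 * 11) c = gcd 2 c" by (rule gcd_mult_left_right_cancel)
      then show ?thesis using \<open>coprime c 11\<close> by (simp add: g2_def g11_def gcd.commute)
    qed
  qed
  define r where "r = (\<lambda>t. (real_of_int (gcd t c))\<^sup>2 / real_of_int t)"
  have "\<exists>K>0. \<forall>z. Im z \<ge> 1 \<longrightarrow> norm (slashEta (dscale t M) z powi x) \<le> K * exp (- pi * Im z / 6 * (of_int x * r t))"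
    if "t > 0" for t x
    using slashEta_powi_bound[of "t * a" "t * b" c d x] that mdet_dscale[of t M] assms(1)
    by (simp add: M r_def gcd del: mdet.simps mdet_dscale)
  note this[of 1 e1] this[of 2 e2] this[of 11 e3] this[of 22 e4]
  then obtain K1 K2 K3 K4 where K: "K1 > 0" "K2 > 0" "K3 > 0" "K4 > 0"
    "\<And>z. Im z \<ge> 1 \<Longrightarrow> norm (slashEta (dscale 1 M) z powi e1) \<le> K1 * exp (- pi * Im z / 6 * (of_int e1 * r 1))"
    "\<And>z. Im z \<ge> 1 \<Longrightarrow> norm (slashEta (dscale 2 M) z powi e2) \<le> K2 * exp (- pi * Im z / 6 * (of_int e2 * r 2))"
    "\<And>z. Im z \<ge> 1 \<Longrightarrow> norm (slashEta (dscale 11 M) z powi e3) \<le> K3 * exp (- pi * Im z / 6 * (of_int e3 * r 11))"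
    "\<And>z. Im z \<ge> 1 \<Longrightarrow> norm (slashEta (dscale 22 M) z powi e4) \<le> K4 * exp (- pi * Im z / 6 * (of_int e4 * r 22))"
    by auto
  define s where "s = of_int e1 * r 1 + of_int e2 * r 2 + of_int e3 * r 11 + of_int e4 * r 22"
  have "22 * s = of_int (22 * e1 + 11 * g2\<^sup>2 * e2 + 2 * g11\<^sup>2 * e3 + (g2 * g11)\<^sup>2 * e4)"
    by (simp add: s_def r_def g22 flip: g2_def g11_def)
  also have "\<dots> \<ge> 0" using assms(2) g2 g11 unfolding e cusp_ok.simps of_int_0_le_iff by blast
  finally have s: "s \<ge> 0" by simp
  show ?thesis unfolding bdd_inf_def
  proof (intro exI conjI allI impI)
    show "K1 * K2 * K3 * K4 > 0" using K by simp
    fix z assume z: "Im z \<ge> 1"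
    have "norm (etaq e M z) \<le> (K1 * exp (- pi * Im z / 6 * (of_int e1 * r 1))) * (K2 * exp (- pi * Im z / 6 * (of_int e2 * r 2)))
       * (K3 * exp (- pi * Im z / 6 * (of_int e3 * r 11))) * (K4 * exp (- pi * Im z / 6 * (of_int e4 * r 22)))"
      unfolding e etaq.simps norm_mult using K z by (intro mult_mono) auto
    also have "\<dots> = K1 * K2 * K3 * K4 * exp (- pi * Im z / 6 * s)"
    proof -
      have "exp (t * s) = exp (t * (of_int e1 * r 1)) * exp (t * (of_int e2 * r 2)) * exp (t * (of_int e3 * r 11))
        * exp (t * (of_int e4 * r 22))" for t
        unfolding s_def distrib_left exp_add ..
      note this[of "- pi * Im z / 6"]
      then show ?thesis by (simp only: mult_ac)
    qed
    also have "\<dots> \<le> K1 * K2 * K3 * K4 * 1"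
      using K s z by (intro mult_left_mono) auto
    finally show "norm (etaq e M z) \<le> K1 * K2 * K3 * K4" by simp
  qed
qed

lemma holomorphic_slashEta:
  assumes "mdet M > 0"
  shows "slashEta M holomorphic_on uhp"
proof -
  have "(\<lambda>z. eta2 (mob M z)) holomorphic_on uhp"
    using holomorphic_on_compose_gen[OF holomorphic_mob[OF assms] holomorphic_eta2] Im_mob_pos[OF assms]
    by (auto simp: o_def)
  then show ?thesis unfolding slashEta_def[abs_def]
    using autf_nonzero[OF assms] by (intro holomorphic_intros holomorphic_autf) auto
qed

lemma holomorphic_slashE4:
  assumes "mdet M > 0"
  shows "slashE4 M holomorphic_on uhp"
proof -
  have "(\<lambda>z. E4 (mob M z)) holomorphic_on uhp"
    using holomorphic_on_compose_gen[OF holomorphic_mob[OF assms] holomorphic_E4] Im_mob_pos[OF assms]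
    by (auto simp: o_def)
  then show ?thesis unfolding slashE4_def[abs_def]
    using autf_nonzero[OF assms] by (intro holomorphic_intros holomorphic_autf) auto
qed

lemma holomorphic_slashE2:
  assumes "mdet M > 0"
  shows "slashE2 M holomorphic_on uhp"
proof -
  have "(\<lambda>z. E2 (mob M z)) holomorphic_on uhp"
    using holomorphic_on_compose_gen[OF holomorphic_mob[OF assms] holomorphic_E2] Im_mob_pos[OF assms]
    by (auto simp: o_def)
  then show ?thesis unfolding slashE2_def[abs_def]
    using autf_nonzero[OF assms] by (intro holomorphic_intros holomorphic_autf) auto
qed

lemma holomorphic_etaq:
  assumes "mdet M = 1"
  shows "etaq e M holomorphic_on uhp"
proof -
  obtain e1 e2 e3 e4 where e: "e = (e1, e2, e3, e4)" by (cases e)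
  have "(\<lambda>z. slashEta (dscale 1 M) z powi e1 * slashEta (dscale 2 M) z powi e2 *
     slashEta (dscale 11 M) z powi e3 * slashEta (dscale 22 M) z powi e4) holomorphic_on uhp"
    using slashEta_nonzero assms by (intro holomorphic_intros holomorphic_slashEta) auto
  then show ?thesis by (simp add: e cong: holomorphic_cong)
qed

section \<open>Vanishing in level 22\<close>

text \<open>The point (c : d) of P^1(Z/22) = P^1(F2) x P^1(F11), which determines the coset
  Gamma_0(22) M. In each field it is recorded as d / c, where c^9 = 1/c modulo 11, and the values 2
  and 11 stand for the point at infinity. This bounds the number of cosets by 3 * 12 = 36.\<close>

definition cusp_class :: "mat2 \<Rightarrow> int \<times> int" where
  "cusp_class M = (case M of (a, b, c, d) \<Rightarrow>
     (if even c then 2 else d mod 2, if 11 dvd c then 11 else (d * c ^ 9) mod 11))"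

lemma cusp_class_range: "cusp_class M \<in> {0..2} \<times> {0..11}"
proof -
  have "x mod 2 \<in> {0..2}" "x mod 11 \<in> {0..11}" for x :: int
    using pos_mod_bound[of 2 x] pos_mod_sign[of 2 x] pos_mod_bound[of 11 x] pos_mod_sign[of 11 x] by auto
  then show ?thesis by (auto simp: cusp_class_def split: prod.splits)
qed

lemma residues_11: "(x::int) mod 11 \<in> set [0,1,2,3,4,5,6,7,8,9,10]"
proof -
  have "x mod 11 \<in> {0..<11}" by simp
  also have "{0..<11::int} = set [0..10]" by auto
  finally show ?thesis by (simp add: upto_rec1)
qed

lemma fermat_11: "\<not> 11 dvd (c::int) \<Longrightarrow> c ^ 10 mod 11 = 1"
proof -
  assume "\<not> 11 dvd c"
  then have "c mod 11 \<noteq> 0" by auto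
  then have "(c mod 11) ^ 10 mod 11 = 1" using residues_11[of c] by auto
  then show ?thesis by (simp add: power_mod)
qed

text \<open>c d' - d c' is the lower left entry of M times the inverse of M', so equal classes mean
  equal cosets of Gamma_0(22).\<close>

lemma cusp_class_eq:
  assumes "cusp_class (a, b, c, d) = cusp_class (a', b', c', d')"
  shows "22 dvd c * d' - d * c'"
proof -
  have 2: "2 dvd c * d' - d * c'"
  proof -
    have "(even c \<and> even c') \<or> (odd c \<and> odd c' \<and> (even d \<longleftrightarrow> even d'))"
    proof (cases "even c"; cases "even c'")
      assume "odd c" "odd c'"
      then show ?thesis using assms by (auto simp: cusp_class_def mod2_eq_if split: if_splits)
    qed (use assms in \<open>auto simp: cusp_class_def mod2_eq_if split: if_splits\<close>)
    then show ?thesis by auto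
  qed
  have m: "x mod 11 \<noteq> 11" for x :: int using pos_mod_bound[of 11 x] by auto
  have 11: "11 dvd c * d' - d * c'"
  proof (cases "11 dvd c")
    case True
    then have "11 dvd c'" using assms m m[THEN not_sym] by (auto simp: cusp_class_def split: if_splits)
    then show ?thesis using True by simp
  next
    case False
    then have c': "\<not> 11 dvd c'" using assms m m[THEN not_sym] by (auto simp: cusp_class_def split: if_splits)
    then have e: "(d * c ^ 9) mod 11 = (d' * c' ^ 9) mod 11" using assms False by (auto simp: cusp_class_def split: if_splits)
    \<comment> \<open>c^10 = 1 allows d / c = d' / c' to be multiplied out.\<close>
    have "d * c' mod 11 = (d * c') * (c ^ 10 mod 11) mod 11" using fermat_11[OF False] by simp
    also have "\<dots> = (d * c') * c ^ 10 mod 11" by (rule mod_mult_right_eq)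
    also have "(d * c') * c ^ 10 = (d * c ^ 9) * (c * c')" by (simp add: power_numeral_reduce)
    also have "\<dots> mod 11 = (d' * c' ^ 9) * (c * c') mod 11" by (metis e mod_mult_left_eq)
    also have "(d' * c' ^ 9) * (c * c') = (c * d') * c' ^ 10" by (simp add: power_numeral_reduce)
    also have "\<dots> mod 11 = (c * d') * (c' ^ 10 mod 11) mod 11" by (rule mod_mult_right_eq[symmetric])
    also have "\<dots> = c * d' mod 11" using fermat_11[OF c'] by simp
    finally show ?thesis by (metis mod_eq_dvd_iff)
  qed
  have "coprime 2 (11::int)" by simp
  from divides_mult[OF 2 11 this] show ?thesis by simp
qed

lemma holomorphic_mult_eq_0:
  assumes "f holomorphic_on uhp" "g holomorphic_on uhp" "\<And>z. z \<in> uhp \<Longrightarrow> f z * g z = 0"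
  shows "(\<forall>z\<in>uhp. f z = 0) \<or> (\<forall>z\<in>uhp. g z = 0)"
proof (rule disjCI, rule ballI)
  fix z assume z: "z \<in> uhp"
  assume "\<not> (\<forall>z\<in>uhp. g z = 0)"
  then obtain w where w: "w \<in> uhp" "g w \<noteq> 0" by blast
  have op: "open uhp" by (rule open_halfspace_Im_gt)
  define S where "S = uhp \<inter> g -` (- {0})"
  have "open S" unfolding S_def
    by (rule continuous_open_preimage[OF holomorphic_on_imp_continuous_on[OF assms(2)] op]) auto
  moreover have "w \<in> S" using w by (simp add: S_def)
  ultimately show "f z = 0"
    using analytic_continuation_open[of S uhp f "\<lambda>_. 0"] assms z op
    by (auto simp: S_def intro!: convex_connected convex_halfspace_Im_gt)
qed

lemma holomorphic_prod_eq_0: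
  assumes "finite A" "\<And>f. f \<in> A \<Longrightarrow> f holomorphic_on uhp" "\<And>z. z \<in> uhp \<Longrightarrow> (\<Prod>f\<in>A. f z) = 0"
  shows "\<exists>f\<in>A. \<forall>z\<in>uhp. f z = 0"
  using assms
proof (induction A rule: finite_induct)
  case empty
  from empty(2)[of \<i>] show ?case by simp
next
  case (insert f A)
  have "(\<forall>z\<in>uhp. f z = 0) \<or> (\<forall>z\<in>uhp. (\<Prod>g\<in>A. g z) = 0)"
    using insert by (intro holomorphic_mult_eq_0) (auto intro!: holomorphic_intros)
  then show ?case using insert.IH insert.prems by auto
qed

text \<open>A form of weight 8 for Gamma_0(22) given together with its translates:
  \<open>F M\<close> is the form slashed with M, and boundedness of every \<open>F M\<close> is
  holomorphy at every cusp.\<close>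

locale level22 =
  fixes F :: "mat2 \<Rightarrow> complex \<Rightarrow> complex"
  assumes right: "\<And>M g z. mdet M = 1 \<Longrightarrow> mdet g = 1 \<Longrightarrow> Im z > 0 \<Longrightarrow> F (mmul M g) z = F M (mob g z) / autf g z ^ 8"
    and left: "\<And>M g z. mdet M = 1 \<Longrightarrow> mdet g = 1 \<Longrightarrow> 22 dvd lower_left g \<Longrightarrow> Im z > 0 \<Longrightarrow> F (mmul g M) z = F M z"
    and hol: "\<And>M. mdet M = 1 \<Longrightarrow> F M holomorphic_on uhp"
    and bdd: "\<And>M. mdet M = 1 \<Longrightarrow> bdd_inf (F M)"
begin

text \<open>Cutting off outside the half-plane makes translates that agree on it equal as
  functions.\<close>

definition G :: "mat2 \<Rightarrow> complex \<Rightarrow> complex" where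
  "G M = (\<lambda>z. if Im z > 0 then F M z else 0)"

text \<open>A set of functions rather than a family over cosets: no representatives have to be
  chosen, and T and S permute it even when translates coincide.\<close>

definition \<F> :: "(complex \<Rightarrow> complex) set" where
  "\<F> = G ` {M. mdet M = 1}"

lemma G_eq:
  assumes "mdet M = 1" "mdet M' = 1" "cusp_class M = cusp_class M'"
  shows "G M = G M'"
proof
  fix z
  obtain a b c d a' b' c' d' where M: "M = (a, b, c, d)" and M': "M' = (a', b', c', d')" by (cases M; cases M')
  define g where "g = mmul M (minv M')"
  have "lower_left g = c * d' - d * c'" by (simp add: g_def M M')
  then have 1: "22 dvd lower_left g" using cusp_class_eq[of a b c d a' b' c' d'] assms by (simp add: M M')
  have 2: "mdet g = 1" using assms by (simp add: g_def mdet_mmul)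
  have "M = mmul g M'" unfolding g_def mmul_assoc using assms by (simp add: mmul_minv)
  then show "G M z = G M' z" using left[OF assms(2) 2 1, of z] by (simp add: G_def)
qed

lemma finite_\<F>: "finite \<F>" and card_\<F>: "card \<F> \<le> 36"
proof -
  define C where "C = cusp_class ` {M. mdet M = 1}"
  have sub: "C \<subseteq> {0..2} \<times> {0..11}" using cusp_class_range unfolding C_def by blast
  have fin: "finite C" using sub by (rule finite_subset) auto
  have "card C \<le> card ({0..2::int} \<times> {0..11::int})" by (rule card_mono) (use sub in auto)
  then have c: "card C \<le> 36" by (simp add: card_cartesian_product)
  have "\<F> \<subseteq> (\<lambda>x. G (SOME M. mdet M = 1 \<and> cusp_class M = x)) ` C"
  proof
    fix f assume "f \<in> \<F>"
    then obtain M where M: "mdet M = 1" "f = G M" by (auto simp: \<F>_def)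
    let ?M = "SOME M'. mdet M' = 1 \<and> cusp_class M' = cusp_class M"
    have "mdet ?M = 1 \<and> cusp_class ?M = cusp_class M" by (rule someI[of _ M]) (use M in auto)
    then have "f = G ?M" using M by (metis G_eq)
    then show "f \<in> (\<lambda>x. G (SOME M. mdet M = 1 \<and> cusp_class M = x)) ` C" using M by (auto simp: C_def)
  qed
  then show "finite \<F>" "card \<F> \<le> 36"
    using fin c by (auto intro: finite_subset dest: surj_card_le[OF fin])
qed

lemma hol_\<F>: "f \<in> \<F> \<Longrightarrow> f holomorphic_on uhp"
  unfolding \<F>_def by (auto simp del: mdet.simps simp: G_def intro: holomorphic_transform[OF hol])

definition P :: "complex \<Rightarrow> complex" where
  "P z = (\<Prod>f\<in>\<F>. f z)"

text \<open>Right multiplication by T maps the finite set of translates injectively into itself,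
  hence permutes the factors. In \<open>P_S\<close> the same argument collects the weight 8 from
  each factor.\<close>

lemma P_T:
  assumes "Im z > 0"
  shows "P (z + 1) = P z"
proof -
  define \<tau> :: "(complex \<Rightarrow> complex) \<Rightarrow> complex \<Rightarrow> complex" where "\<tau> = (\<lambda>f z. f (z + 1))"
  have "\<tau> f \<in> \<F>" if f: "f \<in> \<F>" for f
  proof -
    obtain M where M: "mdet M = 1" "f = G M" using f unfolding \<F>_def by blast
    have "\<tau> f = G (mmul M mT)"
      using M right[of M mT] by (auto simp: fun_eq_iff \<tau>_def G_def)
    then show ?thesis using M by (auto simp: \<F>_def mdet_mmul)
  qed
  then have sub: "\<tau> ` \<F> \<subseteq> \<F>" by blast
  have inj: "inj_on \<tau> \<F>"
  proof (rule inj_onI)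
    fix f g assume "\<tau> f = \<tau> g"
    then have "f ((z - 1) + 1) = g ((z - 1) + 1)" for z unfolding \<tau>_def by metis
    then show "f = g" by (simp add: fun_eq_iff)
  qed
  have im: "\<tau> ` \<F> = \<F>" using endo_inj_surj[OF finite_\<F> sub inj] .
  have "P z = (\<Prod>f\<in>\<tau> ` \<F>. f z)" by (simp add: im P_def)
  also have "\<dots> = (\<Prod>f\<in>\<F>. \<tau> f z)" by (rule prod.reindex_cong[OF inj]) auto
  finally show ?thesis by (simp add: P_def \<tau>_def)
qed

lemma P_S:
  assumes "Im z > 0"
  shows "P (- 1 / z) = z ^ (8 * card \<F>) * P z"
proof -
  define \<tau> :: "(complex \<Rightarrow> complex) \<Rightarrow> complex \<Rightarrow> complex" where
    "\<tau> = (\<lambda>f z. if Im z > 0 then f (- 1 / z) / z ^ 8 else 0)"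
  have "\<tau> f \<in> \<F>" if f: "f \<in> \<F>" for f
  proof -
    obtain M where M: "mdet M = 1" "f = G M" using f unfolding \<F>_def by blast
    have "\<tau> f z = G (mmul M mS) z" for z
      using M right[of M mS z] Im_minus_inverse_pos[of z] by (auto simp: \<tau>_def G_def)
    then have "\<tau> f = G (mmul M mS)" by blast
    then show ?thesis using M by (auto simp: \<F>_def mdet_mmul)
  qed
  then have sub: "\<tau> ` \<F> \<subseteq> \<F>" by blast
  have inj: "inj_on \<tau> \<F>"
  proof (rule inj_onI)
    fix f g assume fg: "\<tau> f = \<tau> g" "f \<in> \<F>" "g \<in> \<F>"
    show "f = g"
    proof
      fix z
      show "f z = g z"
      proof (cases "Im z > 0")
        case True
        have nz: "z \<noteq> 0" using True by auto
        have "\<tau> f (- 1 / z) = \<tau> g (- 1 / z)" using fg by simp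
        then show ?thesis using Im_minus_inverse_pos[OF True] nz by (simp add: \<tau>_def)
      next
        case False
        then show ?thesis using fg(2,3) by (auto simp: \<F>_def G_def)
      qed
    qed
  qed
  have im: "\<tau> ` \<F> = \<F>" using endo_inj_surj[OF finite_\<F> sub inj] .
  have nz: "z \<noteq> 0" using assms by auto
  have "P z = (\<Prod>f\<in>\<tau> ` \<F>. f z)" by (simp add: im P_def)
  also have "\<dots> = (\<Prod>f\<in>\<F>. \<tau> f z)" by (rule prod.reindex_cong[OF inj]) auto
  also have "\<dots> = P (- 1 / z) / z ^ (8 * card \<F>)"
    using assms by (simp add: \<tau>_def P_def prod_dividef power_mult)
  finally show ?thesis using nz by simp
qed

theorem vanish:
  assumes ord: "C > 0" "\<And>z. Im z \<ge> 1 \<Longrightarrow> norm (F mI z) \<le> C * norm (qexp z) ^ 25"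
    and z: "Im z > 0"
  shows "F mI z = 0"
proof -
  define m where "m = card \<F>"
  \<comment> \<open>\<open>P\<close> ^ 3 and \<open>eta2\<close> ^ (24 m) = Delta^(2m) both have
    weight 24 m.\<close>
  define h where "h = (\<lambda>z. P z ^ 3 / eta2 z ^ (24 * m))"
  have midF: "G mI \<in> \<F>" by (auto simp: \<F>_def)
  have h0: "h z = 0" if z: "Im z > 0" for z
  proof (rule level_one_vanish[OF _ _ _ _ z])
    show "h holomorphic_on uhp"
      unfolding h_def P_def by (intro holomorphic_intros holomorphic_eta2 hol_\<F>) auto
    show "norm (h (z + 1)) = norm (h z)" if "Im z > 0" for z
      using that by (simp add: h_def P_T eta2_T norm_divide norm_mult norm_power power_mult_distrib norm_exp_eq_Re)
    show "norm (h (- 1 / z)) = norm (h z)" if "Im z > 0" for z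
    proof -
      have "z \<noteq> 0" using that by auto
      moreover have "8 * m * 3 = 24 * m" by simp
      ultimately show ?thesis unfolding h_def P_S[OF that] eta2_S[OF that] m_def[symmetric]
        by (simp add: norm_divide norm_mult norm_power power_mult_distrib flip: power_mult)
    qed
    fix e :: real assume e: "e > 0"
    define A where "A = \<F> - {G mI}"
    have "\<forall>f\<in>A. \<exists>B>0. \<forall>z. Im z \<ge> 1 \<longrightarrow> norm (f z) \<le> B"
    proof
      fix f assume "f \<in> A"
      then obtain M where "mdet M = 1" "f = G M" by (auto simp: A_def \<F>_def)
      then show "\<exists>B>0. \<forall>z. Im z \<ge> 1 \<longrightarrow> norm (f z) \<le> B" using bdd[of M] by (auto simp: bdd_inf_def G_def)
    qed
    then obtain B where B: "\<And>f. f \<in> A \<Longrightarrow> B f > 0" "\<And>f z. f \<in> A \<Longrightarrow> Im z \<ge> 1 \<Longrightarrow> norm (f z) \<le> B f" by metis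
    define L where "L = C * (\<Prod>f\<in>A. B f)"
    have L: "L > 0" using ord B by (auto simp: L_def intro!: mult_pos_pos prod_pos)
    have Pb: "norm (P z) \<le> L * norm (qexp z) ^ 25" if z: "Im z \<ge> 1" for z
    proof -
      have "P z = G mI z * (\<Prod>f\<in>A. f z)" unfolding P_def A_def by (rule prod.remove[OF finite_\<F> midF])
      then have "norm (P z) = norm (F mI z) * (\<Prod>f\<in>A. norm (f z))" using z by (simp add: norm_mult prod_norm G_def)
      also have "\<dots> \<le> (C * norm (qexp z) ^ 25) * (\<Prod>f\<in>A. B f)"
        using B z ord by (intro mult_mono prod_mono) (auto intro!: prod_nonneg)
      finally show ?thesis by (simp add: L_def mult_ac)
    qed
    obtain c where c: "c > 0" "\<And>z. Im z \<ge> 1 \<Longrightarrow> c * exp (- pi * Im z / 6) \<le> norm (eta2 z)"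
      by (rule eta2_bounds[of 1]) auto
    define K where "K = L ^ 3 / c ^ (24 * m)"
    have K: "K > 0" using L c by (simp add: K_def)
    have bd: "norm (h z) \<le> K * exp (- pi * Im z)" if z: "Im z \<ge> 1" for z
    proof -
      have "norm (h z) = norm (P z) ^ 3 / norm (eta2 z) ^ (24 * m)" by (simp add: h_def norm_divide norm_power)
      also have "\<dots> \<le> (L * norm (qexp z) ^ 25) ^ 3 / (c * exp (- pi * Im z / 6)) ^ (24 * m)"
        using Pb[OF z] c(2)[OF z] c(1) L by (intro frac_le power_mono) auto
      \<comment> \<open>Each of the m factors \<open>eta2\<close> ^ 24 costs exp(4 pi Im z), and the
        order 75 of the numerator gains exp(-150 pi Im z). With m <= 36 the exponent is at most -6
        pi Im z.\<close>
      also have "\<dots> = K * exp (real m * (4 * pi * Im z) - 150 * pi * Im z)"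
        by (simp add: K_def power_mult_distrib norm_qexp exp_diff exp_minus field_simps flip: exp_of_nat_mult exp_add power_mult)
      also have "real m * (4 * pi * Im z) \<le> 36 * (4 * pi * Im z)"
        using card_\<F> z unfolding m_def by (intro mult_right_mono) auto
      also have "K * exp (36 * (4 * pi * Im z) - 150 * pi * Im z) \<le> K * exp (- pi * Im z)"
        using K z by (intro mult_left_mono) auto
      finally show ?thesis using K by (simp add: mult_left_mono)
    qed
    obtain Y where Y: "Y \<ge> 1" "\<And>y. y \<ge> Y \<Longrightarrow> K * exp (- pi * y) < e" using exp_decay[OF K e] by blast
    show "\<exists>Y. \<forall>z. Im z \<ge> Y \<longrightarrow> norm (h z) < e"
      using bd Y by (intro exI[of _ Y]) (meson le_less_trans order_trans)
  qed
  have "P z = 0" if "Im z > 0" for z using h0[OF that] by (simp add: h_def)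
  \<comment> \<open>By the identity theorem one factor vanishes identically. It is a translate of
    the form, and slashing with the inverse matrix leads back to \<open>F mI\<close>.\<close>
  then have "\<exists>f\<in>\<F>. \<forall>z\<in>uhp. f z = 0"
    by (intro holomorphic_prod_eq_0 finite_\<F> hol_\<F>) (auto simp: P_def)
  then obtain M where M: "mdet M = 1" "\<And>z. Im z > 0 \<Longrightarrow> F M z = 0" by (auto simp: \<F>_def G_def)
  have inv: "mdet (minv M) = 1" using M by simp
  have "F mI z = F M (mob (minv M) z) / autf (minv M) z ^ 8"
    using right[OF M(1) inv z] mmul_minv(1)[OF M(1)] by simp
  also have "\<dots> = 0" using M(2) Im_mob_pos[of "minv M" z] inv z by simp
  finally show ?thesis .
qed

end

section \<open>Eta quotients as formal power series\<close>

definition dil :: "nat \<Rightarrow> 'a::comm_ring_1 fps \<Rightarrow> 'a fps" where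
  "dil d F = F oo (fps_X ^ d)"

lemma dil_nth: "fps_nth (dil d F) n = (if d dvd n then fps_nth F (n div d) else 0)"
  for F :: "'a::idom fps"
  by (simp add: dil_def fps_nth_compose_X_power)

lemma sums_dil:
  fixes F :: "complex fps"
  assumes "d > 0" "(\<lambda>n. fps_nth F n * (q ^ d) ^ n) sums s"
  shows "(\<lambda>n. fps_nth (dil d F) n * q ^ n) sums s"
proof -
  have "strict_mono (\<lambda>n. d * n)" using assms(1) by (auto simp: strict_mono_def)
  moreover have "fps_nth (dil d F) n * q ^ n = 0" if "n \<notin> range (\<lambda>n. d * n)" for n
    using that by (auto simp: dil_nth dvd_def)
  ultimately have "(\<lambda>n. fps_nth (dil d F) (d * n) * q ^ (d * n)) sums s \<longleftrightarrow> (\<lambda>n. fps_nth (dil d F) n * q ^ n) sums s"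
    by (rule sums_mono_reindex)
  then show ?thesis using assms by (simp add: dil_nth power_mult)
qed

lemma conv1_dil:
  assumes "conv1 F" "d > 0"
  shows "conv1 (dil d F)"
  unfolding conv1_def fps_conv_radius_def
proof (rule conv_radius_geI_ex')
  fix r :: real assume r: "0 < r" "ereal r < 1"
  have "r ^ d < 1" using r assms(2) by (simp add: power_less_one_iff)
  then have "norm (complex_of_real r ^ d) < 1" using r by (simp add: norm_power)
  then have "ereal (norm (complex_of_real r ^ d)) < fps_conv_radius F"
    using assms(1) unfolding conv1_def by (metis ereal_less(3) less_le_trans)
  from sums_eval_fps[OF this] show "summable (\<lambda>n. fps_nth (dil d F) n * complex_of_real r ^ n)"
    using sums_dil[OF assms(2)] by (auto simp: summable_def)
qed

lemma qeval_dil: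
  assumes "conv1 F" "d > 0" "Im z > 0"
  shows "qeval (dil d F) z = qeval F (of_nat d * z)"
proof -
  have Im: "Im (of_nat d * z) > 0" using assms by simp
  have "(\<lambda>n. fps_nth F n * qexp (of_nat d * z) ^ n) sums qeval F (of_nat d * z)"
    using qeval_has_sum_aux(2)[OF _ Im] assms(1) by (simp add: conv1_def)
  then have "(\<lambda>n. fps_nth (dil d F) n * qexp z ^ n) sums qeval F (of_nat d * z)"
    unfolding qexp_mult_nat by (rule sums_dil[OF assms(2)])
  moreover have "(\<lambda>n. fps_nth (dil d F) n * qexp z ^ n) sums qeval (dil d F) z"
    using qeval_has_sum_aux(2)[OF _ assms(3)] conv1_dil[OF assms(1,2)] by (simp add: conv1_def)
  ultimately show ?thesis by (rule sums_unique2[symmetric])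
qed

lemma qeval_eqI:
  assumes "conv1 F" "conv1 G" "\<And>z. Im z > 0 \<Longrightarrow> qeval F z = qeval G z"
  shows "F = G"
proof -
  have "F - G = 0" by (rule qeval_eq_0_imp) (use assms in \<open>auto intro!: conv1_intros simp: qeval_simps\<close>)
  then show ?thesis by simp
qed

section \<open>Complex powers of the Euler product\<close>

text \<open>The series of \<open>\<Prod>(1 - q\<^sup>n)\<^sup>-\<^sup>c\<close>, which is \<open>exp (c \<Lambda>(q))\<close> for \<open>\<Lambda>(q) = \<Sum>\<sigma>(n) q\<^sup>n / n\<close>.\<close>
definition euler_pow :: "complex \<Rightarrow> complex fps" where
  "euler_pow c = fps_expansion (\<lambda>q. exp (c * eval_fps euler_log q)) 0"

lemma holomorphic_euler_pow: "(\<lambda>q. exp (c * eval_fps euler_log q)) holomorphic_on eball 0 1"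
proof -
  have "eball 0 1 \<subseteq> eball (0 :: complex) (fps_conv_radius euler_log)"
    using conv1_euler_log by (intro eball_mono) (simp add: conv1_def)
  then have "eval_fps euler_log holomorphic_on eball 0 1"
    by (rule holomorphic_on_eval_fps)
  then show ?thesis by (intro holomorphic_on_exp' holomorphic_on_mult holomorphic_on_const)
qed

lemma conv1_euler_pow: "conv1 (euler_pow c)"
  unfolding conv1_def euler_pow_def by (rule conv_radius_fps_expansion[OF holomorphic_euler_pow])

lemma qeval_euler_pow:
  assumes "Im z > 0"
  shows "qeval (euler_pow c) z = exp (c * qeval euler_log z)"
proof -
  have "ereal (norm (qexp z)) < 1" using norm_qexp_less_1[OF assms] by simp
  from eval_fps_expansion'[OF holomorphic_euler_pow this]
  show ?thesis by (simp add: qeval_def euler_pow_def)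
qed

lemma euler_pow_add: "euler_pow (a + b) = euler_pow a * euler_pow b"
  by (rule qeval_eqI) (auto intro!: conv1_intros conv1_euler_pow simp: qeval_mult conv1_euler_pow qeval_euler_pow distrib_right exp_add)

lemma euler_pow_0: "euler_pow 0 = 1"
  by (rule qeval_eqI) (auto intro!: conv1_intros conv1_euler_pow simp: qeval_1 qeval_euler_pow)

lemma euler_pow_of_nat: "euler_pow (of_nat n * c) = euler_pow c ^ n"
  by (induction n) (simp_all add: euler_pow_0 distrib_right euler_pow_add)

lemma euler_pow_inverse: "euler_pow (- c) = inverse (euler_pow c)"
proof -
  have "euler_pow c * euler_pow (- c) = 1" by (simp add: euler_pow_add[symmetric] euler_pow_0)
  then show ?thesis by (simp add: fps_inverse_unique)
qed

lemma euler_pow_nth_0: "fps_nth (euler_pow c) 0 = 1"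
  by (simp add: euler_pow_def fps_expansion_def eval_fps_at_0 euler_log_def)

lemma conv1_uminus: "conv1 F \<Longrightarrow> conv1 (- F)"
  by (simp add: conv1_def)

lemma qeval_uminus: "conv1 F \<Longrightarrow> Im z > 0 \<Longrightarrow> qeval (- F) z = - qeval F z"
  by (simp add: qeval_def eval_fps_minus conv1_eball)

text \<open>The logarithmic derivative of prod (1 - q^n). Read as a recursion it determines all
  coefficients from the constant term.\<close>

lemma qdiff_euler_pow: "qdiff (euler_pow (- 1)) = - (sigma_fps 1 * euler_pow (- 1))"
proof (rule qeval_eqI)
  show "conv1 (qdiff (euler_pow (- 1)))" by (intro conv1_qdiff conv1_euler_pow)
  have cr: "conv1 (sigma_fps 1 * euler_pow (- 1))" by (intro conv1_mult conv1_sigma_fps conv1_euler_pow)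
  then show "conv1 (- (sigma_fps 1 * euler_pow (- 1)))" by (rule conv1_uminus)
  fix z assume z: "Im z > 0"
  define c where "c = 2 * of_real pi * \<i>"
  have c: "c \<noteq> 0" by (simp add: c_def)
  have 1: "((\<lambda>z. exp (- 1 * qeval euler_log z)) has_field_derivative
     (exp (- 1 * qeval euler_log z) * (- 1 * (c * qeval (qdiff euler_log) z)))) (at z)"
    unfolding c_def by (intro DERIV_fun_exp DERIV_cmult has_field_derivative_ups' conv1_euler_log z)
  have "(qeval (euler_pow (- 1)) has_field_derivative
     (exp (- 1 * qeval euler_log z) * (- 1 * (c * qeval (qdiff euler_log) z)))) (at z)"
    by (rule has_field_derivative_transform_within_open[OF 1 open_halfspace_Im_gt[of 0]])
       (use z qeval_euler_pow in auto)
  from DERIV_unique[OF has_field_derivative_ups'[OF conv1_euler_pow z] this]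
  have "c * qeval (qdiff (euler_pow (- 1))) z = c * (- (qeval (qdiff euler_log) z * exp (- 1 * qeval euler_log z)))"
    unfolding c_def[symmetric] by (simp only: mult_minus1 mult_minus_right mult_ac)
  with c have "qeval (qdiff (euler_pow (- 1))) z = - (qeval (sigma_fps 1) z * exp (- 1 * qeval euler_log z))"
    unfolding qdiff_euler_log using mult_left_cancel by blast
  then show "qeval (qdiff (euler_pow (- 1))) z = qeval (- (sigma_fps 1 * euler_pow (- 1))) z"
    unfolding qeval_uminus[OF cr z] qeval_mult[OF conv1_sigma_fps conv1_euler_pow z] qeval_euler_pow[OF z] .
qed

section \<open>Comparison with truncated Euler products\<close>

definition eq_upto :: "nat \<Rightarrow> 'a::zero fps \<Rightarrow> 'a fps \<Rightarrow> bool" where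
  "eq_upto N F G \<longleftrightarrow> (\<forall>i\<le>N. fps_nth F i = fps_nth G i)"

lemma eq_upto_refl: "eq_upto N F F"
  by (simp add: eq_upto_def)

lemma eq_upto_mult: "eq_upto N F F' \<Longrightarrow> eq_upto N G G' \<Longrightarrow> eq_upto N (F * G) (F' * G')"
  for F :: "'a::comm_ring_1 fps"
  unfolding eq_upto_def by (auto simp: fps_mult_nth intro!: sum.cong)

lemma eq_upto_power: "eq_upto N F F' \<Longrightarrow> eq_upto N (F ^ k) (F' ^ k)"
  for F :: "'a::comm_ring_1 fps"
  by (induction k) (auto intro: eq_upto_mult eq_upto_refl)

lemma eq_upto_inverse:
  fixes F :: "'a::field fps"
  assumes "eq_upto N F G" "fps_nth F 0 \<noteq> 0"
  shows "eq_upto N (inverse F) (inverse G)"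
proof -
  have G0: "fps_nth G 0 \<noteq> 0" using assms by (simp add: eq_upto_def)
  have "eq_upto N (inverse F * G * inverse G) (inverse F * F * inverse G)"
    using assms(1) by (intro eq_upto_mult eq_upto_refl) (auto simp: eq_upto_def)
  then show ?thesis using inverse_mult_eq_1[OF assms(2)] inverse_mult_eq_1'[OF G0]
    by (simp add: mult.assoc)
qed

lemma eq_upto_dil: "eq_upto N F G \<Longrightarrow> eq_upto N (dil d F) (dil d G)"
  for F :: "'a::idom fps"
  unfolding eq_upto_def dil_nth by (meson div_le_dividend order_trans)

definition cfps :: "rat fps \<Rightarrow> complex fps" where
  "cfps F = Abs_fps (\<lambda>n. of_rat (fps_nth F n))"

lemma cfps_nth: "fps_nth (cfps F) n = of_rat (fps_nth F n)"
  by (simp add: cfps_def)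

lemma cfps_mult: "cfps (F * G) = cfps F * cfps G"
  by (rule fps_ext) (simp add: cfps_nth fps_mult_nth of_rat_sum of_rat_mult)

lemma cfps_1: "cfps 1 = 1"
  by (rule fps_ext) (simp add: cfps_nth)

lemma cfps_diff: "cfps (F - G) = cfps F - cfps G"
  by (rule fps_ext) (simp add: cfps_nth of_rat_diff)

lemma cfps_X_power: "cfps (fps_X ^ k) = fps_X ^ k"
  by (rule fps_ext) (simp add: cfps_nth fps_X_power_nth)

lemma cfps_power: "cfps (F ^ k) = cfps F ^ k"
  by (induction k) (simp_all add: cfps_1 cfps_mult)

lemma cfps_prod: "cfps (prod f A) = (\<Prod>x\<in>A. cfps (f x))"
  by (induction A rule: infinite_finite_induct) (simp_all add: cfps_1 cfps_mult)

lemma cfps_inverse: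
  assumes "fps_nth F 0 \<noteq> 0"
  shows "cfps (inverse F) = inverse (cfps F)"
proof -
  have "cfps F * cfps (inverse F) = 1"
    using inverse_mult_eq_1'[OF assms] by (simp add: cfps_mult[symmetric] cfps_1)
  then show ?thesis by (simp add: fps_inverse_unique)
qed

definition etr :: "nat \<Rightarrow> complex fps" where
  "etr N = (\<Prod>k\<in>{1..N}. 1 - fps_X ^ k)"

lemma cfps_euler_trunc:
  assumes "d > 0"
  shows "cfps (euler_trunc N d) = dil d (etr N)"
proof -
  have X0: "fps_nth (fps_X ^ d :: complex fps) 0 = 0" using assms by simp
  have "dil d (etr N) = (\<Prod>k\<in>{1..N}. (1 - fps_X ^ k) oo (fps_X ^ d))"
    unfolding dil_def etr_def by (rule fps_compose_prod_distrib[OF X0])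
  also have "\<dots> = (\<Prod>k\<in>{1..N}. 1 - fps_X ^ (d * k))"
    using X0 by (simp add: fps_compose_sub_distrib fps_X_power_compose power_mult)
  finally show ?thesis by (simp add: euler_trunc_def cfps_prod cfps_diff cfps_1 cfps_X_power)
qed

text \<open>Minus the logarithmic derivative of the finite product \<open>etr N\<close>.\<close>

definition sigma_fps_part :: "nat \<Rightarrow> complex fps" where
  "sigma_fps_part N = Abs_fps (\<lambda>n. if n = 0 then 0 else (\<Sum>k\<in>{1..N}. if k dvd n then of_nat k else 0))"

lemma qdiff_mult: "qdiff (F * G) = qdiff F * G + F * qdiff G"
  by (simp add: qdiff_def algebra_simps)

lemma qdiff_etr: "qdiff (etr N) = - sigma_fps_part N * etr N"
proof (induction N)
  case 0
  have "sigma_fps_part 0 = 0" by (rule fps_ext) (simp add: sigma_fps_part_def)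
  then show ?case by (simp add: etr_def qdiff_def)
next
  case (Suc N)
  \<comment> \<open>(N+1) q^(N+1) / (1 - q^(N+1)), minus the logarithmic derivative of the new
    factor.\<close>
  define K :: "complex fps" where "K = Abs_fps (\<lambda>n. if n \<noteq> 0 \<and> Suc N dvd n then of_nat (Suc N) else 0)"
  have S: "sigma_fps_part (Suc N) = sigma_fps_part N + K"
    by (rule fps_ext) (simp add: sigma_fps_part_def K_def)
  have E: "etr (Suc N) = etr N * (1 - fps_X ^ Suc N)"
    by (simp add: etr_def prod.nat_ivl_Suc')
  have "qdiff (1 - fps_X ^ Suc N) = - K * (1 - fps_X ^ Suc N)"
  proof (rule fps_ext)
    fix n
    have "fps_nth (- K * (1 - fps_X ^ Suc N)) n = - (fps_nth K n - fps_nth (K * fps_X ^ Suc N) n)"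
      by (simp add: algebra_simps del: power_Suc)
    also have "fps_nth (K * fps_X ^ Suc N) n = (if n < Suc N then 0 else fps_nth K (n - Suc N))"
      by (rule fps_X_power_mult_right_nth)
    also have "- (fps_nth K n - \<dots>) = (if n = Suc N then - of_nat (Suc N) else 0)"
    proof -
      consider "n < Suc N" | "n = Suc N" | "n > Suc N" by linarith
      then show ?thesis
      proof cases
        case 1
        then show ?thesis using nat_dvd_not_less[of n "Suc N"] by (auto simp: K_def)
      next
        case 3
        then have "Suc N dvd n - Suc N \<longleftrightarrow> Suc N dvd n" by (intro dvd_minus_self[THEN trans]) auto
        then show ?thesis using 3 by (simp add: K_def)
      qed (simp add: K_def)
    qed
    also have "\<dots> = fps_nth (qdiff (1 - fps_X ^ Suc N)) n"
      by (auto simp: fps_nth_qdiff fps_X_power_nth simp del: power_Suc)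
    finally show "fps_nth (qdiff (1 - fps_X ^ Suc N)) n = fps_nth (- K * (1 - fps_X ^ Suc N)) n" ..
  qed
  then show ?case unfolding E S qdiff_mult Suc.IH by (simp only:) (simp add: algebra_simps del: power_Suc)
qed

lemma sigma_fps_part_nth: "n \<le> N \<Longrightarrow> fps_nth (sigma_fps_part N) n = fps_nth (sigma_fps 1) n"
proof (cases "n = 0")
  case False
  assume n: "n \<le> N"
  have "{k \<in> {1..N}. k dvd n} = {k. k dvd n}"
    using False n by (auto dest: dvd_imp_le intro: Nat.gr0I)
  then have "(\<Sum>k\<in>{1..N}. if k dvd n then of_nat k else 0) = (\<Sum>k | k dvd n. of_nat k :: complex)"
    by (simp add: sum.inter_filter[symmetric])
  then show ?thesis using False by (simp add: sigma_fps_part_def sigma_fps_def sigma_k_def)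
qed (simp add: sigma_fps_part_def sigma_fps_def sigma_k_def)

text \<open>Both series satisfy n a(n) = - sum of s(i) a(n - i) over i <= n, where s is sigma in the
  range up to N. As s(0) = 0, only earlier coefficients enter, and induction applies.\<close>

lemma eq_upto_etr: "eq_upto N (etr N) (euler_pow (- 1))"
  unfolding eq_upto_def
proof (intro allI impI)
  fix i assume "i \<le> N"
  then show "fps_nth (etr N) i = fps_nth (euler_pow (- 1)) i"
  proof (induction i rule: less_induct)
    case (less n)
    show ?case
    proof (cases "n = 0")
      case True
      have "fps_nth (etr N) 0 = 1"
        unfolding etr_def by (induction N) (simp_all add: prod.nat_ivl_Suc')
      then show ?thesis using True by (simp add: euler_pow_nth_0)
    next
      case False
      have "of_nat n * fps_nth (etr N) n = - (\<Sum>i=0..n. fps_nth (sigma_fps_part N) i * fps_nth (etr N) (n - i))"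
        using arg_cong[OF qdiff_etr[of N], of "\<lambda>F. fps_nth F n"] by (simp add: fps_nth_qdiff fps_mult_nth sum_negf)
      also have "(\<Sum>i=0..n. fps_nth (sigma_fps_part N) i * fps_nth (etr N) (n - i)) =
           (\<Sum>i=0..n. fps_nth (sigma_fps 1) i * fps_nth (euler_pow (- 1)) (n - i))"
      proof (rule sum.cong)
        fix i assume "i \<in> {0..n}"
        then show "fps_nth (sigma_fps_part N) i * fps_nth (etr N) (n - i) = fps_nth (sigma_fps 1) i * fps_nth (euler_pow (- 1)) (n - i)"
          using less False sigma_fps_part_nth[of i N] by (cases "i = 0") (auto simp: sigma_fps_def sigma_k_def)
      qed simp
      also have "- \<dots> = of_nat n * fps_nth (euler_pow (- 1)) n"
        using arg_cong[OF qdiff_euler_pow, of "\<lambda>F. fps_nth F n"] by (simp add: fps_nth_qdiff fps_mult_nth sum_negf)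
      finally show ?thesis using False by simp
    qed
  qed
qed

text \<open>The eta quotient without its leading power of q; the sign is there because
  \<open>euler_pow c\<close> is the power -c of the Euler product.\<close>

definition eta_fps :: "(nat \<times> int) list \<Rightarrow> complex fps" where
  "eta_fps L = prod_list (map (\<lambda>(d, e). dil d (euler_pow (- of_int e))) L)"

lemma dil_mult: "d > 0 \<Longrightarrow> dil d (F * G) = dil d F * dil d G"
  for F :: "'a::idom fps"
  unfolding dil_def by (rule fps_compose_mult_distrib) simp

lemma dil_1: "dil d 1 = (1 :: 'a::comm_ring_1 fps)"
  by (simp add: dil_def)

lemma dil_power: "d > 0 \<Longrightarrow> dil d (F ^ k) = dil d F ^ k"
  for F :: "'a::idom fps"
  by (induction k) (simp_all add: dil_1 dil_mult)

lemma dil_inverse: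
  fixes F :: "'a::field fps"
  assumes "d > 0" "fps_nth F 0 \<noteq> 0"
  shows "dil d (inverse F) = inverse (dil d F)"
proof -
  have "dil d F * dil d (inverse F) = 1"
    using inverse_mult_eq_1'[OF assms(2)] assms(1) by (simp add: dil_mult[symmetric] dil_1)
  then show ?thesis by (simp add: fps_inverse_unique)
qed

lemma eta_factor:
  assumes "d > 0"
  shows "eq_upto m (cfps (if e \<ge> 0 then euler_trunc m d ^ nat e else inverse (euler_trunc m d) ^ nat (- e)))
     (dil d (euler_pow (- of_int e)))"
proof -
  have E: "eq_upto m (cfps (euler_trunc m d)) (dil d (euler_pow (- 1)))"
    unfolding cfps_euler_trunc[OF assms] by (intro eq_upto_dil eq_upto_etr)
  have c0: "fps_nth (cfps (euler_trunc m d)) 0 = 1"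
    using E by (simp add: eq_upto_def dil_nth euler_pow_nth_0)
  then have r0: "fps_nth (euler_trunc m d) 0 = 1" by (simp add: cfps_nth)
  show ?thesis
  proof (cases "e \<ge> 0")
    case True
    have "- of_int e = of_nat (nat e) * (- 1 :: complex)" using True by simp
    then have "euler_pow (- of_int e) = euler_pow (- 1) ^ nat e" by (metis euler_pow_of_nat)
    then show ?thesis using True E assms by (simp add: cfps_power dil_power eq_upto_power)
  next
    case False
    have "- of_int e = of_nat (nat (- e)) * (1 :: complex)" using False by simp
    then have "euler_pow (- of_int e) = euler_pow 1 ^ nat (- e)" by (metis euler_pow_of_nat)
    also have "euler_pow 1 = inverse (euler_pow (- 1))" using euler_pow_inverse[of "- 1"] by simp
    finally have "dil d (euler_pow (- of_int e)) = inverse (dil d (euler_pow (- 1))) ^ nat (- e)"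
      using assms by (simp add: dil_power dil_inverse euler_pow_nth_0)
    then show ?thesis using False E r0 c0 assms
      by (simp add: cfps_power cfps_inverse eq_upto_power eq_upto_inverse)
  qed
qed

text \<open>Cutting the products at m changes nothing up to q^m.\<close>

lemma eta_prod_coeff_eq:
  assumes "\<And>d e. (d, e) \<in> set L \<Longrightarrow> d > 0"
  shows "of_rat (eta_prod_coeff L m) = fps_nth (eta_fps L) m"
proof -
  have "eq_upto m (cfps (prod_list (map (\<lambda>(d, e). if e \<ge> 0 then euler_trunc m d ^ nat e
                                else inverse (euler_trunc m d) ^ nat (- e)) L))) (eta_fps L)"
    using assms
  proof (induction L)
    case Nil
    then show ?case by (simp add: eta_fps_def cfps_1 eq_upto_refl)
  next
    case (Cons x L)
    obtain d e where x: "x = (d, e)" by (cases x)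
    have d: "d > 0" using Cons.prems x by auto
    have "eq_upto m (cfps (prod_list (map (\<lambda>(d, e). if e \<ge> 0 then euler_trunc m d ^ nat e
                                else inverse (euler_trunc m d) ^ nat (- e)) L))) (eta_fps L)"
      by (rule Cons.IH) (use Cons.prems in auto)
    from eq_upto_mult[OF eta_factor[OF d, of m e] this] show ?case
      unfolding x eta_fps_def list.map prod_list.Cons prod.case cfps_mult .
  qed
  then show ?thesis by (simp add: eta_prod_coeff_def eq_upto_def cfps_nth)
qed

lemma eta_quot_coeff_eq:
  assumes "\<And>d e. (d, e) \<in> set L \<Longrightarrow> d > 0" "(\<Sum>(d, e)\<leftarrow>L. int d * e) div 24 = int s"
  shows "of_rat (eta_quot_coeff L n) = fps_nth (fps_X ^ s * eta_fps L) n"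
proof -
  have "nat (int n - int s) = n - s" by simp
  then show ?thesis using assms(2) eta_prod_coeff_eq[OF assms(1), where m = "n - s"]
    by (simp add: eta_quot_coeff_def Let_def fps_X_power_mult_nth)
qed

section \<open>Truncated computation of coefficients\<close>

fun lfps :: "int list \<Rightarrow> complex fps" where
  "lfps [] = 0"
| "lfps (x # xs) = fps_const (of_int x) + fps_X * lfps xs"

fun padd :: "int list \<Rightarrow> int list \<Rightarrow> int list" where
  "padd [] ys = ys"
| "padd xs [] = xs"
| "padd (x # xs) (y # ys) = (x + y) # padd xs ys"

fun pmul :: "int list \<Rightarrow> int list \<Rightarrow> int list" where
  "pmul [] ys = []"
| "pmul (x # xs) ys = padd (map ((*) x) ys) (0 # pmul xs ys)"

text \<open>24 entries hold q^0 to q^23, the range in which A + C has to be seen to vanish.\<close>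

definition tmul :: "int list \<Rightarrow> int list \<Rightarrow> int list" where
  "tmul xs ys = take 24 (pmul xs ys)"

fun tpow :: "nat \<Rightarrow> int list \<Rightarrow> int list" where
  "tpow 0 xs = [1]"
| "tpow (Suc n) xs = tmul xs (tpow n xs)"

fun tdil :: "nat \<Rightarrow> int list \<Rightarrow> int list" where
  "tdil d [] = []"
| "tdil d (x # xs) = x # replicate (d - 1) 0 @ tdil d xs"

lemma lfps_padd: "lfps (padd xs ys) = lfps xs + lfps ys"
  by (induction xs ys rule: padd.induct) (simp_all add: algebra_simps flip: fps_const_add)

lemma lfps_smult: "lfps (map ((*) c) xs) = fps_const (of_int c) * lfps xs"
  by (induction xs) (simp_all add: algebra_simps flip: fps_const_mult)

lemma lfps_pmul: "lfps (pmul xs ys) = lfps xs * lfps ys"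
  by (induction xs) (simp_all add: algebra_simps lfps_padd lfps_smult)

lemma lfps_zeros: "lfps (replicate k 0 @ xs) = fps_X ^ k * lfps xs"
  by (induction k) (simp_all add: mult.assoc)

lemma lfps_replicate_0: "lfps (replicate k 0) = 0"
  by (induction k) simp_all

lemma lfps_tdil: "d > 0 \<Longrightarrow> lfps (tdil d xs) = dil d (lfps xs)"
proof (induction xs)
  case (Cons x xs)
  have "dil d (fps_const (of_int x) + fps_X * lfps xs) = fps_const (of_int x) + fps_X ^ d * dil d (lfps xs)"
    using Cons.prems unfolding dil_def
    by (simp add: fps_compose_add_distrib fps_compose_mult_distrib)
  moreover have "fps_X * (fps_X ^ (d - 1) * lfps (tdil d xs)) = fps_X ^ d * lfps (tdil d xs)"
    using Cons.prems by (cases d) (simp_all add: mult.assoc)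
  ultimately show ?case using Cons by (simp add: lfps_zeros)
qed (simp add: dil_def)

lemma lfps_nth: "fps_nth (lfps xs) i = (if i < length xs then of_int (xs ! i) else 0)"
  by (induction xs arbitrary: i) (auto simp: nth_Cons split: nat.splits)

lemma lfps_take: "eq_upto 23 (lfps (take 24 xs)) (lfps xs)"
  by (auto simp: eq_upto_def lfps_nth)

text \<open>A shorter list is read as continued by zeros, and entries beyond q^23 are
  ignored.\<close>

definition coeffs :: "complex fps \<Rightarrow> int list \<Rightarrow> bool" where
  "coeffs F xs \<longleftrightarrow> eq_upto 23 F (lfps xs)"

lemma eq_upto_trans: "eq_upto N F G \<Longrightarrow> eq_upto N G H \<Longrightarrow> eq_upto N F H"
  and eq_upto_sym: "eq_upto N F G \<Longrightarrow> eq_upto N G F"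
  by (auto simp: eq_upto_def)

lemma coeffs_take: "coeffs F xs \<Longrightarrow> coeffs F (take 24 xs)"
  unfolding coeffs_def by (rule eq_upto_trans[OF _ eq_upto_sym[OF lfps_take]])

lemma coeffs_add: "coeffs F xs \<Longrightarrow> coeffs G ys \<Longrightarrow> coeffs (F + G) (padd xs ys)"
  by (simp add: coeffs_def lfps_padd eq_upto_def)

lemma coeffs_smult: "coeffs F xs \<Longrightarrow> coeffs (fps_const (of_int c) * F) (map ((*) c) xs)"
  by (simp add: coeffs_def lfps_smult eq_upto_mult eq_upto_refl)

lemma coeffs_mult: "coeffs F xs \<Longrightarrow> coeffs G ys \<Longrightarrow> coeffs (F * G) (tmul xs ys)"
  unfolding tmul_def by (intro coeffs_take) (simp add: coeffs_def lfps_pmul eq_upto_mult)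

lemma coeffs_1: "coeffs 1 [1]"
  by (simp add: coeffs_def eq_upto_refl)

lemma coeffs_power: "coeffs F xs \<Longrightarrow> coeffs (F ^ n) (tpow n xs)"
  by (induction n) (simp_all add: coeffs_1 coeffs_mult)

lemma coeffs_X_power: "coeffs F xs \<Longrightarrow> coeffs (fps_X ^ s * F) (take 24 (replicate s 0 @ xs))"
  by (intro coeffs_take) (simp add: coeffs_def lfps_zeros eq_upto_mult eq_upto_refl)

lemma coeffs_dil: "d > 0 \<Longrightarrow> coeffs F xs \<Longrightarrow> coeffs (dil d F) (take 24 (tdil d xs))"
  by (intro coeffs_take) (simp add: coeffs_def lfps_tdil eq_upto_dil)

section \<open>Coefficient lists of Euler products, eta quotients and divisor sums\<close>

definition euler_step :: "nat \<Rightarrow> int list \<Rightarrow> int list" where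
  "euler_step k xs = take 24 (padd xs (replicate k 0 @ map ((*) (- 1)) xs))"

fun euler_list :: "nat \<Rightarrow> int list" where
  "euler_list 0 = [1]"
| "euler_list (Suc N) = euler_step (Suc N) (euler_list N)"

lemma coeffs_etr: "coeffs (etr N) (euler_list N)"
proof (induction N)
  case 0
  then show ?case by (simp add: etr_def coeffs_1)
next
  case (Suc N)
  have e: "etr (Suc N) = etr N + fps_X ^ Suc N * (fps_const (of_int (- 1)) * etr N)"
    by (simp add: etr_def prod.nat_ivl_Suc' algebra_simps flip: fps_const_neg)
  have "eq_upto 23 (fps_X ^ Suc N * (fps_const (of_int (- 1)) * etr N))
       (lfps (replicate (Suc N) 0 @ map ((*) (- 1)) (euler_list N)))"
    unfolding lfps_zeros lfps_smult using Suc by (intro eq_upto_mult eq_upto_refl) (simp add: coeffs_def)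
  then show ?case unfolding e euler_list.simps euler_step_def by (intro coeffs_take coeffs_add Suc) (simp add: coeffs_def)
qed

text \<open>The signs at the generalized pentagonal numbers, as in Euler's theorem;
  \<open>euler_list_23\<close> certifies them by multiplying out the factors.\<close>

definition pent :: "int list" where
  "pent = [1, -1, -1, 0, 0, 1, 0, 1, 0, 0, 0, 0, -1, 0, 0, -1, 0, 0, 0, 0, 0, 0, 1, 0]"

text \<open>The partition numbers p(0) to p(23), certified as the inverse of \<open>pent\<close> by
  one multiplication.\<close>

definition part :: "int list" where
  "part = [1, 1, 2, 3, 5, 7, 11, 15, 22, 30, 42, 56, 77, 101, 135, 176, 231, 297, 385, 490, 627, 792, 1002, 1255]"

lemma euler_list_23: "euler_list 23 = pent"
  by code_simp

lemma tmul_part_pent: "tmul part pent = 1 # replicate 23 0"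
  by code_simp

lemma coeffs_euler_pow_neg: "coeffs (euler_pow (- 1)) pent"
  using eq_upto_sym[OF eq_upto_etr[of 23]] coeffs_etr[of 23] unfolding euler_list_23 coeffs_def
  by (rule eq_upto_trans)

lemma coeffs_euler_pow_pos: "coeffs (euler_pow 1) part"
proof -
  have "coeffs (lfps part * euler_pow (- 1)) (1 # replicate 23 0)"
    unfolding tmul_part_pent[symmetric] by (intro coeffs_mult coeffs_euler_pow_neg) (simp add: coeffs_def eq_upto_refl)
  then have "eq_upto 23 (lfps part * euler_pow (- 1) * euler_pow 1) (1 * euler_pow 1)"
    unfolding coeffs_def by (intro eq_upto_mult eq_upto_refl) (simp add: lfps_replicate_0)
  then show ?thesis unfolding coeffs_def mult.assoc euler_pow_add[symmetric]
    by (simp add: euler_pow_0 eq_upto_sym)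
qed

definition eta_list_factor :: "int \<Rightarrow> int list" where
  "eta_list_factor e = (if e \<ge> 0 then tpow (nat e) pent else tpow (nat (- e)) part)"

lemma coeffs_euler_pow: "coeffs (euler_pow (- of_int e)) (eta_list_factor e)"
proof (cases "e \<ge> 0")
  case True
  have "- of_int e = of_nat (nat e) * (- 1 :: complex)" using True by simp
  then have "euler_pow (- of_int e) = euler_pow (- 1) ^ nat e" by (metis euler_pow_of_nat)
  then show ?thesis using True coeffs_euler_pow_neg by (simp add: eta_list_factor_def coeffs_power)
next
  case False
  have "- of_int e = of_nat (nat (- e)) * (1 :: complex)" using False by simp
  then have "euler_pow (- of_int e) = euler_pow 1 ^ nat (- e)" by (metis euler_pow_of_nat)
  then show ?thesis using False coeffs_euler_pow_pos by (simp add: eta_list_factor_def coeffs_power)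
qed

fun eta_list :: "(nat \<times> int) list \<Rightarrow> int list" where
  "eta_list [] = [1]"
| "eta_list ((d, e) # L) = tmul (take 24 (tdil d (eta_list_factor e))) (eta_list L)"

lemma coeffs_eta_fps: "(\<And>d e. (d, e) \<in> set L \<Longrightarrow> d > 0) \<Longrightarrow> coeffs (eta_fps L) (eta_list L)"
proof (induction L)
  case Nil
  then show ?case by (simp add: eta_fps_def coeffs_1)
next
  case (Cons x L)
  obtain d e where x: "x = (d, e)" by (cases x)
  have "d > 0" using Cons.prems x by auto
  moreover have "coeffs (eta_fps L) (eta_list L)" by (rule Cons.IH) (use Cons.prems in auto)
  ultimately show ?case unfolding x by (auto simp: eta_fps_def intro!: coeffs_mult coeffs_dil coeffs_euler_pow)
qed

definition sigma_list :: "nat \<Rightarrow> int list" where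
  "sigma_list k = map (\<lambda>n. \<Sum>d\<leftarrow>[1..<Suc n]. if d dvd n then int d ^ k else 0) [0..<24]"

lemma coeffs_sigma_fps: "coeffs (sigma_fps k) (sigma_list k)"
proof -
  have "int (sigma_k k n) = (\<Sum>d\<leftarrow>[1..<Suc n]. if d dvd n then int d ^ k else 0)" for n
  proof (cases "n = 0")
    case False
    have "{d. d dvd n} = {d \<in> set [1..<Suc n]. d dvd n}"
    proof (intro equalityI subsetI)
      fix d assume "d \<in> {d. d dvd n}"
      then have "d \<noteq> 0" "d \<le> n" "d dvd n" using False by (auto dest: dvd_imp_le)
      then show "d \<in> {d \<in> set [1..<Suc n]. d dvd n}" by auto
    qed auto
    then have "int (sigma_k k n) = (\<Sum>d\<in>{d \<in> set [1..<Suc n]. d dvd n}. int d ^ k)"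
      using False by (simp add: sigma_k_def)
    also have "\<dots> = (\<Sum>d\<in>set [1..<Suc n]. if d dvd n then int d ^ k else 0)"
      by (rule sum.inter_filter) simp
    also have "\<dots> = (\<Sum>d\<leftarrow>[1..<Suc n]. if d dvd n then int d ^ k else 0)"
      by (rule sum_list_distinct_conv_sum_set[symmetric]) simp
    finally show ?thesis .
  qed (simp add: sigma_k_def)
  then have "of_nat (sigma_k k n) = (of_int (\<Sum>d\<leftarrow>[1..<Suc n]. if d dvd n then int d ^ k else 0) :: complex)" for n
    by (metis of_int_of_nat_eq)
  then show ?thesis by (auto simp: coeffs_def eq_upto_def lfps_nth sigma_list_def sigma_fps_def simp del: upt_Suc)
qed

definition E2_series :: "complex fps" where
  "E2_series = 1 + fps_const (of_int (- 24)) * sigma_fps 1"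

definition E4_series :: "complex fps" where
  "E4_series = 1 + fps_const (of_int 240) * sigma_fps 3"

definition level22_E2 :: "complex fps" where
  "level22_E2 = fps_const (of_int 2) * dil 2 E2_series + fps_const (of_int (- 11)) * dil 11 E2_series"

abbreviation "L1 \<equiv> [(1, 6), (11, 6), (2, -2), (22, -2)] :: (nat \<times> int) list"
abbreviation "L2 \<equiv> [(1, 4), (11, 4)] :: (nat \<times> int) list"
abbreviation "L3 \<equiv> [(1, 2), (2, 2), (11, 2), (22, 2)] :: (nat \<times> int) list"
abbreviation "L4 \<equiv> [(2, 4), (22, 4)] :: (nat \<times> int) list"
abbreviation "L5 \<equiv> [(2, 6), (22, 6), (1, -2), (11, -2)] :: (nat \<times> int) list"
abbreviation "L6 \<equiv> [(2, 1), (11, 3), (22, 5), (1, -1)] :: (nat \<times> int) list"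
abbreviation "L7 \<equiv> [(2, 9), (11, 7), (1, -5), (22, -3)] :: (nat \<times> int) list"

text \<open>The claimed identity, multiplied by \<open>- 25344 \<cdot> 305\<close> to clear denominators, reads
  \<open>fps_A + fps_C = 0\<close>.  Here \<open>fps_A\<close> has trivial character, while the eta quotients in \<open>fps_C\<close> have
  odd exponents.\<close>
definition fps_A :: "complex fps" where
  "fps_A = fps_const (of_int 305) * level22_E2 ^ 2
    + (fps_const (of_int (- 330)) * E4_series + (fps_const (of_int (- 780)) * dil 2 E4_series
    + (fps_const (of_int (- 33891)) * dil 11 E4_series + (fps_const (of_int 10296) * dil 22 E4_series
    + (fps_const (of_int (- 184320)) * (fps_X ^ 1 * eta_fps L1)
    + (fps_const (of_int (- 1787040)) * (fps_X ^ 2 * eta_fps L2)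
    + (fps_const (of_int (- 5801760)) * (fps_X ^ 3 * eta_fps L3)
    + (fps_const (of_int (- 7695360)) * (fps_X ^ 4 * eta_fps L4)
    + fps_const (of_int (- 4170240)) * (fps_X ^ 5 * eta_fps L5)))))))))"

definition fps_C :: "complex fps" where
  "fps_C = fps_const (of_int 6763680) * (fps_X ^ 6 * eta_fps L6)
    + fps_const (of_int 263520) * (fps_X ^ 1 * eta_fps L7)"

definition E2_list :: "int list" where
  "E2_list = padd [1] (map ((*) (- 24)) (sigma_list 1))"

definition E4_list :: "int list" where
  "E4_list = padd [1] (map ((*) 240) (sigma_list 3))"

definition level22_E2_list :: "int list" where
  "level22_E2_list = padd (map ((*) 2) (take 24 (tdil 2 E2_list))) (map ((*) (- 11)) (take 24 (tdil 11 E2_list)))"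

definition eta_qlist :: "nat \<Rightarrow> (nat \<times> int) list \<Rightarrow> int list" where
  "eta_qlist s L = take 24 (replicate s 0 @ eta_list L)"

definition A_list :: "int list" where
  "A_list = padd (map ((*) 305) (tpow 2 level22_E2_list))
     (padd (map ((*) (- 330)) E4_list) (padd (map ((*) (- 780)) (take 24 (tdil 2 E4_list)))
     (padd (map ((*) (- 33891)) (take 24 (tdil 11 E4_list))) (padd (map ((*) 10296) (take 24 (tdil 22 E4_list)))
     (padd (map ((*) (- 184320)) (eta_qlist 1 L1))
     (padd (map ((*) (- 1787040)) (eta_qlist 2 L2))
     (padd (map ((*) (- 5801760)) (eta_qlist 3 L3))
     (padd (map ((*) (- 7695360)) (eta_qlist 4 L4))
       (map ((*) (- 4170240)) (eta_qlist 5 L5))))))))))"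

definition C_list :: "int list" where
  "C_list = padd (map ((*) 6763680) (eta_qlist 6 L6)) (map ((*) 263520) (eta_qlist 1 L7))"

lemma coeffs_E2: "coeffs E2_series E2_list"
  unfolding E2_series_def E2_list_def by (intro coeffs_add coeffs_1 coeffs_smult coeffs_sigma_fps)

lemma coeffs_E4: "coeffs E4_series E4_list"
  unfolding E4_series_def E4_list_def by (intro coeffs_add coeffs_1 coeffs_smult coeffs_sigma_fps)

lemma coeffs_level22_E2: "coeffs level22_E2 level22_E2_list"
  unfolding level22_E2_def level22_E2_list_def by (intro coeffs_add coeffs_smult coeffs_dil coeffs_E2) simp_all

lemma coeffs_eta_q: "(\<And>d e. (d, e) \<in> set L \<Longrightarrow> d > 0) \<Longrightarrow> coeffs (fps_X ^ s * eta_fps L) (eta_qlist s L)"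
  unfolding eta_qlist_def by (intro coeffs_X_power coeffs_eta_fps)

lemma coeffs_A: "coeffs fps_A A_list"
  unfolding fps_A_def A_list_def
  by (intro coeffs_add coeffs_smult coeffs_power coeffs_dil coeffs_E4 coeffs_level22_E2 coeffs_eta_q) (auto simp: numeral_eq_Suc)

lemma coeffs_C: "coeffs fps_C C_list"
  unfolding fps_C_def C_list_def by (intro coeffs_add coeffs_smult coeffs_eta_q) auto

text \<open>The finite computation behind the theorem, in the range dictated by the bound 24 for
  weight 8 and index 36.\<close>

lemma list_A_C: "padd A_list C_list = replicate 24 0"
  by code_simp

text \<open>The entry 0 provides the zero of A - C at infinity, hence the 25th order of F; the other
  entry shows that A - C is not 0.\<close>

lemma list_C: "take 2 C_list = [0, 263520]"
  by code_simp

lemma fps_A_C_coeffs: "i < 24 \<Longrightarrow> fps_nth (fps_A + fps_C) i = 0"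
  using coeffs_add[OF coeffs_A coeffs_C] unfolding list_A_C coeffs_def lfps_replicate_0 eq_upto_def by auto

lemma fps_C_coeffs: "fps_nth fps_C 0 = 0" "fps_nth fps_C 1 = 263520"
proof -
  have "length C_list \<ge> 2" using arg_cong[OF list_C, of length] by (simp add: min_def split: if_splits)
  moreover have "C_list ! i = [0, 263520] ! i" if "i < 2" for i
    using nth_take[OF that, of C_list] by (simp add: list_C)
  from this[of 0] this[of 1] have "C_list ! 0 = 0" "C_list ! 1 = 263520" by simp_all
  ultimately show "fps_nth fps_C 0 = 0" "fps_nth fps_C 1 = 263520"
    using coeffs_C by (auto simp: coeffs_def eq_upto_def lfps_nth)
qed

section \<open>The identity\<close>

text \<open>The series \<open>fps_A\<close> slashed with M. The exponents of eta are halved, as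
  \<open>etaq\<close> counts powers of eta^2, and the factors 2 and 11 of E2 come from the
  determinants in \<open>slashE2\<close>.\<close>

definition form_A :: "mat2 \<Rightarrow> complex \<Rightarrow> complex" where
  "form_A M z = 305 * (slashE2 (dscale 2 M) z - slashE2 (dscale 11 M) z) ^ 2
    + ((- 330) * slashE4 (dscale 1 M) z + ((- 780) * slashE4 (dscale 2 M) z
    + ((- 33891) * slashE4 (dscale 11 M) z + (10296 * slashE4 (dscale 22 M) z
    + ((- 184320) * etaq (3, -1, 3, -1) M z
    + ((- 1787040) * etaq (2, 0, 2, 0) M z
    + ((- 5801760) * etaq (1, 1, 1, 1) M z
    + ((- 7695360) * etaq (0, 2, 0, 2) M z
    + (- 4170240) * etaq (-1, 3, -1, 3) M z))))))))"

text \<open>This is \<open>C\<^sup>2\<close> for \<open>C = 6763680 B\<^sub>6 + 263520 B\<^sub>7\<close>.\<close>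
definition form_CC :: "mat2 \<Rightarrow> complex \<Rightarrow> complex" where
  "form_CC M z = 6763680\<^sup>2 * etaq (-1, 1, 3, 5) M z + (2 * 6763680 * 263520 * etaq (-3, 5, 5, 1) M z
    + 263520\<^sup>2 * etaq (-5, 9, 7, -3) M z)"

definition form_F :: "mat2 \<Rightarrow> complex \<Rightarrow> complex" where
  "form_F M z = form_A M z ^ 2 - form_CC M z"

abbreviation level22_exponents :: "(int \<times> int \<times> int \<times> int) set" where
  "level22_exponents \<equiv> {(3, -1, 3, -1), (2, 0, 2, 0), (1, 1, 1, 1), (0, 2, 0, 2), (-1, 3, -1, 3),
      (-1, 1, 3, 5), (-3, 5, 5, 1), (-5, 9, 7, -3)}"

text \<open>Expressing three of the four values of \<open>psi\<close> by the one for 11 leaves two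
  conditions on the exponents, 12 | e2 + e3 - e1 - e4 and 4 | e4 - e2, which all listed tuples
  satisfy.\<close>

lemma psi_sum_trivial:
  assumes "mdet g = 1" "22 dvd lower_left g"
    "e \<in> level22_exponents"
  shows "[psi_sum e g = 0] (mod 12)"
proof -
  obtain k l m where "psi (conj_dscale 1 g) + psi (conj_dscale 11 g) = 12 * k"
    "psi (conj_dscale 2 g) + psi (conj_dscale 22 g) = 12 * l" "psi (conj_dscale 11 g) + psi (conj_dscale 22 g) = 3 * m"
    using psi_relations[OF assms(1,2)] by metis
  then have "psi (conj_dscale 22 g) = 3 * m - psi (conj_dscale 11 g)"
    "psi (conj_dscale 2 g) = 12 * l - 3 * m + psi (conj_dscale 11 g)"
    "psi (conj_dscale 1 g) = 12 * k - psi (conj_dscale 11 g)" by linarith+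
  note p = this
  show ?thesis using assms(3) unfolding cong_0_iff
    by (elim insertE emptyE; hypsubst; unfold psi_sum.simps p; presburger)
qed

lemma cusp_conditions:
  "e \<in> level22_exponents \<Longrightarrow> cusp_ok e"
  by auto

text \<open>The correction term in \<open>slashE2_right\<close> depends on g only, so it cancels in
  the difference and true weight 2 remains.\<close>

lemma slashE2_diff_right:
  assumes "mdet M = 1" "mdet g = 1" "Im z > 0"
  shows "slashE2 (dscale 2 (mmul M g)) z - slashE2 (dscale 11 (mmul M g)) z =
     (slashE2 (dscale 2 M) (mob g z) - slashE2 (dscale 11 M) (mob g z)) / (autf g z)\<^sup>2"
  using assms unfolding dscale_mmul by (simp add: slashE2_right diff_divide_distrib)

lemma form_A_right:
  assumes "mdet M = 1" "mdet g = 1" "Im z > 0"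
  shows "form_A (mmul M g) z = form_A M (mob g z) / autf g z ^ 4"
proof -
  have Y: "slashE4 (dscale t (mmul M g)) z = slashE4 (dscale t M) (mob g z) / autf g z ^ 4" if "t > 0" for t
    using assms that unfolding dscale_mmul by (simp add: slashE4_right)
  have E: "etaq (a, b, c, d) (mmul M g) z = etaq (a, b, c, d) M (mob g z) / autf g z ^ 4" if "a + b + c + d = 4" for a b c d
    using etaq_right[OF assms, of "(a, b, c, d)"] that by (simp add: power_int_def del: etaq.simps)
  have "(autf g z)\<^sup>2 ^ 2 = autf g z ^ 4" by (simp flip: power_mult)
  then show ?thesis unfolding form_A_def slashE2_diff_right[OF assms] power_divide
    by (simp add: Y E add_divide_distrib diff_divide_distrib del: etaq.simps)
qed

lemma form_F_right:
  assumes "mdet M = 1" "mdet g = 1" "Im z > 0"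
  shows "form_F (mmul M g) z = form_F M (mob g z) / autf g z ^ 8"
proof -
  have E: "etaq (a, b, c, d) (mmul M g) z = etaq (a, b, c, d) M (mob g z) / autf g z ^ 8" if "a + b + c + d = 8" for a b c d
    using etaq_right[OF assms, of "(a, b, c, d)"] that by (simp add: power_int_def del: etaq.simps)
  have "(autf g z ^ 4) ^ 2 = autf g z ^ 8" by (simp flip: power_mult)
  then show ?thesis unfolding form_F_def form_A_right[OF assms] power_divide form_CC_def
    by (simp add: E add_divide_distrib diff_divide_distrib del: etaq.simps)
qed

lemma form_F_left:
  assumes "mdet M = 1" "mdet g = 1" "22 dvd lower_left g" "Im z > 0"
  shows "form_F (mmul g M) z = form_F M z"
proof -
  have dvd: "2 dvd lower_left g" "11 dvd lower_left g" using assms(3) by presburger+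
  have X: "slashE2 (dscale t (mmul g M)) z = slashE2 (dscale t M) z" and Y: "slashE4 (dscale t (mmul g M)) z = slashE4 (dscale t M) z"
    if "t dvd lower_left g" "t > 0" for t
    unfolding dscale_mmul_conj[OF that(1)] using that assms
    by (auto intro!: slashE2_left slashE4_left simp: mdet_conj_dscale)
  have E: "etaq e (mmul g M) z = etaq e M z" if "e \<in> level22_exponents" for e
    using psi_sum_trivial[OF assms(2,3) that] assms by (intro etaq_left) auto
  show ?thesis unfolding form_F_def form_A_def form_CC_def using assms(3) dvd
    by (simp add: X Y E del: etaq.simps)
qed

lemma holomorphic_form_F:
  assumes "mdet M = 1"
  shows "form_F M holomorphic_on uhp"
  unfolding form_F_def[abs_def] form_A_def form_CC_def
  by (intro holomorphic_intros holomorphic_slashE2 holomorphic_slashE4 holomorphic_etaq) (use assms in auto)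

lemma bdd_form_F:
  assumes "mdet M = 1"
  shows "bdd_inf (form_F M)"
  unfolding form_F_def[abs_def] form_A_def form_CC_def
  by (intro bdd_inf_intros bdd_inf_slashE2 bdd_inf_slashE4 bdd_inf_etaq[OF assms] cusp_conditions) (use assms in auto)

lemma qeval_eta_fps:
  assumes "\<And>d e. (d, e) \<in> set L \<Longrightarrow> d > 0" "Im z > 0"
  shows "conv1 (eta_fps L) \<and> qeval (eta_fps L) z = exp (- (\<Sum>(d, e)\<leftarrow>L. of_int e * qeval euler_log (of_nat d * z)))"
  using assms(1)
proof (induction L)
  case Nil
  then show ?case by (simp add: eta_fps_def conv1_1 qeval_1)
next
  case (Cons x L)
  obtain d e where x: "x = (d, e)" by (cases x)
  have d: "d > 0" using Cons.prems x by auto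
  then have Im: "Im (of_nat d * z) > 0" using assms(2) by simp
  have IH: "conv1 (eta_fps L)" "qeval (eta_fps L) z = exp (- (\<Sum>(d, e)\<leftarrow>L. of_int e * qeval euler_log (of_nat d * z)))"
    using Cons.IH Cons.prems by auto
  have c: "conv1 (dil d (euler_pow (- of_int e)))" by (intro conv1_dil conv1_euler_pow d)
  have e: "eta_fps (x # L) = dil d (euler_pow (- of_int e)) * eta_fps L" by (simp add: eta_fps_def x)
  have u: "qeval (dil d (euler_pow (- of_int e))) z = exp (- of_int e * qeval euler_log (of_nat d * z))"
    unfolding qeval_dil[OF conv1_euler_pow d assms(2)] by (rule qeval_euler_pow[OF Im])
  show ?case unfolding e using c IH assms(2) by (simp add: conv1_mult qeval_mult u exp_add[symmetric] x)
qed

lemma etaq_mI: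
  assumes "Im z > 0"
  shows "etaq (e1, e2, e3, e4) mI z = exp (\<i> * of_real pi / 6 * of_int (e1 + 2 * e2 + 11 * e3 + 22 * e4) * z
    - 2 * (of_int e1 * qeval euler_log z + of_int e2 * qeval euler_log (2 * z) + of_int e3 * qeval euler_log (11 * z) + of_int e4 * qeval euler_log (22 * z)))"
proof -
  have N: "slashEta (dscale t mI) z powi e = exp (of_int e * (\<i> * of_real pi * (of_int t * z) / 6 - 2 * qeval euler_log (of_int t * z)))" for t e
    by (simp add: slashEta_def eta2_def exp_power_int)
  show ?thesis unfolding etaq.simps N exp_add[symmetric]
    by (rule arg_cong[of _ _ exp]) (simp add: algebra_simps add_divide_distrib)
qed

lemma qeval_eta_q:
  assumes "\<And>d e. (d, e) \<in> set L \<Longrightarrow> d > 0" "Im z > 0"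
  shows "conv1 (fps_X ^ s * eta_fps L) \<and> qeval (fps_X ^ s * eta_fps L) z =
     exp (2 * of_real pi * \<i> * of_nat s * z - (\<Sum>(d, e)\<leftarrow>L. of_int e * qeval euler_log (of_nat d * z)))"
proof -
  have "qexp z ^ s = exp (2 * of_real pi * \<i> * of_nat s * z)"
    unfolding qexp_def exp_of_nat_mult[symmetric] by (simp add: mult_ac)
  then show ?thesis using qeval_eta_fps[OF assms] assms(2)
    by (simp add: conv1_mult conv1_power conv1_X qeval_mult qeval_power qeval_X exp_diff exp_minus divide_inverse)
qed

lemma E2_series_eq: "E2_series = 1 - 24 * sigma_fps 1"
  and E4_series_eq: "E4_series = 1 + 240 * sigma_fps 3"
  by (rule fps_ext; simp add: E2_series_def E4_series_def fps_mult_numeral_left)+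

lemma conv1_E2_series: "conv1 E2_series" and conv1_E4_series: "conv1 E4_series"
  unfolding E2_series_def E4_series_def by (intro conv1_intros)+

lemma qeval_E2_series: "Im z > 0 \<Longrightarrow> qeval E2_series z = E2 z" and qeval_E4_series: "Im z > 0 \<Longrightarrow> qeval E4_series z = E4 z"
  using E2_eq_qeval E4_eq_qeval unfolding E2_series_eq E4_series_eq by simp_all

lemma conv1_fps_A: "conv1 fps_A" and conv1_fps_C: "conv1 fps_C"
proof -
  have eta: "conv1 (fps_X ^ s * eta_fps L)" if "\<And>d e. (d, e) \<in> set L \<Longrightarrow> d > 0" for s L
    by (rule qeval_eta_q[where z = \<i>, THEN conjunct1]) (use that in auto)
  show "conv1 fps_A" unfolding fps_A_def level22_E2_def
    by (intro conv1_add conv1_mult[OF conv1_const] conv1_power conv1_dil conv1_E2_series conv1_E4_series eta) auto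
  show "conv1 fps_C" unfolding fps_C_def by (intro conv1_add conv1_mult[OF conv1_const] eta) auto
qed

lemma qeval_fps_A:
  assumes z: "Im z > 0"
  shows "qeval fps_A z = form_A mI z"
proof -
  have E: "slashE2 (dscale (int t) mI) z = of_nat t * qeval (dil t E2_series) z" and E4: "qeval (dil t E4_series) z = slashE4 (dscale (int t) mI) z" if "t > 0" for t
    using that z by (simp_all add: qeval_dil conv1_E2_series conv1_E4_series qeval_E2_series qeval_E4_series slashE2_def slashE4_def)
  have V1: "qeval E4_series z = slashE4 (dscale 1 mI) z" using z by (simp add: qeval_E4_series slashE4_def)
  have crE: "conv1 (dil t E2_series)" and crV: "conv1 (dil t E4_series)" if "t > 0" for t
    using that by (intro conv1_dil conv1_E2_series conv1_E4_series; simp)+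
  have crL: "conv1 level22_E2" unfolding level22_E2_def by (intro conv1_add conv1_mult[OF conv1_const] crE) auto
  have uE: "qeval level22_E2 z = slashE2 (dscale 2 mI) z - slashE2 (dscale 11 mI) z"
    unfolding level22_E2_def using z E[of 2] E[of 11]
    by (simp add: qeval_add qeval_mult qeval_const conv1_mult conv1_const crE del: fps_const_neg)
  have cr: "conv1 (fps_X ^ s * eta_fps L)"
    and u: "qeval (fps_X ^ s * eta_fps L) z = exp (2 * of_real pi * \<i> * of_nat s * z - (\<Sum>(d, e)\<leftarrow>L. of_int e * qeval euler_log (of_nat d * z)))"
    if "\<And>d e. (d, e) \<in> set L \<Longrightarrow> d > 0" for s L
    using qeval_eta_q[of L z s] that z by auto
  have c: "conv1 (fps_X ^ 1 * eta_fps L1)" "conv1 (fps_X ^ 2 * eta_fps L2)" "conv1 (fps_X ^ 3 * eta_fps L3)"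
    "conv1 (fps_X ^ 4 * eta_fps L4)" "conv1 (fps_X ^ 5 * eta_fps L5)" by (rule cr; auto)+
  have e: "qeval (fps_X ^ 1 * eta_fps L1) z = etaq (3, -1, 3, -1) mI z"
    "qeval (fps_X ^ 2 * eta_fps L2) z = etaq (2, 0, 2, 0) mI z"
    "qeval (fps_X ^ 3 * eta_fps L3) z = etaq (1, 1, 1, 1) mI z"
    "qeval (fps_X ^ 4 * eta_fps L4) z = etaq (0, 2, 0, 2) mI z"
    "qeval (fps_X ^ 5 * eta_fps L5) z = etaq (-1, 3, -1, 3) mI z"
    by (subst u; (auto; fail)?; unfold etaq_mI[OF z]; intro arg_cong[of _ _ exp]; simp add: algebra_simps)+
  show ?thesis unfolding fps_A_def form_A_def
    using z by (simp only: qeval_add qeval_mult qeval_power qeval_const conv1_add conv1_mult conv1_power conv1_const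
        c crL crE crV conv1_E4_series e uE E4 V1 zero_less_numeral) (simp only: of_int_numeral of_int_minus of_nat_numeral)
qed

text \<open>In a product of two of the series B6, B7 all exponents of eta are even, and the
  exponents of eta^2 are the means of the given ones.\<close>

lemma qeval_fps_C_square:
  assumes z: "Im z > 0"
  shows "qeval fps_C z ^ 2 = form_CC mI z"
proof -
  have cr: "conv1 (fps_X ^ s * eta_fps L)"
    and u: "qeval (fps_X ^ s * eta_fps L) z = exp (2 * of_real pi * \<i> * of_nat s * z - (\<Sum>(d, e)\<leftarrow>L. of_int e * qeval euler_log (of_nat d * z)))"
    if "\<And>d e. (d, e) \<in> set L \<Longrightarrow> d > 0" for s L
    using qeval_eta_q[of L z s] that z by auto
  have c: "conv1 (fps_X ^ 6 * eta_fps L6)" "conv1 (fps_X ^ 1 * eta_fps L7)" by (rule cr; auto)+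
  define B6 B7 where "B6 = qeval (fps_X ^ 6 * eta_fps L6) z" and "B7 = qeval (fps_X ^ 1 * eta_fps L7) z"
  have e6: "B6 = exp (2 * of_real pi * \<i> * of_nat 6 * z - (\<Sum>(d, e)\<leftarrow>L6. of_int e * qeval euler_log (of_nat d * z)))"
    unfolding B6_def by (rule u) auto
  have e7: "B7 = exp (2 * of_real pi * \<i> * of_nat 1 * z - (\<Sum>(d, e)\<leftarrow>L7. of_int e * qeval euler_log (of_nat d * z)))"
    unfolding B7_def by (rule u) auto
  have 1: "B6 * B6 = etaq (-1, 1, 3, 5) mI z" "B6 * B7 = etaq (-3, 5, 5, 1) mI z" "B7 * B7 = etaq (-5, 9, 7, -3) mI z"
    unfolding e6 e7 exp_add[symmetric] etaq_mI[OF z] by (intro arg_cong[of _ _ exp]; simp add: algebra_simps)+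
  have "qeval fps_C z = 6763680 * B6 + 263520 * B7"
    unfolding fps_C_def B6_def B7_def using z c by (simp only: qeval_add qeval_mult qeval_const conv1_mult conv1_const) simp
  then show ?thesis unfolding form_CC_def 1[symmetric] by (simp add: power2_eq_square algebra_simps)
qed

theorem fps_A_C_zero: "fps_A + fps_C = 0"
proof -
  define D where "D = (fps_A + fps_C) * (fps_A - fps_C)"
  have cr: "conv1 D" unfolding D_def by (intro conv1_mult conv1_add conv1_diff conv1_fps_A conv1_fps_C)
  have uD: "qeval D z = form_F mI z" if z: "Im z > 0" for z
  proof -
    have "qeval D z = (qeval fps_A z + qeval fps_C z) * (qeval fps_A z - qeval fps_C z)"
      unfolding D_def using z conv1_fps_A conv1_fps_C by (simp only: qeval_mult qeval_add qeval_diff conv1_add conv1_diff)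
    then have "qeval D z = qeval fps_A z ^ 2 - qeval fps_C z ^ 2" by (simp add: power2_eq_square algebra_simps)
    then show ?thesis by (simp add: qeval_fps_A[OF z] qeval_fps_C_square[OF z] form_F_def)
  qed
  \<comment> \<open>This zero of A - C raises the order of \<open>D\<close> from 24 to 25.\<close>
  have A0: "fps_nth (fps_A - fps_C) 0 = 0"
    using fps_A_C_coeffs[of 0] fps_C_coeffs by simp
  have "fps_nth D i = 0" if "i < 25" for i
    unfolding D_def fps_mult_nth
  proof (rule sum.neutral, rule ballI)
    fix j assume j: "j \<in> {0..i}"
    show "fps_nth (fps_A + fps_C) j * fps_nth (fps_A - fps_C) (i - j) = 0"
      using fps_A_C_coeffs[of j] A0 that j by (cases "j < 24") auto
  qed
  then obtain C where C: "C > 0" "\<And>z. Im z \<ge> 1 \<Longrightarrow> norm (qeval D z) \<le> C * norm (qexp z) ^ 25"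
    using qeval_bound[OF cr, of 25 1] by auto
  interpret level22 form_F
    by unfold_locales (use form_F_right form_F_left holomorphic_form_F bdd_form_F in auto)
  have "form_F mI z = 0" if z: "Im z > 0" for z
  proof (rule vanish[OF C(1) _ z])
    fix z assume "Im z \<ge> 1"
    then show "norm (form_F mI z) \<le> C * norm (qexp z) ^ 25" using C(2)[of z] uD[of z] by simp
  qed
  then have "D = 0" using uD by (intro qeval_eq_0_imp cr) auto
  then have "fps_A + fps_C = 0 \<or> fps_A - fps_C = 0" unfolding D_def by simp
  \<comment> \<open>A and C have opposite coefficients of q, so that of A - C is -2 *
    263520.\<close>
  moreover have "fps_nth (fps_A - fps_C) 1 \<noteq> 0"
    using fps_A_C_coeffs[of 1] fps_C_coeffs by (simp add: eq_neg_iff_add_eq_0[symmetric])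
  ultimately show ?thesis by auto
qed

section \<open>Comparison of coefficients\<close>

lemma W_eq_nth: "of_nat (W 2 11 n) = fps_nth (dil 2 (sigma_fps 1) * dil 11 (sigma_fps 1)) n"
proof -
  define S where "S = {(l, m). 2 * l + 11 * m = n}"
  have fin: "finite S" by (rule finite_subset[of _ "{..n} \<times> {..n}"]) (auto simp: S_def)
  have "fps_nth (dil 2 (sigma_fps 1) * dil 11 (sigma_fps 1)) n =
     (\<Sum>i\<in>{0..n}. fps_nth (dil 2 (sigma_fps 1)) i * fps_nth (dil 11 (sigma_fps 1)) (n - i))"
    by (simp add: fps_mult_nth)
  also have "\<dots> = (\<Sum>i\<in>(\<lambda>(l, m). 2 * l) ` S. fps_nth (dil 2 (sigma_fps 1)) i * fps_nth (dil 11 (sigma_fps 1)) (n - i))"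
  proof (rule sum.mono_neutral_right)
    show "\<forall>i\<in>{0..n} - (\<lambda>(l, m). 2 * l) ` S. fps_nth (dil 2 (sigma_fps 1)) i * fps_nth (dil 11 (sigma_fps 1)) (n - i) = 0"
    proof
      fix i assume i: "i \<in> {0..n} - (\<lambda>(l, m). 2 * l) ` S"
      have "\<not> (2 dvd i \<and> 11 dvd n - i)"
      proof
        assume "2 dvd i \<and> 11 dvd n - i"
        then obtain l m where "i = 2 * l" "n - i = 11 * m" by (auto elim!: dvdE)
        with i have "(l, m) \<in> S" by (auto simp: S_def)
        with i \<open>i = 2 * l\<close> show False by force
      qed
      then show "fps_nth (dil 2 (sigma_fps 1)) i * fps_nth (dil 11 (sigma_fps 1)) (n - i) = 0" by (auto simp: dil_nth)
    qed
  qed (auto simp: S_def)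
  also have "\<dots> = (\<Sum>(l, m)\<in>S. of_nat (sigma_k 1 l) * of_nat (sigma_k 1 m))"
  proof (rule sum.reindex_cong)
    show "inj_on (\<lambda>(l, m). 2 * l) S" by (auto simp: inj_on_def S_def)
    fix x assume "x \<in> S"
    then obtain l m where x: "x = (l, m)" "n = 2 * l + 11 * m" by (auto simp: S_def)
    then show "fps_nth (dil 2 (sigma_fps 1)) ((\<lambda>(l, m). 2 * l) x) * fps_nth (dil 11 (sigma_fps 1)) (n - (\<lambda>(l, m). 2 * l) x)
      = (case x of (l, m) \<Rightarrow> of_nat (sigma_k 1 l) * of_nat (sigma_k 1 m))" by (simp add: dil_nth sigma_fps_def)
  qed simp
  also have "\<dots> = of_nat (W 2 11 n)" unfolding W_def S_def by (simp add: case_prod_unfold)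
  finally show ?thesis ..
qed

lemma sigmaQ_div:
  assumes "d > 0" "n > 0"
  shows "sigmaQ k (of_nat n / of_nat d) = (if d dvd n then of_nat (sigma_k k (n div d)) else 0)"
proof (cases "d dvd n")
  case True
  then obtain m where m: "n = d * m" by blast
  have q: "of_nat n / of_nat d = (of_nat m :: rat)" using assms by (simp add: m)
  have "(THE m'. of_nat m = (of_nat m' :: rat)) = m" by auto
  then show ?thesis unfolding q sigmaQ_def using assms m by auto
next
  case False
  have "\<not> (\<exists>m::nat. of_nat n / of_nat d = (of_nat m :: rat))"
  proof
    assume "\<exists>m::nat. of_nat n / of_nat d = (of_nat m :: rat)"
    then obtain m where "of_nat n / of_nat d = (of_nat m :: rat)" by blast
    then have "of_nat n = (of_nat (d * m) :: rat)" using assms by (simp add: field_simps)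
    then have "n = d * m" by (simp only: of_nat_eq_iff)
    with False show False by simp
  qed
  then show ?thesis using False by (auto simp: sigmaQ_def)
qed

lemma dil_diff: "dil d (F - G) = dil d F - dil d (G :: complex fps)"
  by (simp add: dil_def fps_compose_sub_distrib)

lemma dil_numeral: "dil d (numeral k :: complex fps) = numeral k"
  by (simp add: dil_def)

lemma E2_series_square: "E2_series\<^sup>2 = E4_series - 288 * qdiff (sigma_fps 1)"
  using Ramanujan_fps unfolding E2_series_eq E4_series_eq by (simp add: eq_diff_eq)

text \<open>Only the cross term is a genuine convolution, entering with -44 * 24^2 = -25344;
  Ramanujan's identity makes the two squares linear.\<close>

lemma level22_E2_square:
  "level22_E2\<^sup>2 = 4 * (dil 2 E4_series - 288 * dil 2 (qdiff (sigma_fps 1))) + 121 * (dil 11 E4_series - 288 * dil 11 (qdiff (sigma_fps 1)))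
     - 44 * ((1 - 24 * dil 2 (sigma_fps 1)) * (1 - 24 * dil 11 (sigma_fps 1)))"
proof -
  have sq: "dil d E2_series ^ 2 = dil d E4_series - 288 * dil d (qdiff (sigma_fps 1))" if "d > 0" for d
    using that by (simp add: dil_power[symmetric] E2_series_square dil_diff dil_mult dil_numeral)
  have l: "dil d E2_series = 1 - 24 * dil d (sigma_fps 1)" if "d > 0" for d
    using that by (simp add: E2_series_eq dil_diff dil_mult dil_numeral dil_1)
  have e: "level22_E2 = 2 * dil 2 E2_series - 11 * dil 11 E2_series"
    by (rule fps_ext) (simp add: level22_E2_def fps_mult_numeral_left)
  have "level22_E2\<^sup>2 = 4 * dil 2 E2_series ^ 2 + 121 * dil 11 E2_series ^ 2 - 44 * (dil 2 E2_series * dil 11 E2_series)"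
    unfolding e by (simp add: power2_eq_square algebra_simps)
  then show ?thesis by (simp only: sq zero_less_numeral) (simp only: l zero_less_numeral)
qed

theorem theorem3p3:
  fixes n :: nat
  assumes "n > 0"
  shows "of_nat (W 2 11 n) =
      - (5/488) * sigmaQ 3 (of_nat n) + (5/366) * sigmaQ 3 (of_nat n / 2)
      + (137/1464) * sigmaQ 3 (of_nat n / 11) + (39/122) * sigmaQ 3 (of_nat n / 22)
      + (1/24 - of_nat n / 44) * sigmaQ 1 (of_nat n / 2)
      + (1/24 - of_nat n / 8) * sigmaQ 1 (of_nat n / 11)
      - (16/671) * b1 n - (1241/5368) * b2 n - (4029/5368) * b3 n
      - (668/671) * b4 n - (362/671) * b5 n + (7/8) * b6 n + (3/88) * b7 n"
proof -
  define s3 s1 where "s3 = (\<lambda>d. sigmaQ 3 (of_nat n / of_nat d))" and "s1 = (\<lambda>d. sigmaQ 1 (of_nat n / of_nat d))"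
  have E4: "fps_nth (dil d E4_series) n = of_rat (240 * s3 d)" and S: "fps_nth (dil d (sigma_fps 1)) n = of_rat (s1 d)"
    and X: "fps_nth (dil d (qdiff (sigma_fps 1))) n = of_rat (of_nat n / of_nat d * s1 d)" if "d > 0" for d
    using that assms
    by (auto simp: E4_series_eq dil_nth s3_def s1_def sigmaQ_div sigma_fps_def fps_nth_qdiff fps_mult_numeral_left fps_one_nth
        of_rat_mult of_rat_divide dvd_div_eq_0_iff elim!: dvdE)
  have V1: "fps_nth E4_series n = of_rat (240 * s3 1)" using E4[of 1] by (simp add: dil_def)
  have B: "fps_nth (fps_X ^ 1 * eta_fps L1) n = of_rat (b1 n)" "fps_nth (fps_X ^ 2 * eta_fps L2) n = of_rat (b2 n)"
    "fps_nth (fps_X ^ 3 * eta_fps L3) n = of_rat (b3 n)" "fps_nth (fps_X ^ 4 * eta_fps L4) n = of_rat (b4 n)"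
    "fps_nth (fps_X ^ 5 * eta_fps L5) n = of_rat (b5 n)" "fps_nth (fps_X ^ 6 * eta_fps L6) n = of_rat (b6 n)"
    "fps_nth (fps_X ^ 1 * eta_fps L7) n = of_rat (b7 n)"
    unfolding b1_def b2_def b3_def b4_def b5_def b6_def b7_def by (rule eta_quot_coeff_eq[symmetric]; auto)+
  define w where "w = (of_nat (W 2 11 n) :: rat)"
  have w: "fps_nth (dil 2 (sigma_fps 1) * dil 11 (sigma_fps 1)) n = of_rat w" by (simp add: w_def W_eq_nth)
  \<comment> \<open>Coefficients of the dilated series q d/dq of sigma; they bring n into the
    factors of sigma(n/2) and sigma(n/11).\<close>
  define u2 u11 where "u2 = of_nat n / 2 * s1 2" and "u11 = of_nat n / 11 * s1 11"
  have Xd: "fps_nth (dil 2 (qdiff (sigma_fps 1))) n = of_rat u2" "fps_nth (dil 11 (qdiff (sigma_fps 1))) n = of_rat u11"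
    using X[of 2] X[of 11] by (simp_all add: u2_def u11_def)
  have "level22_E2\<^sup>2 = 4 * dil 2 E4_series - 1152 * dil 2 (qdiff (sigma_fps 1)) + 121 * dil 11 E4_series - 34848 * dil 11 (qdiff (sigma_fps 1))
     - 44 + 1056 * dil 2 (sigma_fps 1) + 1056 * dil 11 (sigma_fps 1) - 25344 * (dil 2 (sigma_fps 1) * dil 11 (sigma_fps 1))"
    unfolding level22_E2_square by (simp add: algebra_simps)
  then have E: "fps_nth (level22_E2\<^sup>2) n = of_rat (4 * (240 * s3 2) - 1152 * u2 + 121 * (240 * s3 11)
     - 34848 * u11 + 1056 * s1 2 + 1056 * s1 11 - 25344 * w)"
    using E4[of 2] E4[of 11] S[of 2] S[of 11] Xd w assms
    by (simp add: fps_mult_numeral_left of_rat_add of_rat_diff of_rat_mult of_rat_divide fps_numeral_nth)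
  have "of_rat (305 * (4 * (240 * s3 2) - 1152 * u2 + 121 * (240 * s3 11)
     - 34848 * u11 + 1056 * s1 2 + 1056 * s1 11 - 25344 * w)
     - 330 * (240 * s3 1) - 780 * (240 * s3 2) - 33891 * (240 * s3 11) + 10296 * (240 * s3 22)
     - 184320 * b1 n - 1787040 * b2 n - 5801760 * b3 n - 7695360 * b4 n - 4170240 * b5 n
     + 6763680 * b6 n + 263520 * b7 n) = fps_nth (fps_A + fps_C) n"
    using E4[of 2] E4[of 11] E4[of 22] V1 E B unfolding fps_A_def fps_C_def
    by (simp add: of_rat_add of_rat_diff of_rat_mult of_rat_minus del: fps_const_neg power_one_right)
  also have "\<dots> = 0" by (simp add: fps_A_C_zero)
  finally have "305 * (4 * (240 * s3 2) - 1152 * u2 + 121 * (240 * s3 11)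
     - 34848 * u11 + 1056 * s1 2 + 1056 * s1 11 - 25344 * w)
     - 330 * (240 * s3 1) - 780 * (240 * s3 2) - 33891 * (240 * s3 11) + 10296 * (240 * s3 22)
     - 184320 * b1 n - 1787040 * b2 n - 5801760 * b3 n - 7695360 * b4 n - 4170240 * b5 n
     + 6763680 * b6 n + 263520 * b7 n = 0" by simp
  moreover have "sigmaQ 3 (of_nat n) = s3 1" "sigmaQ 3 (of_nat n / 2) = s3 2" "sigmaQ 3 (of_nat n / 11) = s3 11"
    "sigmaQ 3 (of_nat n / 22) = s3 22" "sigmaQ 1 (of_nat n / 2) = s1 2" "sigmaQ 1 (of_nat n / 11) = s1 11"
    by (simp_all add: s3_def s1_def)
  ultimately show ?thesis unfolding w_def[symmetric] u2_def u11_def by (simp add: field_simps)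
qed

end
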